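(* Let $A$ be a finite-dimensional Hopf algebra over an algebraically closed field $\mathbb{F}$ with $\ell+1$ isomorphism classes of simple modules, and let $V$ be an $A$-module. The following are equivalent: (i) $\overline{L_V}$ is a nonsingular $M$-matrix; (ii) $\overline{L_V}$ is nonsingular; (iii) $L_V$ has rank $\ell$ (so nullity $1$); (iv) the critical group $K(V)$ is finite; (v) $V$ is tensor-rich.
   Context: All modules are finite-dimensional left $A$-modules, tensor products are over $\mathbb{F}$ with action via the coproduct $\Delta(a)=\sum a_1\otimes a_2$, and $\epsilon$ denotes the trivial module ($\mathbb{F}$ with $a$ acting by the counit $\epsilon(a)$). Let $S_1,\dots,S_{\ell+1}$ be the simple $A$-modules, indexed so that $S_{\ell+1}=\epsilon$, and $[W:S_i]$ the multiplicity of $S_i$ as a composition factor of $W$. For $n=\dim V$, the McKay matrix $M_V\in\mathbb{Z}^{(\ell+1)\times(\ell+1)}$ has $(M_V)_{i,j}=[S_j\otimes V:S_i]$, $L_V:=nI_{\ell+1}-M_V$, and $\overline{L_V}\in\mathbb{Z}^{\ell\times\ell}$ is obtained from $L_V$ by deleting the row and column indexed by $\epsilon$. A real square matrix $Q$ with nonpositive off-diagonal entries is a nonsingular $M$-matrix if it is invertible and $Q^{-1}$ has all entries nonnegative. $V$ is rich if $[V:S_i]>0$ for all $i$, and tensor-rich if $\bigoplus_{k=0}^tV^{\otimes k}$ is rich for some positive integer $t$. The critical group: $G_0(A)$ is the Grothendieck group (relations from short exact sequences), a ring via $[W][X]=[W\otimes X]$, with augmentation $[W]\mapsto\dim W$ and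 augmentation ideal $I$; $K(V):=I/G_0(A)(n-[V])$. *)

theory Defs
  imports "Jordan_Normal_Form.DL_Rank" "HOL-Computational_Algebra.Polynomial"
begin

text \<open>A finite-dimensional Hopf algebra A over a field with basis e_0,...,e_(d-1):
  e_i e_j = sum_k hmult i j k e_k, 1 = sum_k hunit k e_k,
  Delta(e_i) = sum_(j,k) hcomult i j k (e_j (x) e_k), eps(e_i) = hcounit i,
  S(e_i) = sum_j hantipode i j e_j.\<close>

record 'f hopf_data =
  hdim :: nat
  hmult :: "nat \<Rightarrow> nat \<Rightarrow> nat \<Rightarrow> 'f"
  hunit :: "nat \<Rightarrow> 'f"
  hcomult :: "nat \<Rightarrow> nat \<Rightarrow> nat \<Rightarrow> 'f"
  hcounit :: "nat \<Rightarrow> 'f"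
  hantipode :: "nat \<Rightarrow> nat \<Rightarrow> 'f"

definition alg_closed_field :: "'f::field itself \<Rightarrow> bool" where
  "alg_closed_field _ \<longleftrightarrow> (\<forall>p :: 'f poly. degree p > 0 \<longrightarrow> (\<exists>x. poly p x = 0))"

definition kd :: "nat \<Rightarrow> nat \<Rightarrow> 'f::field" where
  "kd i j = (if i = j then 1 else 0)"

definition hopf :: "'f::field hopf_data \<Rightarrow> bool" where
  "hopf H \<longleftrightarrow>
    (let d = hdim H; m = hmult H; u = hunit H; c = hcomult H; e = hcounit H; s = hantipode H in
     \<comment> \<open>associativity\<close>
     (\<forall>i<d. \<forall>j<d. \<forall>l<d. \<forall>p<d.
        (\<Sum>k<d. m i j k * m k l p) = (\<Sum>k<d. m j l k * m i k p)) \<and>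
     \<comment> \<open>unit\<close>
     (\<forall>j<d. \<forall>p<d. (\<Sum>k<d. u k * m k j p) = kd j p \<and> (\<Sum>k<d. u k * m j k p) = kd j p) \<and>
     \<comment> \<open>coassociativity\<close>
     (\<forall>i<d. \<forall>a<d. \<forall>b<d. \<forall>q<d.
        (\<Sum>j<d. c i j q * c j a b) = (\<Sum>k<d. c i a k * c k b q)) \<and>
     \<comment> \<open>counit\<close>
     (\<forall>i<d. \<forall>k<d. (\<Sum>j<d. c i j k * e j) = kd i k \<and> (\<Sum>j<d. c i k j * e j) = kd i k) \<and>
     \<comment> \<open>comultiplication is an algebra map\<close>
     (\<forall>i<d. \<forall>j<d. \<forall>p<d. \<forall>q<d.
        (\<Sum>k<d. m i j k * c k p q) =
        (\<Sum>a<d. \<Sum>b<d. \<Sum>a'<d. \<Sum>b'<d. c i a b * c j a' b' * m a a' p * m b b' q)) \<and>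
     (\<forall>p<d. \<forall>q<d. (\<Sum>k<d. u k * c k p q) = u p * u q) \<and>
     \<comment> \<open>counit is an algebra map\<close>
     (\<forall>i<d. \<forall>j<d. (\<Sum>k<d. m i j k * e k) = e i * e j) \<and>
     (\<Sum>k<d. u k * e k) = 1 \<and>
     \<comment> \<open>antipode\<close>
     (\<forall>i<d. \<forall>p<d.
        (\<Sum>j<d. \<Sum>k<d. \<Sum>a<d. c i j k * s j a * m a k p) = e i * u p \<and>
        (\<Sum>j<d. \<Sum>k<d. \<Sum>a<d. c i j k * s k a * m j a p) = e i * u p))"

text \<open>A module of dimension n: the basis element e_i acts on F^n by the matrix
  (act i p q)_(p,q<n). Vectors of F^n are functions nat => F vanishing from n on.\<close>

record 'f amod =
  mdim :: nat
  act :: "nat \<Rightarrow> nat \<Rightarrow> nat \<Rightarrow> 'f"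

definition is_module :: "'f::field hopf_data \<Rightarrow> 'f amod \<Rightarrow> bool" where
  "is_module H M \<longleftrightarrow>
    (let d = hdim H; n = mdim M; r = act M in
      (\<forall>i<d. \<forall>j<d. \<forall>p<n. \<forall>q<n.
         (\<Sum>t<n. r i p t * r j t q) = (\<Sum>k<d. hmult H i j k * r k p q)) \<and>
      (\<forall>p<n. \<forall>q<n. (\<Sum>k<d. hunit H k * r k p q) = kd p q))"

definition vecs :: "nat \<Rightarrow> (nat \<Rightarrow> 'f::field) set" where
  "vecs n = {v. \<forall>p\<ge>n. v p = 0}"

definition actv :: "'f::field amod \<Rightarrow> nat \<Rightarrow> (nat \<Rightarrow> 'f) \<Rightarrow> (nat \<Rightarrow> 'f)" where
  "actv M i v = (\<lambda>p. if p < mdim M then (\<Sum>q<mdim M. act M i p q * v q) else 0)"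

definition subspace_of :: "nat \<Rightarrow> (nat \<Rightarrow> 'f::field) set \<Rightarrow> bool" where
  "subspace_of n U \<longleftrightarrow> U \<subseteq> vecs n \<and> (\<lambda>_. 0) \<in> U \<and>
     (\<forall>v\<in>U. \<forall>w\<in>U. (\<lambda>p. v p + w p) \<in> U) \<and> (\<forall>a. \<forall>v\<in>U. (\<lambda>p. a * v p) \<in> U)"

definition submodule_of :: "'f::field hopf_data \<Rightarrow> 'f amod \<Rightarrow> (nat \<Rightarrow> 'f) set \<Rightarrow> bool" where
  "submodule_of H M U \<longleftrightarrow> subspace_of (mdim M) U \<and> (\<forall>i<hdim H. \<forall>v\<in>U. actv M i v \<in> U)"

definition simple_mod :: "'f::field hopf_data \<Rightarrow> 'f amod \<Rightarrow> bool" where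
  "simple_mod H M \<longleftrightarrow> is_module H M \<and> mdim M > 0 \<and>
     (\<forall>U. submodule_of H M U \<longrightarrow> U = {\<lambda>_. 0} \<or> U = vecs (mdim M))"

text \<open>The subquotient U'/U of M (U \<subseteq> U' submodules) is isomorphic to the module S:
  there is a linear map U' \<rightarrow> F^(dim S), onto, with kernel U, intertwining the actions.\<close>

definition subquot_iso ::
  "'f::field hopf_data \<Rightarrow> 'f amod \<Rightarrow> (nat \<Rightarrow> 'f) set \<Rightarrow> (nat \<Rightarrow> 'f) set \<Rightarrow> 'f amod \<Rightarrow> bool" where
  "subquot_iso H M U U' S \<longleftrightarrow>
    (\<exists>\<Phi> :: nat \<Rightarrow> nat \<Rightarrow> 'f.
      let \<phi> = (\<lambda>v. \<lambda>p. if p < mdim S then (\<Sum>q<mdim M. \<Phi> p q * v q) else 0) in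
      \<phi> ` U' = vecs (mdim S) \<and> {v\<in>U'. \<phi> v = (\<lambda>_. 0)} = U \<and>
      (\<forall>i<hdim H. \<forall>v\<in>U'. \<phi> (actv M i v) = actv S i (\<phi> v)))"

definition mod_iso :: "'f::field hopf_data \<Rightarrow> 'f amod \<Rightarrow> 'f amod \<Rightarrow> bool" where
  "mod_iso H M N \<longleftrightarrow> subquot_iso H M {\<lambda>_. 0} (vecs (mdim M)) N"

definition comp_series :: "'f::field hopf_data \<Rightarrow> 'f amod \<Rightarrow> (nat \<Rightarrow> 'f) set list \<Rightarrow> bool" where
  "comp_series H M Us \<longleftrightarrow> Us \<noteq> [] \<and> hd Us = {\<lambda>_. 0} \<and> last Us = vecs (mdim M) \<and>
     (\<forall>j<length Us. submodule_of H M (Us ! j)) \<and>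
     (\<forall>j. Suc j < length Us \<longrightarrow> Us ! j \<subset> Us ! Suc j \<and>
        (\<forall>W. submodule_of H M W \<longrightarrow> Us ! j \<subseteq> W \<longrightarrow> W \<subseteq> Us ! Suc j \<longrightarrow>
             W = Us ! j \<or> W = Us ! Suc j))"

text \<open>Composition multiplicity [M:S] (well defined by Jordan--Hoelder).\<close>

definition comp_mult :: "'f::field hopf_data \<Rightarrow> 'f amod \<Rightarrow> 'f amod \<Rightarrow> nat" where
  "comp_mult H M S = (let Us = (SOME Us. comp_series H M Us) in
     card {j. Suc j < length Us \<and> subquot_iso H M (Us ! j) (Us ! Suc j) S})"

definition triv_mod :: "'f::field hopf_data \<Rightarrow> 'f amod" where
  "triv_mod H = \<lparr>mdim = 1, act = (\<lambda>i p q. hcounit H i)\<rparr>"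

definition tensor_mod :: "'f::field hopf_data \<Rightarrow> 'f amod \<Rightarrow> 'f amod \<Rightarrow> 'f amod" where
  "tensor_mod H V W = \<lparr>mdim = mdim V * mdim W,
     act = (\<lambda>i p q. \<Sum>j<hdim H. \<Sum>k<hdim H. hcomult H i j k *
             act V j (p div mdim W) (q div mdim W) * act W k (p mod mdim W) (q mod mdim W))\<rparr>"

definition dsum_mod :: "'f::field amod \<Rightarrow> 'f amod \<Rightarrow> 'f amod" where
  "dsum_mod V W = \<lparr>mdim = mdim V + mdim W,
     act = (\<lambda>i p q. if p < mdim V \<and> q < mdim V then act V i p q
                    else if mdim V \<le> p \<and> mdim V \<le> q then act W i (p - mdim V) (q - mdim V)
                    else 0)\<rparr>"

fun tensor_pow :: "'f::field hopf_data \<Rightarrow> 'f amod \<Rightarrow> nat \<Rightarrow> 'f amod" where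
  "tensor_pow H V 0 = triv_mod H"
| "tensor_pow H V (Suc k) = tensor_mod H (tensor_pow H V k) V"

fun tensor_pow_sum :: "'f::field hopf_data \<Rightarrow> 'f amod \<Rightarrow> nat \<Rightarrow> 'f amod" where
  "tensor_pow_sum H V 0 = tensor_pow H V 0"
| "tensor_pow_sum H V (Suc t) = dsum_mod (tensor_pow_sum H V t) (tensor_pow H V (Suc t))"

definition simple_classes :: "'f::field hopf_data \<Rightarrow> nat \<Rightarrow> (nat \<Rightarrow> 'f amod) \<Rightarrow> bool" where
  "simple_classes H l S \<longleftrightarrow>
     (\<forall>i\<le>l. simple_mod H (S i)) \<and>
     (\<forall>i\<le>l. \<forall>j\<le>l. mod_iso H (S i) (S j) \<longrightarrow> i = j) \<and>
     (\<forall>M. simple_mod H M \<longrightarrow> (\<exists>i\<le>l. mod_iso H M (S i))) \<and>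
     S l = triv_mod H"

definition mckay :: "'f::field hopf_data \<Rightarrow> nat \<Rightarrow> (nat \<Rightarrow> 'f amod) \<Rightarrow> 'f amod \<Rightarrow> int mat" where
  "mckay H l S V = mat (l+1) (l+1) (\<lambda>(i,j). int (comp_mult H (tensor_mod H (S j) V) (S i)))"

definition laplacian :: "'f::field hopf_data \<Rightarrow> nat \<Rightarrow> (nat \<Rightarrow> 'f amod) \<Rightarrow> 'f amod \<Rightarrow> int mat" where
  "laplacian H l S V = mat (l+1) (l+1)
     (\<lambda>(i,j). (if i = j then int (mdim V) else 0) - mckay H l S V $$ (i,j))"

text \<open>Delete the row and column of the trivial module (index l).\<close>
definition red_laplacian :: "'f::field hopf_data \<Rightarrow> nat \<Rightarrow> (nat \<Rightarrow> 'f amod) \<Rightarrow> 'f amod \<Rightarrow> int mat" where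
  "red_laplacian H l S V = mat l l (\<lambda>(i,j). laplacian H l S V $$ (i,j))"

definition nonsingular_M_matrix :: "real mat \<Rightarrow> bool" where
  "nonsingular_M_matrix Q \<longleftrightarrow> square_mat Q \<and>
     (\<forall>i<dim_row Q. \<forall>j<dim_row Q. i \<noteq> j \<longrightarrow> Q $$ (i,j) \<le> 0) \<and>
     (\<exists>B \<in> carrier_mat (dim_row Q) (dim_row Q). inverts_mat Q B \<and> inverts_mat B Q \<and>
        (\<forall>i<dim_row Q. \<forall>j<dim_row Q. B $$ (i,j) \<ge> 0))"

definition rich :: "'f::field hopf_data \<Rightarrow> nat \<Rightarrow> (nat \<Rightarrow> 'f amod) \<Rightarrow> 'f amod \<Rightarrow> bool" where
  "rich H l S W \<longleftrightarrow> (\<forall>i\<le>l. comp_mult H W (S i) > 0)"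

definition tensor_rich :: "'f::field hopf_data \<Rightarrow> nat \<Rightarrow> (nat \<Rightarrow> 'f amod) \<Rightarrow> 'f amod \<Rightarrow> bool" where
  "tensor_rich H l S V \<longleftrightarrow> (\<exists>t>0. rich H l S (tensor_pow_sum H V t))"

text \<open>G_0(A) is identified (Jordan--Hoelder) with the free abelian group on the classes
  [S_0],...,[S_l]: elements are x : nat => int with x i = 0 for i > l; the class of a module W
  is the vector of its composition multiplicities; the product is induced by the tensor product.\<close>

definition G0 :: "nat \<Rightarrow> (nat \<Rightarrow> int) set" where
  "G0 l = {x. \<forall>i>l. x i = 0}"

definition gclass :: "'f::field hopf_data \<Rightarrow> nat \<Rightarrow> (nat \<Rightarrow> 'f amod) \<Rightarrow> 'f amod \<Rightarrow> nat \<Rightarrow> int" where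
  "gclass H l S W = (\<lambda>i. if i \<le> l then int (comp_mult H W (S i)) else 0)"

definition gmul :: "'f::field hopf_data \<Rightarrow> nat \<Rightarrow> (nat \<Rightarrow> 'f amod) \<Rightarrow>
    (nat \<Rightarrow> int) \<Rightarrow> (nat \<Rightarrow> int) \<Rightarrow> nat \<Rightarrow> int" where
  "gmul H l S x y = (\<lambda>i. if i \<le> l then
      (\<Sum>j\<le>l. \<Sum>k\<le>l. x j * y k * int (comp_mult H (tensor_mod H (S j) (S k)) (S i))) else 0)"

definition aug_ideal :: "nat \<Rightarrow> (nat \<Rightarrow> 'f::field amod) \<Rightarrow> (nat \<Rightarrow> int) set" where
  "aug_ideal l S = {x \<in> G0 l. (\<Sum>i\<le>l. x i * int (mdim (S i))) = 0}"

definition crit_rel :: "'f::field hopf_data \<Rightarrow> nat \<Rightarrow> (nat \<Rightarrow> 'f amod) \<Rightarrow> 'f amod \<Rightarrow> (nat \<Rightarrow> int) set" where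
  "crit_rel H l S V = {gmul H l S x (\<lambda>i. int (mdim V) * gclass H l S (triv_mod H) i - gclass H l S V i)
                        | x. x \<in> G0 l}"

definition critical_group :: "'f::field hopf_data \<Rightarrow> nat \<Rightarrow> (nat \<Rightarrow> 'f amod) \<Rightarrow> 'f amod \<Rightarrow> (nat \<Rightarrow> int) set set" where
  "critical_group H l S V = (\<lambda>x. {(\<lambda>i. x i + y i) | y. y \<in> crit_rel H l S V}) ` aug_ideal l S"

end

theory Submission
  imports Defs "HOL-Library.Function_Algebras"
begin

text \<open>
  Let \<open>s\<close> be the vector of dimensions of the simple modules and \<open>c\<close> the class of the regular
  module \<open>A\<close>. Both are positive, \<open>s M\<^sub>V = n s\<close>, and \<open>M\<^sub>V c = n c\<close> because \<open>A \<otimes> V\<close> is free of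
  rank \<open>n = dim V\<close>. Pairing with \<open>s\<close> shows that \<open>M x \<ge> n x\<close> forces \<open>M x = n x\<close>, and dually
  for \<open>c\<close>; this replaces all Perron--Frobenius theory. A kernel vector of the reduced matrix extends
  by zero to one of \<open>L\<^sub>V\<close>, independent of \<open>c\<close>, which gives the rank statement. Negative parts of
  solutions of \<open>L x \<ge> 0\<close> are harmonic, which gives the nonnegative inverse. The absolute value
  of a left kernel vector \<open>y\<close> with \<open>y \<epsilon> = 0\<close> is harmonic and therefore vanishes at every simple
  module that occurs in some \<open>V\<^sup>\<otimes>\<^sup>k\<close>, while restricting \<open>c\<close> to the simple modules that do
  not occur yields a right kernel vector: this is tensor-richness. Finally \<open>det\<close> times the augmentation
  ideal lies in the image of \<open>L\<^sub>V\<close>, whereas a left kernel vector is a nonzero functional on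
  the critical group.
\<close>

section \<open>Nonnegative matrices with positive eigenvectors\<close>

text \<open>\<open>comp_mult\<close> counts the factors of an arbitrarily chosen composition series,
  so every use of a multiplicity rests on Jordan-Hoelder, proved below for chains of submodules of
  \<open>vecs n\<close>. The regular class is an eigenvector because the diagonal action on A
  \<otimes> V can be straightened: a \<otimes> v \<mapsto> a1 \<otimes> a2 v turns the action on the
  first factor alone into the diagonal one, and the antipode supplies the inverse. Its entries are
  positive since each simple module is a quotient of A, while the equation for \<open>s\<close> is
  multiplicativity of dimension.\<close>

locale positive_kernel =
  fixes l :: nat and n :: "'a::linordered_idom" and M :: "nat \<Rightarrow> nat \<Rightarrow> 'a" and s c :: "nat \<Rightarrow> 'a"
  assumes M_nonneg: "\<And>i j. i \<le> l \<Longrightarrow> j \<le> l \<Longrightarrow> 0 \<le> M i j"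
    and s_pos: "\<And>i. i \<le> l \<Longrightarrow> 0 < s i"
    and c_pos: "\<And>i. i \<le> l \<Longrightarrow> 0 < c i"
    and s_M: "\<And>j. j \<le> l \<Longrightarrow> (\<Sum>i\<le>l. s i * M i j) = n * s j"
    and M_c: "\<And>i. i \<le> l \<Longrightarrow> (\<Sum>j\<le>l. M i j * c j) = n * c i"
begin

text \<open>Transposing exchanges the two eigenvectors, so every statement about right kernel
  vectors has a left counterpart for free.\<close>

lemma dual: "positive_kernel l n (\<lambda>i j. M j i) c s"
  by unfold_locales (use M_nonneg s_pos c_pos s_M M_c in \<open>auto simp: mult.commute\<close>)

lemma s_pairing: "(\<Sum>i\<le>l. s i * (\<Sum>j\<le>l. M i j * x j)) = (\<Sum>j\<le>l. s j * (n * x j))"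
proof -
  have "(\<Sum>i\<le>l. s i * (\<Sum>j\<le>l. M i j * x j)) = (\<Sum>j\<le>l. \<Sum>i\<le>l. s i * M i j * x j)"
    by (subst sum.swap) (simp add: sum_distrib_left mult.assoc)
  also have "\<dots> = (\<Sum>j\<le>l. (\<Sum>i\<le>l. s i * M i j) * x j)" by (simp add: sum_distrib_right)
  also have "\<dots> = (\<Sum>j\<le>l. s j * (n * x j))" by (rule sum.cong) (simp_all add: s_M mult_ac)
  finally show ?thesis .
qed

text \<open>The defects \<open>M x - n x\<close> are nonnegative and their sum weighted by the
  positive \<open>s\<close> is 0, so each of them is 0.\<close>

lemma subharmonic_eq:
  assumes "\<And>i. i \<le> l \<Longrightarrow> n * x i \<le> (\<Sum>j\<le>l. M i j * x j)" and "i \<le> l"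
  shows "(\<Sum>j\<le>l. M i j * x j) = n * x i"
proof -
  have "(\<Sum>i\<le>l. s i * ((\<Sum>j\<le>l. M i j * x j) - n * x i)) = 0"
    using s_pairing[of x] by (simp add: right_diff_distrib sum_subtractf)
  then have "s i * ((\<Sum>j\<le>l. M i j * x j) - n * x i) = 0"
    using assms by (subst (asm) sum_nonneg_eq_0_iff) (auto intro!: mult_nonneg_nonneg less_imp_le[OF s_pos])
  then show ?thesis using s_pos[OF assms(2)] by simp
qed

text \<open>The defects satisfy one linear relation with the positive coefficients \<open>s\<close>,
  so the equation of the deleted row follows from the others.\<close>

lemma harmonic_at_l:
  assumes "\<And>i. i < l \<Longrightarrow> (\<Sum>j\<le>l. M i j * x j) = n * x i"
  shows "(\<Sum>j\<le>l. M l j * x j) = n * x l"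
proof -
  have "(\<Sum>i\<le>l. s i * ((\<Sum>j\<le>l. M i j * x j) - n * x i)) = 0"
    using s_pairing[of x] by (simp add: right_diff_distrib sum_subtractf)
  moreover have "(\<Sum>i\<le>l. s i * ((\<Sum>j\<le>l. M i j * x j) - n * x i))
      = s l * ((\<Sum>j\<le>l. M l j * x j) - n * x l)"
    using assms by (subst sum.remove[of _ l]) auto
  ultimately show ?thesis using s_pos[of l] by simp
qed

definition red :: "'a mat" where
  "red = mat l l (\<lambda>(i,j). (if i = j then n else 0) - M i j)"

definition lap :: "'a mat" where
  "lap = mat (l+1) (l+1) (\<lambda>(i,j). (if i = j then n else 0) - M i j)"

lemma red_carrier[simp]: "red \<in> carrier_mat l l" by (simp add: red_def)
lemma lap_carrier[simp]: "lap \<in> carrier_mat (l+1) (l+1)" by (simp add: lap_def)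

lemma sum_delta_diff: "i \<in> A \<Longrightarrow> finite A \<Longrightarrow>
    (\<Sum>j\<in>A. ((if i = j then n else 0) - M i j) * x j) = n * x i - (\<Sum>j\<in>A. M i j * x j)"
  by (simp add: left_diff_distrib sum_subtractf if_distrib[of "\<lambda>t. t * _"] cong: if_cong)

lemma red_mult:
  assumes "i < l" and "x l = 0"
  shows "(red *\<^sub>v vec l x) $ i = n * x i - (\<Sum>j\<le>l. M i j * x j)"
proof -
  have "(red *\<^sub>v vec l x) $ i = (\<Sum>j\<in>{0..<l}. ((if i = j then n else 0) - M i j) * x j)"
    using assms by (simp add: red_def scalar_prod_def)
  also have "\<dots> = n * x i - (\<Sum>j\<in>{0..<l}. M i j * x j)" using assms by (intro sum_delta_diff) auto
  also have "(\<Sum>j\<in>{0..<l}. M i j * x j) = (\<Sum>j\<le>l. M i j * x j)"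
    using assms by (simp add: lessThan_Suc_atMost[symmetric] lessThan_atLeast0)
  finally show ?thesis .
qed

lemma lap_mult:
  assumes "i \<le> l"
  shows "(lap *\<^sub>v vec (l+1) x) $ i = n * x i - (\<Sum>j\<le>l. M i j * x j)"
proof -
  have "(lap *\<^sub>v vec (l+1) x) $ i = (\<Sum>j\<in>{0..<l+1}. ((if i = j then n else 0) - M i j) * x j)"
    using assms by (simp add: lap_def scalar_prod_def)
  also have "\<dots> = n * x i - (\<Sum>j\<in>{0..<l+1}. M i j * x j)" using assms by (intro sum_delta_diff) auto
  also have "{0..<l+1} = {..l}" by auto
  finally show ?thesis .
qed

text \<open>Deleting column \<open>l\<close> amounts to \<open>x l = 0\<close>, and the deleted row
  is recovered by \<open>harmonic_at_l\<close>. Singularity is detected by kernel vectors over any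
  integral domain, so the criterion serves the integers and the reals alike.\<close>

lemma det_red_zero_iff:
  "det red = 0 \<longleftrightarrow> (\<exists>x. x l = 0 \<and> (\<exists>i<l. x i \<noteq> 0) \<and> (\<forall>i\<le>l. (\<Sum>j\<le>l. M i j * x j) = n * x i))"
proof
  assume "det red = 0"
  then obtain v where v: "v \<in> carrier_vec l" "v \<noteq> 0\<^sub>v l" "red *\<^sub>v v = 0\<^sub>v l"
    using det_0_iff_vec_prod_zero[OF red_carrier] by blast
  define x where "x = (\<lambda>i. if i < l then v $ i else 0)"
  have vx: "v = vec l x" using v(1) by (auto simp: x_def)
  have x0: "x l = 0" by (simp add: x_def)
  have "\<exists>i<l. x i \<noteq> 0" using v(2) unfolding vx by (auto simp: vec_eq_iff)
  moreover have h: "(\<Sum>j\<le>l. M i j * x j) = n * x i" if "i < l" for i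
    using red_mult[of i x] x0 that v(3) unfolding vx by simp
  moreover have "(\<Sum>j\<le>l. M l j * x j) = n * x l" using h by (rule harmonic_at_l)
  ultimately show "\<exists>x. x l = 0 \<and> (\<exists>i<l. x i \<noteq> 0) \<and> (\<forall>i\<le>l. (\<Sum>j\<le>l. M i j * x j) = n * x i)"
    using x0 by (intro exI[of _ x]) (auto simp: le_less)
next
  assume "\<exists>x. x l = 0 \<and> (\<exists>i<l. x i \<noteq> 0) \<and> (\<forall>i\<le>l. (\<Sum>j\<le>l. M i j * x j) = n * x i)"
  then obtain x i where x: "x l = 0" "i < l" "x i \<noteq> 0" "\<forall>i\<le>l. (\<Sum>j\<le>l. M i j * x j) = n * x i" by blast
  have "red *\<^sub>v vec l x = 0\<^sub>v l"
    by (rule eq_vecI) (use x red_mult in \<open>auto simp: red_def simp del: index_mult_mat_vec\<close>)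
  moreover have "vec l x \<noteq> 0\<^sub>v l" using x by (auto simp: vec_eq_iff)
  ultimately show "det red = 0"
    using det_0_iff_vec_prod_zero[OF red_carrier] by (metis vec_carrier)
qed

lemma det_red_zero_iff_left:
  "det red = 0 \<longleftrightarrow> (\<exists>y. y l = 0 \<and> (\<exists>i<l. y i \<noteq> 0) \<and> (\<forall>j\<le>l. (\<Sum>i\<le>l. y i * M i j) = n * y j))"
proof -
  interpret d: positive_kernel l n "\<lambda>i j. M j i" c s by (rule dual)
  have "d.red = transpose_mat red" by (auto simp: d.red_def red_def)
  then have "det red = det d.red" using det_transpose[OF red_carrier] by simp
  then show ?thesis using d.det_red_zero_iff by (simp add: mult.commute)
qed

text \<open>The negative part of a solution is again harmonic: pairing with \<open>s\<close> turns the
  inequality \<open>M m \<ge> n m\<close> into an equality.\<close>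

lemma red_inverse_nonneg:
  assumes "det red \<noteq> 0" and "x l = 0"
    and b: "\<And>i. i < l \<Longrightarrow> (\<Sum>j\<le>l. M i j * x j) \<le> n * x i" and "i < l"
  shows "0 \<le> x i"
proof (rule ccontr)
  assume "\<not> 0 \<le> x i"
  define m where "m = (\<lambda>i. max (- x i) 0)"
  have m0: "m l = 0" by (simp add: m_def assms(2))
  have sub: "n * m k \<le> (\<Sum>j\<le>l. M k j * m j)" if "k \<le> l" for k
  \<comment> \<open>Where \<open>x\<close> is negative, \<open>b\<close> gives the bound after
    \<open>- x\<close> is replaced by the larger \<open>m\<close>; elsewhere, including the index
    \<open>l\<close> that \<open>b\<close> does not cover, \<open>m\<close> vanishes.\<close>
  proof (cases "k < l \<and> x k < 0")
    case True
    have "n * m k = - (n * x k)" using True by (simp add: m_def)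
    also have "\<dots> \<le> (\<Sum>j\<le>l. M k j * (- x j))" using b[of k] True by (simp add: sum_negf)
    also have "\<dots> \<le> (\<Sum>j\<le>l. M k j * m j)"
      by (intro sum_mono mult_left_mono M_nonneg) (use that in \<open>auto simp: m_def\<close>)
    finally show ?thesis .
  next
    case False
    then have "m k = 0" using that assms(2) by (cases "k = l") (auto simp: m_def)
    moreover have "0 \<le> (\<Sum>j\<le>l. M k j * m j)"
      by (intro sum_nonneg mult_nonneg_nonneg M_nonneg) (use that in \<open>auto simp: m_def\<close>)
    ultimately show ?thesis by simp
  qed
  have "\<forall>i\<le>l. (\<Sum>j\<le>l. M i j * m j) = n * m i" using subharmonic_eq[OF sub] by blast
  moreover have "m i \<noteq> 0" using \<open>\<not> 0 \<le> x i\<close> by (simp add: m_def max_def)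
  ultimately have "det red = 0" using m0 \<open>i < l\<close> det_red_zero_iff by blast
  then show False using assms(1) by simp
qed

text \<open>The signed adjugate is \<bar>det\<bar> times the inverse, an integral substitute for it.
  Its k-th column solves \<open>red x = \<bar>det red\<bar> * unit_vec l k\<close>, whose right side
  is nonnegative, so \<open>red_inverse_nonneg\<close> applies.\<close>

lemma signed_adj_nonneg:
  assumes d: "det red \<noteq> 0" and i: "i < l" and k: "k < l"
  shows "0 \<le> sgn (det red) * adj_mat red $$ (i,k)"
proof -
  define x where "x = (\<lambda>i. if i < l then sgn (det red) * adj_mat red $$ (i,k) else 0)"
  have adj: "adj_mat red \<in> carrier_mat l l" "red * adj_mat red = det red \<cdot>\<^sub>m 1\<^sub>m l"
    using adj_mat[OF red_carrier] by auto
  have x0: "x l = 0" by (simp add: x_def)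
  have "vec l x = sgn (det red) \<cdot>\<^sub>v col (adj_mat red) k"
    using adj(1) k by (auto simp: x_def)
  then have "red *\<^sub>v vec l x = sgn (det red) \<cdot>\<^sub>v (red *\<^sub>v col (adj_mat red) k)"
    using adj(1) by (auto simp: scalar_prod_def red_def sum_distrib_left mult_ac intro!: eq_vecI)
  also have "red *\<^sub>v col (adj_mat red) k = col (red * adj_mat red) k"
    by (rule col_mult2[OF red_carrier adj(1) k, symmetric])
  also have "\<dots> = det red \<cdot>\<^sub>v unit_vec l k" using k by (auto simp: adj(2))
  finally have *: "red *\<^sub>v vec l x = sgn (det red) \<cdot>\<^sub>v (det red \<cdot>\<^sub>v unit_vec l k)" .
  have "(\<Sum>j\<le>l. M p j * x j) \<le> n * x p" if "p < l" for p
  proof -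
    have "n * x p - (\<Sum>j\<le>l. M p j * x j) = (sgn (det red) \<cdot>\<^sub>v (det red \<cdot>\<^sub>v unit_vec l k)) $ p"
      using red_mult[OF that, of x] x0 * by simp
    also have "\<dots> \<ge> 0" using that k d by (simp add: unit_vec_def sgn_if)
    finally show ?thesis by simp
  qed
  then have "0 \<le> x i" using red_inverse_nonneg[where x = x, OF d x0 _ i] by blast
  then show ?thesis using i by (simp add: x_def)
qed

text \<open>\<open>P k i\<close> stands for the multiplicity of \<open>S i\<close> in the k-th
  tensor power of V: \<open>P 0\<close> is the trivial module, and \<open>PS\<close> is
  multiplication by the McKay matrix.\<close>

lemma tensor_rich_iff:
  assumes P0: "\<And>i. P 0 i = (if i = l then 1 else 0)"
    and PS: "\<And>k i. i \<le> l \<Longrightarrow> P (Suc k) i = (\<Sum>j\<le>l. M i j * P k j)"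
  shows "(\<exists>t>0. \<forall>i\<le>l. \<exists>k\<le>t. 0 < P k i) \<longleftrightarrow> det red \<noteq> 0"
proof -
  have Pnn: "0 \<le> P k i" if "i \<le> l" for k i
    using that by (induction k arbitrary: i) (auto simp: P0 PS intro!: sum_nonneg mult_nonneg_nonneg M_nonneg)
  have "det red \<noteq> 0" if rich: "\<exists>t>0. \<forall>i\<le>l. \<exists>k\<le>t. 0 < P k i"
  proof
    assume "det red = 0"
    then obtain y i0 where y: "y l = 0" "i0 < l" "y i0 \<noteq> 0" "\<And>j. j \<le> l \<Longrightarrow> (\<Sum>i\<le>l. y i * M i j) = n * y j"
      unfolding det_red_zero_iff_left by blast
    interpret d: positive_kernel l n "\<lambda>i j. M j i" c s by (rule dual)
    define z where "z = (\<lambda>i. \<bar>y i\<bar>)"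
    \<comment> \<open>Nonnegativity of \<open>n\<close> gives \<bar>n y\<bar> = n \<bar>y\<bar>
      below.\<close>
    have n0: "0 \<le> n"
    proof -
      have "0 \<le> n * s l" unfolding s_M[OF order_refl, symmetric]
        by (intro sum_nonneg mult_nonneg_nonneg M_nonneg less_imp_le[OF s_pos]) auto
      then show ?thesis using s_pos[of l] by (simp add: zero_le_mult_iff)
    qed
    \<comment> \<open>The triangle inequality makes \<open>z\<close> subharmonic for the transposed
      matrix.\<close>
    have sub: "n * z j \<le> (\<Sum>i\<le>l. M i j * z i)" if "j \<le> l" for j
    proof -
      have "n * z j = \<bar>\<Sum>i\<le>l. y i * M i j\<bar>" using y(4)[OF that] n0 by (simp add: z_def abs_mult)
      also have "\<dots> \<le> (\<Sum>i\<le>l. \<bar>y i * M i j\<bar>)" by (rule sum_abs)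
      also have "\<dots> = (\<Sum>i\<le>l. M i j * z i)"
        by (rule sum.cong) (use that M_nonneg in \<open>auto simp: z_def abs_mult\<close>)
      finally show ?thesis .
    qed
    have eq: "(\<Sum>i\<le>l. M i j * z i) = n * z j" if "j \<le> l" for j
      using d.subharmonic_eq[OF sub that] .
    \<comment> \<open>The pairing with \<open>z\<close> is multiplied by \<open>n\<close> when
      \<open>k\<close> grows by one, and it starts at \<open>z l = 0\<close>.\<close>
    have zP: "(\<Sum>i\<le>l. z i * P k i) = 0" for k
    proof (induction k)
      case 0
      then show ?case by (simp add: P0 z_def y(1) if_distrib cong: if_cong)
    next
      case (Suc k)
      have "(\<Sum>i\<le>l. z i * P (Suc k) i) = (\<Sum>i\<le>l. \<Sum>j\<le>l. z i * M i j * P k j)"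
        by (simp add: PS sum_distrib_left mult.assoc)
      also have "\<dots> = (\<Sum>j\<le>l. (\<Sum>i\<le>l. M i j * z i) * P k j)"
        by (subst sum.swap) (simp add: sum_distrib_left sum_distrib_right mult_ac)
      also have "\<dots> = n * (\<Sum>j\<le>l. z j * P k j)"
        by (simp add: eq sum_distrib_left mult.assoc)
      finally show ?case using Suc by simp
    qed
    obtain k where k: "0 < P k i0" using rich y(2) by (meson less_imp_le)
    have "z i0 * P k i0 = 0"
      using zP[of k] y(2) Pnn by (subst (asm) sum_nonneg_eq_0_iff) (auto simp: z_def)
    then show False using k y(3) by (simp add: z_def)
  qed
  moreover have "det red = 0" if not_rich: "\<not> (\<exists>t>0. \<forall>i\<le>l. \<exists>k\<le>t. 0 < P k i)"
  proof -
    define J where "J = {i. i \<le> l \<and> (\<forall>k. P k i = 0)}"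
    have "J \<noteq> {}"
    proof
      assume "J = {}"
      then have "\<forall>i\<in>{..l}. \<exists>k. 0 < P k i" using Pnn unfolding J_def by (auto simp: less_le)
      then obtain f where f: "\<And>i. i \<le> l \<Longrightarrow> 0 < P (f i) i" by (metis atMost_iff)
      \<comment> \<open>A common bound for the finitely many stages \<open>f i\<close>;
        \<open>Suc\<close> makes it positive, as \<open>t > 0\<close> demands.\<close>
      have "f i \<le> Suc (\<Sum>i\<le>l. f i)" if "i \<le> l" for i
        using member_le_sum[of i "{..l}" f] that by auto
      then have "\<exists>t>0. \<forall>i\<le>l. \<exists>k\<le>t. 0 < P k i" using f by (intro exI[of _ "Suc (\<Sum>i\<le>l. f i)"]) auto
      then show False using not_rich by simp
    qed
    have "l \<notin> J" using P0[of l] by (auto simp: J_def intro!: exI[of _ 0])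
    \<comment> \<open>If \<open>j\<close> occurs at stage \<open>k\<close> and
      \<open>M i j > 0\<close>, then \<open>i\<close> occurs at stage \<open>k + 1\<close>; hence no
      entry leads from outside \<open>J\<close> into \<open>J\<close>.\<close>
    have closed: "M i j = 0" if "i \<in> J" "j \<le> l" "j \<notin> J" for i j
    proof -
      from that obtain k where "P k j \<noteq> 0" unfolding J_def by blast
      then have k: "0 < P k j" using Pnn[OF that(2), of k] by simp
      have "P (Suc k) i = 0" "i \<le> l" using that by (auto simp: J_def)
      then have "(\<Sum>j\<le>l. M i j * P k j) = 0" by (simp add: PS)
      then have "M i j * P k j = 0"
        using \<open>i \<le> l\<close> that Pnn M_nonneg by (subst (asm) sum_nonneg_eq_0_iff) auto
      then show ?thesis using k by simp
    qed
    define x where "x = (\<lambda>i. if i \<in> J then c i else 0)"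
    \<comment> \<open>On \<open>J\<close> nothing is lost by dropping the other coordinates, because
      \<open>closed\<close> makes their entries vanish; off \<open>J\<close> the left side is
      0.\<close>
    have sub: "n * x i \<le> (\<Sum>j\<le>l. M i j * x j)" if "i \<le> l" for i
    proof (cases "i \<in> J")
      case True
      have "(\<Sum>j\<le>l. M i j * x j) = (\<Sum>j\<le>l. M i j * c j)"
        by (rule sum.cong) (use closed[OF True] in \<open>auto simp: x_def\<close>)
      then show ?thesis using M_c[OF that] True by (simp add: x_def)
    next
      case False
      have "0 \<le> (\<Sum>j\<le>l. M i j * x j)"
        by (intro sum_nonneg mult_nonneg_nonneg M_nonneg)
          (use that c_pos in \<open>auto simp: x_def J_def less_imp_le\<close>)
      then show ?thesis using False by (simp add: x_def)
    qed
    have "\<forall>i\<le>l. (\<Sum>j\<le>l. M i j * x j) = n * x i" using subharmonic_eq[OF sub] by blast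
    moreover obtain i where "i \<in> J" using \<open>J \<noteq> {}\<close> by blast
    moreover have "i < l" using \<open>i \<in> J\<close> \<open>l \<notin> J\<close> by (cases "i = l") (auto simp: J_def)
    ultimately show ?thesis
      unfolding det_red_zero_iff using \<open>l \<notin> J\<close> c_pos[of i]
      by (intro exI[of _ x]) (auto simp: x_def intro!: exI[of _ i])
  qed
  ultimately show ?thesis by blast
qed

end

text \<open>\<open>c\<close> is a kernel vector, so the rank is at most \<open>l\<close>. If the
  reduced determinant is nonzero, a perturbation of rank one makes \<open>lap\<close> invertible, so
  the rank is short by at most one. If it is zero, \<open>c\<close> and a second kernel vector
  \<open>x\<close> allow two columns to be discarded.\<close>

lemma rank_lap_iff:
  fixes n :: "'a::linordered_field"
  assumes pk: "positive_kernel l n M s c"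
  shows "vec_space.rank (l+1) (positive_kernel.lap l n M) = l \<longleftrightarrow> det (positive_kernel.red l n M) \<noteq> 0"
proof -
  interpret positive_kernel l n M s c by (rule pk)
  interpret vec_space "TYPE('a)" "l+1" .
  have "lap *\<^sub>v vec (l+1) c = 0\<^sub>v (l+1)"
    by (rule eq_vecI) (use lap_mult[of _ c] M_c in \<open>auto simp: lap_def simp del: index_mult_mat_vec\<close>)
  moreover have "vec (l+1) c \<noteq> 0\<^sub>v (l+1)" using c_pos[of l] by (auto simp: vec_eq_iff)
  ultimately have "det lap = 0" using det_0_iff_vec_prod_zero[OF lap_carrier] by (metis vec_carrier)
  then have lt: "rank lap < l + 1" using det_zero_low_rank[OF lap_carrier] by simp
  have "rank lap = l" if det: "det red \<noteq> 0"
  proof -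
    \<comment> \<open>\<open>E\<close> adds \<open>x l\<close> to the last equation alone. The other
      equations already imply the unperturbed last one by \<open>harmonic_at_l\<close>, so a kernel
      vector of \<open>lap + E\<close> has \<open>x l = 0\<close> and yields one of
      \<open>red\<close>.\<close>
    define E :: "'a mat" where "E = mat (l+1) (l+1) (\<lambda>(i,j). if i = l \<and> j = l then 1 else 0)"
    have E: "E \<in> carrier_mat (l+1) (l+1)" by (simp add: E_def)
    have rE: "rank E \<le> 1"
      by (rule rank_le_1_product_entries[OF E, of "\<lambda>i. if i = l then 1 else 0" "\<lambda>i. if i = l then 1 else 0"])
        (auto simp: E_def)
    have "det (lap + E) \<noteq> 0"
    proof
      assume "det (lap + E) = 0"
      then obtain v where v: "v \<in> carrier_vec (l+1)" "v \<noteq> 0\<^sub>v (l+1)" "(lap + E) *\<^sub>v v = 0\<^sub>v (l+1)"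
        using det_0_iff_vec_prod_zero[of "lap + E" "l+1"] E by auto
      define x where "x = (\<lambda>i. v $ i)"
      have vx: "v = vec (l+1) x" using v(1) by (auto simp: x_def)
      have Ex: "(E *\<^sub>v v) $ i = (if i = l then x l else 0)" if "i \<le> l" for i
        using that v(1) by (simp add: E_def x_def scalar_prod_def if_distrib[of "\<lambda>t. t * _"] cong: if_cong)
      have eq: "n * x i - (\<Sum>j\<le>l. M i j * x j) + (if i = l then x l else 0) = 0" if "i \<le> l" for i
      proof -
        have "0 = (lap *\<^sub>v v + E *\<^sub>v v) $ i"
          using v(3) that add_mult_distrib_mat_vec[OF lap_carrier E v(1)] by simp
        also have "\<dots> = (lap *\<^sub>v v) $ i + (E *\<^sub>v v) $ i" using that E by simp
        finally show ?thesis using lap_mult[OF that, of x] Ex[OF that] unfolding vx by simp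
      qed
      have h: "(\<Sum>j\<le>l. M i j * x j) = n * x i" if "i < l" for i using eq[of i] that by simp
      have "x l = 0" using eq[of l] harmonic_at_l[OF h] by simp
      moreover have "\<exists>i<l. x i \<noteq> 0"
        using v(2) \<open>x l = 0\<close> unfolding vx by (auto simp: vec_eq_iff less_Suc_eq)
      ultimately have "det red = 0"
        unfolding det_red_zero_iff using h harmonic_at_l[OF h] by (intro exI[of _ x]) (auto simp: le_less)
      then show False using det by simp
    qed
    then have "rank (lap + E) = l + 1" using low_rank_det_zero[of "lap + E"] E by auto
    then show ?thesis using rank_subadditive[OF lap_carrier E] rE lt by simp
  qed
  moreover have "rank lap \<noteq> l" if "det red = 0"
  proof -
    from that obtain x i where x: "x l = 0" "i < l" "x i \<noteq> 0" "\<And>i. i \<le> l \<Longrightarrow> (\<Sum>j\<le>l. M i j * x j) = n * x i"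
      unfolding det_red_zero_iff by blast
    \<comment> \<open>\<open>g\<close> enumerates the indices below \<open>l\<close> other than
      \<open>i\<close>, so \<open>lap * P\<close> keeps the columns of \<open>lap\<close> other than
      \<open>i\<close> and \<open>l\<close>. There are \<open>l - 1\<close> of them because
      \<open>i < l\<close>.\<close>
    define g where "g = (\<lambda>k. if k < i then k else Suc k)"
    define P :: "'a mat" where "P = mat (l+1) (l-1) (\<lambda>(a,k). if a = g k then 1 else 0)"
    have P: "P \<in> carrier_mat (l+1) (l-1)" by (simp add: P_def)
    have LP: "lap * P \<in> carrier_mat (l+1) (l-1)" using lap_carrier P by (rule mult_carrier_mat)
    have key: "\<exists>w\<in>carrier_vec (l-1). (lap * P) *\<^sub>v w = lap *\<^sub>v v" if v: "v \<in> carrier_vec (l+1)" for v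
    proof -
      \<comment> \<open>Subtracting multiples of the kernel vectors \<open>c\<close> and
        \<open>x\<close> does not change \<open>lap *\<^sub>v v\<close>. The choice of
        \<open>b\<close> clears coordinate \<open>l\<close>; as \<open>x l = 0\<close>, the choice
        of \<open>a\<close> then clears coordinate \<open>i\<close> without disturbing it.\<close>
      define b where "b = v $ l / c l"
      define a where "a = (v $ i - b * c i) / x i"
      define u where "u = (\<lambda>j. v $ j - b * c j - a * x j)"
      have ul: "u l = 0" using c_pos[of l] x(1) by (simp add: u_def b_def)
      have ui: "u i = 0" using x(3) by (simp add: u_def a_def)
      define w where "w = vec (l-1) (\<lambda>k. u (g k))"
      have "P *\<^sub>v w = vec (l+1) u"
      proof (rule eq_vecI)
        fix j assume "j < dim_vec (vec (l+1) u)"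
        then have j: "j \<le> l" by simp
        have "(P *\<^sub>v w) $ j = (\<Sum>k\<in>{0..<l-1}. (if j = g k then 1 else 0) * u (g k))"
          using j by (simp add: P_def w_def scalar_prod_def)
        also have "\<dots> = u j"
        proof (cases "j = i \<or> j = l")
          case True
          have "(\<Sum>k\<in>{0..<l-1}. (if j = g k then 1 else 0) * u (g k)) = (\<Sum>k\<in>{0..<l-1}. 0)"
            by (rule sum.cong) (use True ul ui in auto)
          then show ?thesis using True ul ui by auto
        next
          case False
          define k where "k = (if j < i then j else j - 1)"
          have k: "k < l - 1" "g k = j" using False j x(2) by (auto simp: k_def g_def)
          have gk: "j = g k' \<longleftrightarrow> k' = k" for k' using k False by (auto simp: g_def k_def split: if_splits)
          show ?thesis using k by (simp add: gk if_distrib[of "\<lambda>t. t * _"] cong: if_cong)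
        qed
        finally show "(P *\<^sub>v w) $ j = vec (l+1) u $ j" using j by simp
      qed (simp add: P_def)
      then have "(lap * P) *\<^sub>v w = lap *\<^sub>v vec (l+1) u"
        using assoc_mult_mat_vec[OF lap_carrier P] by (simp add: w_def)
      also have "\<dots> = lap *\<^sub>v vec (l+1) (\<lambda>j. v $ j)"
      proof (rule eq_vecI)
        fix j assume "j < dim_vec (lap *\<^sub>v vec (l+1) (\<lambda>j. v $ j))"
        then have j: "j \<le> l" by (simp add: lap_def)
        have "(\<Sum>k\<le>l. M j k * u k) = (\<Sum>k\<le>l. M j k * v $ k) - b * (\<Sum>k\<le>l. M j k * c k) - a * (\<Sum>k\<le>l. M j k * x k)"
          by (simp add: u_def right_diff_distrib sum_subtractf sum_distrib_left mult_ac)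
        then show "(lap *\<^sub>v vec (l+1) u) $ j = (lap *\<^sub>v vec (l+1) (\<lambda>j. v $ j)) $ j"
          unfolding lap_mult[OF j] using M_c[OF j] x(4)[OF j] by (simp add: u_def algebra_simps)
      qed simp
      also have "vec (l+1) (\<lambda>j. v $ j) = v" using v by auto
      finally show ?thesis by (intro bexI[of _ w]) (simp_all add: w_def)
    qed
    have "col_space lap = col_space (lap * P)"
    proof -
      have "\<exists>x\<in>carrier_vec (l+1). lap *\<^sub>v x = (lap * P) *\<^sub>v w" if "w \<in> carrier_vec (l-1)" for w
        using assoc_mult_mat_vec[OF lap_carrier P that] that P mult_mat_vec_carrier by metis
      then show ?thesis
        unfolding col_space_eq[OF lap_carrier] col_space_eq[OF LP]
        using key lap_carrier LP P by auto
    qed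
    then have "rank lap = rank (lap * P)" unfolding rank_def col_space_def by simp
    also have "\<dots> \<le> l - 1" by (rule rank_le_nc[OF LP])
    finally show ?thesis using x(2) by simp
  qed
  ultimately show ?thesis by blast
qed

section \<open>Finiteness of the critical group\<close>

definition augmentation_kernel :: "nat \<Rightarrow> (nat \<Rightarrow> int) \<Rightarrow> (nat \<Rightarrow> int) set" where
  "augmentation_kernel l s = {x. (\<forall>i>l. x i = 0) \<and> (\<Sum>i\<le>l. x i * s i) = 0}"

definition laplacian_image :: "nat \<Rightarrow> int \<Rightarrow> (nat \<Rightarrow> nat \<Rightarrow> int) \<Rightarrow> (nat \<Rightarrow> int) set" where
  "laplacian_image l n M =
     {(\<lambda>i. if i \<le> l then n * x i - (\<Sum>j\<le>l. M i j * x j) else 0) | x. \<forall>i>l. x i = 0}"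

text \<open>With a nonzero determinant, a coset depends only on the residues of the coordinates
  below \<open>l\<close> modulo \<bar>det\<bar>, and these are finitely many. Otherwise a left
  kernel vector separates infinitely many cosets.\<close>

lemma finite_quotient_iff:
  assumes pk: "positive_kernel l n M s c" and sl: "s l = 1"
  shows "finite ((\<lambda>x. {(\<lambda>i. x i + y i) | y. y \<in> laplacian_image l n M}) ` augmentation_kernel l s)
    \<longleftrightarrow> det (positive_kernel.red l n M) \<noteq> (0::int)"
proof -
  interpret positive_kernel l n M s c by (rule pk)
  let ?coset = "\<lambda>x. {(\<lambda>i. x i + y i) | y. y \<in> laplacian_image l n M}"
  let ?I = "augmentation_kernel l s"
  have zero: "(\<lambda>_. 0) \<in> laplacian_image l n M"
    unfolding laplacian_image_def by (rule CollectI, rule exI[of _ "\<lambda>_. 0"]) auto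
  have diff: "(\<lambda>i. y i - z i) \<in> laplacian_image l n M"
    if "y \<in> laplacian_image l n M" "z \<in> laplacian_image l n M" for y z
  proof -
    from that(1) obtain u where u: "\<forall>i>l. u i = 0" "y = (\<lambda>i. if i \<le> l then n * u i - (\<Sum>j\<le>l. M i j * u j) else 0)"
      unfolding laplacian_image_def by blast
    from that(2) obtain v where v: "\<forall>i>l. v i = 0" "z = (\<lambda>i. if i \<le> l then n * v i - (\<Sum>j\<le>l. M i j * v j) else 0)"
      unfolding laplacian_image_def by blast
    show ?thesis unfolding laplacian_image_def
      by (rule CollectI, rule exI[of _ "\<lambda>i. u i - v i"])
        (use u v in \<open>auto simp: fun_eq_iff right_diff_distrib sum_subtractf\<close>)
  qed
  have coset_eqD: "(\<lambda>i. x i - x' i) \<in> laplacian_image l n M" if "?coset x = ?coset x'" for x x'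
  proof -
    have "x \<in> ?coset x" by (rule CollectI, rule exI[of _ "\<lambda>_. 0"]) (simp add: zero)
    then have "x \<in> ?coset x'" by (simp only: that)
    then obtain y where "y \<in> laplacian_image l n M" "x = (\<lambda>i. x' i + y i)" unfolding mem_Collect_eq by blast
    then show ?thesis by simp
  qed
  have coset_eqI: "?coset x = ?coset x'" if d: "(\<lambda>i. x i - x' i) \<in> laplacian_image l n M" for x x'
  proof -
    have sub: "?coset u \<subseteq> ?coset v" if "(\<lambda>i. v i - u i) \<in> laplacian_image l n M" for u v
    proof
      fix z assume "z \<in> ?coset u"
      then obtain y where y: "y \<in> laplacian_image l n M" "z = (\<lambda>i. u i + y i)" by blast
      show "z \<in> ?coset v"
        by (rule CollectI, rule exI[of _ "\<lambda>i. y i - (v i - u i)"]) (use y diff[OF y(1) that] in \<open>simp add: add.commute\<close>)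
    qed
    have "(\<lambda>i. x' i - x i) \<in> laplacian_image l n M" using diff[OF zero d] by simp
    then show ?thesis using sub[of x' x] sub[of x x'] d by blast
  qed
  show ?thesis
  proof
    assume det: "det red \<noteq> 0"
    define d where "d = \<bar>det red\<bar>"
    have d: "d > 0" using det by (simp add: d_def)
    have inj: "?coset x = ?coset x'"
      if I: "x \<in> ?I" "x' \<in> ?I" and eq: "\<And>i. i < l \<Longrightarrow> x i mod d = x' i mod d" for x x'
    proof -
      define q where "q = (\<lambda>i. (x i - x' i) div d)"
      have q: "x i - x' i = d * q i" if "i < l" for i
        using eq[OF that] by (simp add: q_def mod_eq_dvd_iff)
      \<comment> \<open>\<open>q\<close> is the difference \<open>x - x'\<close> divided by
        \<bar>det\<bar>, and the adjugate inverts \<open>red\<close> up to the determinant, so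
        \<open>w\<close> is an integral solution of \<open>red w = x - x'\<close>.\<close>
      define w where "w = sgn (det red) \<cdot>\<^sub>v (adj_mat red *\<^sub>v vec l q)"
      define u where "u = (\<lambda>i. if i < l then w $ i else 0)"
      have adj: "adj_mat red \<in> carrier_mat l l" "red * adj_mat red = det red \<cdot>\<^sub>m 1\<^sub>m l"
        using adj_mat[OF red_carrier] by auto
      have w: "w \<in> carrier_vec l" using adj(1) by (auto simp: w_def)
      have u0: "u l = 0" by (simp add: u_def)
      have wu: "vec l u = w" using w by (auto simp: u_def)
      have "red *\<^sub>v w = sgn (det red) \<cdot>\<^sub>v (red *\<^sub>v (adj_mat red *\<^sub>v vec l q))"
        using adj(1) by (auto simp: w_def scalar_prod_def red_def sum_distrib_left mult_ac intro!: eq_vecI)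
      also have "red *\<^sub>v (adj_mat red *\<^sub>v vec l q) = (det red \<cdot>\<^sub>m 1\<^sub>m l) *\<^sub>v vec l q"
        using assoc_mult_mat_vec[OF red_carrier adj(1), of "vec l q"] adj(2) by simp
      finally have rw: "(red *\<^sub>v w) $ i = d * q i" if "i < l" for i
        using that by (auto simp: d_def abs_sgn scalar_prod_def if_distrib[of "\<lambda>t. t * _"] if_distrib[of "\<lambda>t. _ * t"] mult_ac cong: if_cong)
      have first: "n * u i - (\<Sum>j\<le>l. M i j * u j) = x i - x' i" if "i < l" for i
        using red_mult[where x = u, OF that u0] rw[OF that] q[OF that] wu by simp
      \<comment> \<open>The image of the Laplacian and the augmentation kernel both pair to 0 with
        \<open>s\<close>, so agreement below \<open>l\<close> forces agreement at
        \<open>l\<close>.\<close>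
      have "(\<Sum>i\<le>l. s i * (n * u i - (\<Sum>j\<le>l. M i j * u j) - (x i - x' i))) = 0"
        using s_pairing[of u] I
        by (simp add: augmentation_kernel_def right_diff_distrib sum_subtractf mult.commute[of "s _" "x _"] mult.commute[of "s _" "x' _"])
      moreover have "(\<Sum>i\<le>l. s i * (n * u i - (\<Sum>j\<le>l. M i j * u j) - (x i - x' i)))
          = s l * (n * u l - (\<Sum>j\<le>l. M l j * u j) - (x l - x' l))"
        using first by (subst sum.remove[of _ l]) auto
      ultimately have last: "n * u l - (\<Sum>j\<le>l. M l j * u j) = x l - x' l" using s_pos[of l] by simp
      have "(\<lambda>i. x i - x' i) \<in> laplacian_image l n M"
        unfolding laplacian_image_def
        by (rule CollectI, rule exI[of _ u])
          (use first last I in \<open>auto simp: fun_eq_iff u_def augmentation_kernel_def le_less\<close>)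
      then show ?thesis by (rule coset_eqI)
    qed
    define r where "r = (\<lambda>x. restrict (\<lambda>i. x i mod d) {..<l})"
    have "r ` ?I \<subseteq> {..<l} \<rightarrow>\<^sub>E {0..<d}"
      unfolding r_def image_subset_iff restrict_PiE_iff using d by simp
    then have fin: "finite (r ` ?I)" by (rule finite_subset) (auto intro: finite_PiE)
    \<comment> \<open>One representative for each pattern of residues, so that the cosets are
      covered by the image of a finite set.\<close>
    define pick where "pick = (\<lambda>t. SOME x. x \<in> ?I \<and> r x = t)"
    have "?coset ` ?I \<subseteq> (\<lambda>t. ?coset (pick t)) ` (r ` ?I)"
    proof
      fix C assume "C \<in> ?coset ` ?I"
      then obtain x where x: "x \<in> ?I" "C = ?coset x" by blast
      have p: "pick (r x) \<in> ?I \<and> r (pick (r x)) = r x"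
        unfolding pick_def by (rule someI[of _ x]) (use x in simp)
      have "x i mod d = pick (r x) i mod d" if "i < l" for i
        using fun_cong[OF conjunct2[OF p], of i] that by (simp add: r_def)
      then have C: "?coset x = ?coset (pick (r x))" by (rule inj[OF x(1) conjunct1[OF p]])
      show "C \<in> (\<lambda>t. ?coset (pick t)) ` (r ` ?I)"
        unfolding x(2) by (rule rev_image_eqI[of "r x"], rule imageI, rule x(1), rule C)
    qed
    then show "finite (?coset ` ?I)" by (rule finite_surj[OF fin])
  next
    assume fin: "finite (?coset ` ?I)"
    show "det red \<noteq> 0"
    proof
      assume "det red = 0"
      then obtain y i where y: "y l = 0" "i < l" "y i \<noteq> 0" "\<And>j. j \<le> l \<Longrightarrow> (\<Sum>i\<le>l. y i * M i j) = n * y j"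
        unfolding det_red_zero_iff_left by blast
      have y0: "(\<Sum>i\<le>l. y i * z i) = 0" if "z \<in> laplacian_image l n M" for z
      proof -
        from that obtain u where u: "z = (\<lambda>i. if i \<le> l then n * u i - (\<Sum>j\<le>l. M i j * u j) else 0)"
          unfolding laplacian_image_def by blast
        have "(\<Sum>i\<le>l. y i * (\<Sum>j\<le>l. M i j * u j)) = (\<Sum>j\<le>l. (\<Sum>i\<le>l. y i * M i j) * u j)"
          by (subst sum_distrib_left, subst sum.swap) (simp add: sum_distrib_right mult.assoc)
        also have "\<dots> = (\<Sum>j\<le>l. n * y j * u j)" by (simp add: y(4))
        finally show ?thesis by (simp add: u right_diff_distrib sum_subtractf mult_ac)
      qed
      \<comment> \<open>\<open>k\<close> times the class of \<open>S i\<close> minus its dimension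
        times the trivial class. It lies in the augmentation kernel because \<open>s l = 1\<close>,
        and \<open>y\<close> pairs it to \<open>k * y i\<close> because
        \<open>y l = 0\<close>.\<close>
      define e where "e = (\<lambda>k::int. \<lambda>j. if j = i then k else if j = l then - k * s i else 0)"
      have sum_e: "(\<Sum>j\<le>l. g j * e k j) = g i * k - g l * (k * s i)" for g :: "nat \<Rightarrow> int" and k
      proof -
        have "(\<Sum>j\<le>l. g j * e k j) = (\<Sum>j\<in>{i, l}. g j * e k j)"
          by (rule sum.mono_neutral_right) (use y(2) in \<open>auto simp: e_def\<close>)
        then show ?thesis using y(2) by (simp add: e_def)
      qed
      have eI: "e k \<in> ?I" for k
        using sum_e[of s k] y(2) sl by (auto simp: augmentation_kernel_def e_def mult.commute)
      have "inj (\<lambda>k. ?coset (e k))"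
      proof (rule injI)
        fix k k' assume "?coset (e k) = ?coset (e k')"
        then have "(\<Sum>j\<le>l. y j * (e k j - e k' j)) = 0" by (rule y0[OF coset_eqD])
        then have "y i * k = y i * k'"
          using sum_e[of y k] sum_e[of y k'] y(1) by (simp add: right_diff_distrib sum_subtractf)
        then show "k = k'" using y(3) by simp
      qed
      moreover have "range (\<lambda>k. ?coset (e k)) \<subseteq> ?coset ` ?I"
        by (rule image_subsetI) (rule imageI[OF eI])
      ultimately have "finite (UNIV :: int set)" using finite_imageD[OF finite_subset[OF _ fin]] by blast
      then show False using infinite_UNIV_int by simp
    qed
  qed
qed

section \<open>Composition multiplicities\<close>

text \<open>Named so that the functions \<open>nat \<Rightarrow> 'f\<close> with pointwise addition
  become an instance of the generic vector space theory.\<close>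

definition scl :: "'f::field \<Rightarrow> (nat \<Rightarrow> 'f) \<Rightarrow> (nat \<Rightarrow> 'f)" where
  "scl a v = (\<lambda>p. a * v p)"

lemma scl_apply[simp]: "scl a v p = a * v p" by (simp add: scl_def)

global_interpretation fvs: vector_space "scl :: 'f::field \<Rightarrow> _"
  by unfold_locales (auto simp: scl_def fun_eq_iff algebra_simps)

lemma fun_sum_apply: "(\<Sum>a\<in>A. f a) p = (\<Sum>a\<in>A. f a p :: 'f::comm_monoid_add)"
  by (induction A rule: infinite_finite_induct) auto

lemma subspace_of_iff: "subspace_of n U \<longleftrightarrow> U \<subseteq> vecs n \<and> fvs.subspace U"
  by (auto simp: subspace_of_def fvs.subspace_def scl_def plus_fun_def zero_fun_def)

lemma vecs_subspace: "fvs.subspace (vecs n)"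
  by (auto simp: vecs_def fvs.subspace_def)

lemma actv_add: "actv M i (v + w) = actv M i v + actv M i w"
  by (auto simp: actv_def fun_eq_iff distrib_left sum.distrib)

lemma actv_scl: "actv M i (scl a v) = scl a (actv M i v)"
  by (auto simp: actv_def fun_eq_iff sum_distrib_left mult_ac)

lemma actv_zero[simp]: "actv M i 0 = 0"
  by (auto simp: actv_def fun_eq_iff)

lemma actv_sum: "actv M i (\<Sum>a\<in>A. f a) = (\<Sum>a\<in>A. actv M i (f a))"
  by (induction A rule: infinite_finite_induct)
    (simp_all only: sum.infinite sum.empty sum.insert actv_zero actv_add not_False_eq_True)

lemma actv_vecs[simp]: "actv M i v \<in> vecs (mdim M)"
  by (auto simp: actv_def vecs_def)

section \<open>Submodules and isomorphic subquotients\<close>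

lemma submodule_of_iff: "submodule_of H M U \<longleftrightarrow>
    U \<subseteq> vecs (mdim M) \<and> fvs.subspace U \<and> (\<forall>i<hdim H. \<forall>v\<in>U. actv M i v \<in> U)"
  by (auto simp: submodule_of_def subspace_of_iff)

lemma submodule_ofI:
  assumes "U \<subseteq> vecs (mdim M)" "0 \<in> U" "\<And>v w. v \<in> U \<Longrightarrow> w \<in> U \<Longrightarrow> v + w \<in> U"
    "\<And>a v. v \<in> U \<Longrightarrow> scl a v \<in> U" "\<And>i v. i < hdim H \<Longrightarrow> v \<in> U \<Longrightarrow> actv M i v \<in> U"
  shows "submodule_of H M U"
  using assms by (simp add: submodule_of_iff fvs.subspace_def)

lemma submodule_0: "submodule_of H M {0}"
  by (auto simp: submodule_of_iff vecs_def)

lemma submodule_vecs: "submodule_of H M (vecs (mdim M))"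
  by (auto simp: submodule_of_iff vecs_subspace)

lemma submodule_Int: "submodule_of H M U \<Longrightarrow> submodule_of H M W \<Longrightarrow> submodule_of H M (U \<inter> W)"
  by (auto simp: submodule_of_iff fvs.subspace_inter)

definition ssum :: "(nat \<Rightarrow> 'f::field) set \<Rightarrow> (nat \<Rightarrow> 'f) set \<Rightarrow> (nat \<Rightarrow> 'f) set" where
  "ssum U W = {u + w | u w. u \<in> U \<and> w \<in> W}"

lemma submodule_zero_mem: "submodule_of H M U \<Longrightarrow> 0 \<in> U"
  by (simp add: submodule_of_iff fvs.subspace_0)

lemma submodule_add: "submodule_of H M U \<Longrightarrow> v \<in> U \<Longrightarrow> w \<in> U \<Longrightarrow> v + w \<in> U"
  by (simp add: submodule_of_iff fvs.subspace_add)

lemma submodule_diff: "submodule_of H M U \<Longrightarrow> v \<in> U \<Longrightarrow> w \<in> U \<Longrightarrow> v - w \<in> U"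
  by (simp add: submodule_of_iff fvs.subspace_diff)

lemma submodule_scl: "submodule_of H M U \<Longrightarrow> v \<in> U \<Longrightarrow> scl a v \<in> U"
  by (simp add: submodule_of_iff fvs.subspace_scale)

lemma submodule_act: "submodule_of H M U \<Longrightarrow> i < hdim H \<Longrightarrow> v \<in> U \<Longrightarrow> actv M i v \<in> U"
  by (simp add: submodule_of_iff)

lemma submodule_vecs_subset: "submodule_of H M U \<Longrightarrow> U \<subseteq> vecs (mdim M)"
  by (simp add: submodule_of_iff)

lemma submodule_ssum:
  assumes U: "submodule_of H M U" and W: "submodule_of H M W"
  shows "submodule_of H M (ssum U W)"
proof (rule submodule_ofI)
  show "ssum U W \<subseteq> vecs (mdim M)"
    using U W unfolding ssum_def submodule_of_iff
    by (auto intro!: fvs.subspace_add[OF vecs_subspace])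
  have "0 = (0 :: nat \<Rightarrow> 'a) + 0" by simp
  then show "0 \<in> ssum U W" unfolding ssum_def
    using submodule_zero_mem[OF U] submodule_zero_mem[OF W] by blast
next
  fix v w assume "v \<in> ssum U W" "w \<in> ssum U W"
  then obtain a b a' b' where h: "v = a + b" "a \<in> U" "b \<in> W" "w = a' + b'" "a' \<in> U" "b' \<in> W"
    unfolding ssum_def by blast
  then have "v + w = (a + a') + (b + b')" by (simp only: add_ac)
  then show "v + w \<in> ssum U W"
    unfolding ssum_def using h submodule_add[OF U] submodule_add[OF W] by blast
next
  fix a v assume "v \<in> ssum U W"
  then show "scl a v \<in> ssum U W"
    unfolding ssum_def using fvs.scale_right_distrib submodule_scl[OF U] submodule_scl[OF W] by blast
next
  fix i v assume "i < hdim H" "v \<in> ssum U W"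
  then show "actv M i v \<in> ssum U W"
    unfolding ssum_def using actv_add submodule_act[OF U] submodule_act[OF W] by blast
qed

lemma ssum_upper1:
  assumes "submodule_of H M W"
  shows "U \<subseteq> ssum U W"
proof
  fix u assume "u \<in> U"
  moreover have "u = u + 0" by simp
  ultimately show "u \<in> ssum U W" unfolding ssum_def using submodule_zero_mem[OF assms] by blast
qed

lemma ssum_commute: "ssum U W = ssum W U"
  unfolding ssum_def using add.commute by blast

lemma ssum_upper2: "submodule_of H M U \<Longrightarrow> W \<subseteq> ssum U W"
  using ssum_upper1 ssum_commute by metis

lemma ssum_least: "submodule_of H M Z \<Longrightarrow> U \<subseteq> Z \<Longrightarrow> W \<subseteq> Z \<Longrightarrow> ssum U W \<subseteq> Z"
  by (auto simp: ssum_def intro: submodule_add)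

text \<open>Isomorphisms of subquotients are encoded as additive relations, so that inverses,
  composites and the second isomorphism theorem need no extension or choice of linear maps.\<close>

definition linrel :: "'f::field hopf_data \<Rightarrow> 'f amod \<Rightarrow> 'f amod \<Rightarrow> ((nat \<Rightarrow> 'f) \<times> (nat \<Rightarrow> 'f)) set \<Rightarrow> bool" where
  "linrel H M N R \<longleftrightarrow> (0, 0) \<in> R
    \<and> (\<forall>v w v' w'. (v, w) \<in> R \<longrightarrow> (v', w') \<in> R \<longrightarrow> (v + v', w + w') \<in> R)
    \<and> (\<forall>a v w. (v, w) \<in> R \<longrightarrow> (scl a v, scl a w) \<in> R)
    \<and> (\<forall>i<hdim H. \<forall>v w. (v, w) \<in> R \<longrightarrow> (actv M i v, actv N i w) \<in> R)"

text \<open>\<open>R\<close> relates \<open>v\<close> to \<open>w\<close> when their classes in Y/U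
  and Q/P correspond; the final equivalence gives well-definedness and injectivity at the same
  time.\<close>

definition relates_subquot :: "'f::field hopf_data \<Rightarrow> 'f amod \<Rightarrow> (nat \<Rightarrow> 'f) set \<Rightarrow> (nat \<Rightarrow> 'f) set \<Rightarrow>
    'f amod \<Rightarrow> (nat \<Rightarrow> 'f) set \<Rightarrow> (nat \<Rightarrow> 'f) set \<Rightarrow> ((nat \<Rightarrow> 'f) \<times> (nat \<Rightarrow> 'f)) set \<Rightarrow> bool" where
  "relates_subquot H M U Y N P Q R \<longleftrightarrow> linrel H M N R \<and> Domain R = Y \<and> Range R = Q
    \<and> (\<forall>v w. (v, w) \<in> R \<longrightarrow> (v \<in> U \<longleftrightarrow> w \<in> P))"

definition sqi :: "'f::field hopf_data \<Rightarrow> 'f amod \<Rightarrow> (nat \<Rightarrow> 'f) set \<Rightarrow> (nat \<Rightarrow> 'f) set \<Rightarrow>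
    'f amod \<Rightarrow> (nat \<Rightarrow> 'f) set \<Rightarrow> (nat \<Rightarrow> 'f) set \<Rightarrow> bool" where
  "sqi H M U Y N P Q \<longleftrightarrow> (\<exists>R. relates_subquot H M U Y N P Q R)"

lemma linrelI:
  assumes "(0, 0) \<in> R"
    and "\<And>v w v' w'. (v, w) \<in> R \<Longrightarrow> (v', w') \<in> R \<Longrightarrow> (v + v', w + w') \<in> R"
    and "\<And>a v w. (v, w) \<in> R \<Longrightarrow> (scl a v, scl a w) \<in> R"
    and "\<And>i v w. i < hdim H \<Longrightarrow> (v, w) \<in> R \<Longrightarrow> (actv M i v, actv N i w) \<in> R"
  shows "linrel H M N R"
  unfolding linrel_def using assms by simp

lemma
  assumes "linrel H M N R"
  shows linrel_zero: "(0, 0) \<in> R"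
    and linrel_add: "(v, w) \<in> R \<Longrightarrow> (v', w') \<in> R \<Longrightarrow> (v + v', w + w') \<in> R"
    and linrel_scl: "(v, w) \<in> R \<Longrightarrow> (scl a v, scl a w) \<in> R"
    and linrel_act: "i < hdim H \<Longrightarrow> (v, w) \<in> R \<Longrightarrow> (actv M i v, actv N i w) \<in> R"
  using assms unfolding linrel_def by simp_all

lemma linrel_diff:
  assumes "linrel H M N R" "(v, w) \<in> R" "(v', w') \<in> R"
  shows "(v - v', w - w') \<in> R"
  using linrel_add[OF assms(1,2) linrel_scl[OF assms(1,3), of "-1"]] by simp

lemma linrel_sum:
  assumes "linrel H M N R" "\<And>a. a \<in> A \<Longrightarrow> (f a, g a) \<in> R"
  shows "((\<Sum>a\<in>A. f a), (\<Sum>a\<in>A. g a)) \<in> R"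
  using assms(2)
  by (induction A rule: infinite_finite_induct)
    (simp_all add: linrel_zero[OF assms(1)] linrel_add[OF assms(1)])

lemma linrel_converse: "linrel H M N R \<Longrightarrow> linrel H N M (R\<inverse>)"
  by (rule linrelI) (simp_all add: linrel_zero linrel_add linrel_scl linrel_act)

lemma linrel_comp:
  assumes R: "linrel H M N R" and T: "linrel H N L T"
  shows "linrel H M L (R O T)"
proof (rule linrelI)
  show "(0, 0) \<in> R O T" using linrel_zero[OF R] linrel_zero[OF T] by (rule relcompI)
next
  fix v w v' w' assume "(v, w) \<in> R O T" "(v', w') \<in> R O T"
  then obtain x x' where "(v, x) \<in> R" "(x, w) \<in> T" "(v', x') \<in> R" "(x', w') \<in> T" by blast
  then show "(v + v', w + w') \<in> R O T" using linrel_add[OF R] linrel_add[OF T] by blast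
next
  fix a v w assume "(v, w) \<in> R O T"
  then obtain x where "(v, x) \<in> R" "(x, w) \<in> T" by blast
  then show "(scl a v, scl a w) \<in> R O T" using linrel_scl[OF R] linrel_scl[OF T] by blast
next
  fix i v w assume i: "i < hdim H" and "(v, w) \<in> R O T"
  then obtain x where "(v, x) \<in> R" "(x, w) \<in> T" by blast
  then show "(actv M i v, actv L i w) \<in> R O T"
    using linrel_act[OF R i] linrel_act[OF T i] by blast
qed

lemma linrel_image:
  assumes R: "linrel H M N R" and X: "submodule_of H M X" and Q: "Range R \<subseteq> vecs (mdim N)"
  shows "submodule_of H N (R `` X)"
proof (rule submodule_ofI)
  show "R `` X \<subseteq> vecs (mdim N)" using Q by blast
  show "0 \<in> R `` X" using linrel_zero[OF R] submodule_zero_mem[OF X] by (rule ImageI)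
next
  fix v w assume "v \<in> R `` X" "w \<in> R `` X"
  then obtain x y where "x \<in> X" "(x, v) \<in> R" "y \<in> X" "(y, w) \<in> R" by blast
  then show "v + w \<in> R `` X" by (intro ImageI[OF linrel_add[OF R]] submodule_add[OF X])
next
  fix a v assume "v \<in> R `` X"
  then obtain x where "x \<in> X" "(x, v) \<in> R" by blast
  then show "scl a v \<in> R `` X" by (intro ImageI[OF linrel_scl[OF R]] submodule_scl[OF X])
next
  fix i v assume i: "i < hdim H" and "v \<in> R `` X"
  then obtain x where "x \<in> X" "(x, v) \<in> R" by blast
  then show "actv N i v \<in> R `` X" by (intro ImageI[OF linrel_act[OF R i]] submodule_act[OF X i])
qed

lemma sqiI: "linrel H M N R \<Longrightarrow> Domain R = Y \<Longrightarrow> Range R = Q \<Longrightarrow>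
    (\<And>v w. (v, w) \<in> R \<Longrightarrow> v \<in> U \<longleftrightarrow> w \<in> P) \<Longrightarrow> sqi H M U Y N P Q"
  unfolding sqi_def relates_subquot_def by blast

lemma sqi_sym:
  assumes "sqi H M U Y N P Q"
  shows "sqi H N P Q M U Y"
proof -
  obtain R where R: "relates_subquot H M U Y N P Q R" using assms unfolding sqi_def by (rule exE)
  show ?thesis
    by (rule sqiI[of _ _ _ "R\<inverse>"]) (use R in \<open>auto simp: relates_subquot_def intro: linrel_converse\<close>)
qed

lemma sqi_trans:
  assumes "sqi H M U Y N P Q" "sqi H N P Q L A B"
  shows "sqi H M U Y L A B"
proof -
  obtain R where R: "linrel H M N R" "Domain R = Y" "Range R = Q" "\<And>v w. (v, w) \<in> R \<Longrightarrow> v \<in> U \<longleftrightarrow> w \<in> P"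
    using assms(1) unfolding sqi_def relates_subquot_def by auto
  obtain T where T: "linrel H N L T" "Domain T = Q" "Range T = B" "\<And>v w. (v, w) \<in> T \<Longrightarrow> v \<in> P \<longleftrightarrow> w \<in> A"
    using assms(2) unfolding sqi_def relates_subquot_def by auto
  show ?thesis
  proof (rule sqiI[OF linrel_comp[OF R(1) T(1)]])
    have "Domain T = Range R" "Range R = Domain T" using R T by auto
    then show "Domain (R O T) = Y" "Range (R O T) = B"
      unfolding R(2)[symmetric] T(3)[symmetric] by blast+
  next
    fix v w assume "(v, w) \<in> R O T"
    then obtain x where "(v, x) \<in> R" "(x, w) \<in> T" by blast
    then show "v \<in> U \<longleftrightarrow> w \<in> A" using R(4) T(4) by simp
  qed
qed

text \<open>As in the correspondence theorem, the relation is restricted to targets in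
  \<open>Z'\<close>. An element related to both \<open>w\<close> and \<open>w'\<close> does no harm,
  since \<open>w - w'\<close> lies in \<open>P \<subseteq> Z\<close>.\<close>

lemma relates_subquot_preimage:
  assumes R: "relates_subquot H M U Y N P Q R" and U: "0 \<in> U"
    and Z: "submodule_of H N Z" "submodule_of H N Z'" "P \<subseteq> Z" "Z \<subseteq> Z'" "Z' \<subseteq> Q"
  shows "sqi H M (R\<inverse> `` Z) (R\<inverse> `` Z') N Z Z'"
proof -
  have lin: "linrel H M N R" using R by (simp add: relates_subquot_def)
  let ?T = "R \<inter> UNIV \<times> Z'"
  have "linrel H M N ?T"
    by (rule linrelI)
      (auto intro: linrel_zero[OF lin] linrel_add[OF lin] linrel_scl[OF lin] linrel_act[OF lin]
        submodule_zero_mem[OF Z(2)] submodule_add[OF Z(2)] submodule_scl[OF Z(2)] submodule_act[OF Z(2)])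
  moreover have "Domain ?T = R\<inverse> `` Z'" by blast
  moreover have "Range ?T = Z'" using R Z(5) unfolding relates_subquot_def by blast
  moreover have "w \<in> Z" if w: "(v, w) \<in> R" "v \<in> R\<inverse> `` Z" for v w
  proof -
    obtain w' where w': "w' \<in> Z" "(v, w') \<in> R" using w by blast
    have "(0, w - w') \<in> R" using linrel_diff[OF lin w(1) w'(2)] by simp
    then have "w - w' \<in> P" using R U unfolding relates_subquot_def by blast
    then have "(w - w') + w' \<in> Z" using submodule_add[OF Z(1)] Z(3) w'(1) by blast
    then show ?thesis by simp
  qed
  ultimately have "relates_subquot H M (R\<inverse> `` Z) (R\<inverse> `` Z') N Z Z' ?T"
    unfolding relates_subquot_def by blast
  then show ?thesis unfolding sqi_def by blast
qed

text \<open>The second isomorphism theorem relative to \<open>W\<close>: a sum \<open>w + q\<close>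
  is related to \<open>q\<close>, and two choices of \<open>q\<close> differ by an element of
  \<open>W \<inter> Q\<close>, hence of \<open>P\<close>.\<close>

lemma sqi_diamond:
  assumes W: "submodule_of H M W" and P: "submodule_of H M P" and Q: "submodule_of H M Q"
    and "P \<subseteq> Q" and WQ: "W \<inter> Q \<subseteq> P"
  shows "sqi H M (ssum W P) (ssum W Q) M P Q"
proof -
  let ?R = "{(w + q, q) | w q. w \<in> W \<and> q \<in> Q}"
  have "linrel H M M ?R"
  proof (rule linrelI)
    show "(0, 0) \<in> ?R" using submodule_zero_mem[OF W] submodule_zero_mem[OF Q] by force
  next
    fix v w v' w' assume "(v, w) \<in> ?R" "(v', w') \<in> ?R"
    then obtain a a' where "v = a + w" "v' = a' + w'" "a \<in> W" "a' \<in> W" "w \<in> Q" "w' \<in> Q" by blast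
    moreover from this have "v + v' = (a + a') + (w + w')" by (simp add: algebra_simps)
    ultimately show "(v + v', w + w') \<in> ?R" using submodule_add[OF W] submodule_add[OF Q] by blast
  next
    fix b v w assume "(v, w) \<in> ?R"
    then obtain a where "v = a + w" "a \<in> W" "w \<in> Q" by blast
    moreover from this have "scl b v = scl b a + scl b w" by (simp add: fvs.scale_right_distrib)
    ultimately show "(scl b v, scl b w) \<in> ?R" using submodule_scl[OF W] submodule_scl[OF Q] by blast
  next
    fix i v w assume i: "i < hdim H" and "(v, w) \<in> ?R"
    then obtain a where "v = a + w" "a \<in> W" "w \<in> Q" by blast
    moreover from this have "actv M i v = actv M i a + actv M i w" by (simp add: actv_add)
    ultimately show "(actv M i v, actv M i w) \<in> ?R" using submodule_act[OF W i] submodule_act[OF Q i] by blast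
  qed
  moreover have "Range ?R = Q" using submodule_zero_mem[OF W] by blast
  moreover have "Domain ?R = ssum W Q" unfolding ssum_def by blast
  moreover have "w \<in> P" if w: "v \<in> ssum W P" "(v, w) \<in> ?R" for v w
  proof -
    obtain a b p where h: "v = a + w" "a \<in> W" "w \<in> Q" "v = b + p" "b \<in> W" "p \<in> P"
      using w unfolding ssum_def by blast
    have "w - p = b - a" using h by (metis add_diff_cancel_left' add_diff_eq diff_diff_eq2 diff_add_cancel)
    then have "w - p \<in> W \<inter> Q"
      using h submodule_diff[OF W, of b a] submodule_diff[OF Q, of w p] \<open>P \<subseteq> Q\<close> by auto
    then have "(w - p) + p \<in> P" using WQ submodule_add[OF P] h by blast
    then show ?thesis by simp
  qed
  moreover have "v \<in> ssum W P" if "w \<in> P" "(v, w) \<in> ?R" for v w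
    using that unfolding ssum_def by blast
  ultimately show ?thesis by (intro sqiI[of _ _ _ ?R]) blast+
qed

section \<open>Irreducible factors and the Jordan-Hoelder theorem\<close>

definition irreducible_mod :: "'f::field hopf_data \<Rightarrow> 'f amod \<Rightarrow> bool" where
  "irreducible_mod H N \<longleftrightarrow> mdim N > 0 \<and> (\<forall>U. submodule_of H N U \<longrightarrow> U = {0} \<or> U = vecs (mdim N))"

lemma vecs_ne_0: "n > 0 \<Longrightarrow> vecs n \<noteq> {0 :: nat \<Rightarrow> 'f::field}"
proof
  assume "n > 0" and e: "vecs n = {0 :: nat \<Rightarrow> 'f}"
  have "(\<lambda>p::nat. if p = 0 then 1 else 0 :: 'f) \<in> vecs n" using \<open>n > 0\<close> by (simp add: vecs_def)
  then have "(\<lambda>p::nat. if p = 0 then 1 else 0 :: 'f) = 0" unfolding e by (rule singletonD)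
  from fun_cong[OF this, of 0] show False by simp
qed

lemma sqi_irreducible_neq:
  assumes "irreducible_mod H N" "sqi H M Y Z N {0} (vecs (mdim N))"
  shows "Y \<noteq> Z"
proof
  assume "Y = Z"
  then have "vecs (mdim N) \<subseteq> {0 :: nat \<Rightarrow> 'a}"
    using assms(2) unfolding sqi_def relates_subquot_def by blast
  moreover have "0 \<in> vecs (mdim N)" by (simp add: vecs_def)
  ultimately show False using assms(1) vecs_ne_0 unfolding irreducible_mod_def by blast
qed

text \<open>The image of \<open>X\<close> in \<open>N\<close> is 0 or everything, and it determines
  \<open>X\<close> because \<open>X\<close> contains the kernel \<open>Y\<close>.\<close>

lemma sqi_irreducible_between:
  assumes N: "irreducible_mod H N" and s: "sqi H M Y Z N {0} (vecs (mdim N))"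
    and X: "submodule_of H M X" "Y \<subseteq> X" "X \<subseteq> Z"
  shows "X = Y \<or> X = Z"
proof -
  obtain R where R: "linrel H M N R" "Domain R = Z" "Range R = vecs (mdim N)"
      "\<And>v w. (v, w) \<in> R \<Longrightarrow> v \<in> Y \<longleftrightarrow> w \<in> {0}"
    using s unfolding sqi_def relates_subquot_def by blast
  have "submodule_of H N (R `` X)" using linrel_image[OF R(1) X(1)] R(3) by simp
  then consider "R `` X = {0}" | "R `` X = vecs (mdim N)" using N unfolding irreducible_mod_def by blast
  then show ?thesis
  proof cases
    case 1
    then have "X \<subseteq> Y" using R X(3) by blast
    then show ?thesis using X(2) by blast
  next
    case 2
    have "v \<in> X" if v: "v \<in> Z" for v
    proof -
      obtain w where w: "(v, w) \<in> R" using v R(2) by blast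
      then obtain x where x: "x \<in> X" "(x, w) \<in> R" using 2 R(3) by blast
      have "(v - x, 0) \<in> R" using linrel_diff[OF R(1) w x(2)] by simp
      then have "(v - x) + x \<in> X" using R(4) X(2) submodule_add[OF X(1) _ x(1)] by blast
      then show ?thesis by simp
    qed
    then show ?thesis using X(3) by blast
  qed
qed

text \<open>\<open>filt H l S M U Y x\<close>: there is a chain of submodules from \<open>U\<close> to \<open>Y\<close> in which \<open>S i\<close>
  occurs \<open>x i\<close> times as a factor.\<close>

inductive filt :: "'f::field hopf_data \<Rightarrow> nat \<Rightarrow> (nat \<Rightarrow> 'f amod) \<Rightarrow> 'f amod \<Rightarrow> (nat \<Rightarrow> 'f) set \<Rightarrow>
    (nat \<Rightarrow> 'f) set \<Rightarrow> (nat \<Rightarrow> nat) \<Rightarrow> bool"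
  for H l S M U where
  base: "submodule_of H M U \<Longrightarrow> filt H l S M U U (\<lambda>_. 0)"
| step: "filt H l S M U Y x \<Longrightarrow> submodule_of H M Z \<Longrightarrow> Y \<subseteq> Z \<Longrightarrow> i \<le> l \<Longrightarrow>
    sqi H M Y Z (S i) {0} (vecs (mdim (S i))) \<Longrightarrow> filt H l S M U Z (x(i := Suc (x i)))"

lemma filt_submodule: "filt H l S M U Y x \<Longrightarrow> submodule_of H M U \<and> submodule_of H M Y"
  by (induction rule: filt.induct) auto

lemma filt_subset: "filt H l S M U Y x \<Longrightarrow> U \<subseteq> Y"
  by (induction rule: filt.induct) auto

lemma filt_support: "filt H l S M U Y x \<Longrightarrow> i > l \<Longrightarrow> x i = 0"
  by (induction rule: filt.induct) auto

lemma filt_append: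
  assumes "filt H l S M W Y z" "filt H l S M U W y"
  shows "filt H l S M U Y (\<lambda>i. y i + z i)"
  using assms
proof (induction rule: filt.induct)
  case (step Y z Z i)
  have "filt H l S M U Z ((\<lambda>i. y i + z i)(i := Suc (y i + z i)))"
    using filt.step[OF step.IH[OF step.prems] step.hyps(2,3,4,5)] by simp
  moreover have "(\<lambda>i. y i + z i)(i := Suc (y i + z i)) = (\<lambda>j. y j + (z(i := Suc (z i))) j)" by auto
  ultimately show ?case by simp
qed simp

text \<open>Every term of the chain is pulled back along the relation; the preimages of
  \<open>P\<close> and \<open>Q\<close> are \<open>U\<close> and \<open>Y\<close>.\<close>

lemma filt_transport:
  assumes f: "filt H l S N P Q z" and s: "sqi H M U Y N P Q"
    and U: "submodule_of H M U" "U \<subseteq> Y" and Y: "Y \<subseteq> vecs (mdim M)"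
  shows "filt H l S M U Y z"
proof -
  obtain R where R: "relates_subquot H M U Y N P Q R" using s unfolding sqi_def by blast
  have U0: "0 \<in> U" using submodule_zero_mem[OF U(1)] .
  have pre: "submodule_of H M (R\<inverse> `` Z)" if "submodule_of H N Z" for Z
    by (rule linrel_image[OF linrel_converse that]) (use R Y in \<open>auto simp: relates_subquot_def\<close>)
  have "Z \<subseteq> Q \<Longrightarrow> filt H l S M U (R\<inverse> `` Z) x" if "filt H l S N P Z x" for Z x
    using that
  proof (induction rule: filt.induct)
    case base
    have "R\<inverse> `` P = U" using R U(2) unfolding relates_subquot_def by blast
    then show ?case using filt.base[OF U(1)] by simp
  next
    case (step Z x Z' i)
    have sub: "submodule_of H N Z" "P \<subseteq> Z" using filt_submodule[OF step.hyps(1)] filt_subset[OF step.hyps(1)] by auto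
    have "sqi H M (R\<inverse> `` Z) (R\<inverse> `` Z') N Z Z'"
      by (rule relates_subquot_preimage[OF R U0 sub(1) step.hyps(2) sub(2) step.hyps(3) step.prems])
    then have "sqi H M (R\<inverse> `` Z) (R\<inverse> `` Z') (S i) {0} (vecs (mdim (S i)))"
      using step.hyps(5) sqi_trans by blast
    moreover have "filt H l S M U (R\<inverse> `` Z) x" using step.IH step.hyps(3) step.prems by blast
    ultimately show ?case using step.hyps pre by (intro filt.step) auto
  qed
  moreover have "R\<inverse> `` Q = Y" using R unfolding relates_subquot_def by blast
  ultimately show ?thesis using f by (metis order_refl)
qed

text \<open>Only irreducibility and pairwise non-isomorphism are recorded, because there are two
  instances: the given family over \<open>H\<close>, and the ground field over \<open>H\<close> with
  \<open>hdim\<close> set to 0, where the unit law of a module fails.\<close>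

locale simples =
  fixes H :: "'f::field hopf_data" and l :: nat and S :: "nat \<Rightarrow> 'f amod"
  assumes irreducible: "\<And>i. i \<le> l \<Longrightarrow> irreducible_mod H (S i)"
    and distinct: "\<And>i j. i \<le> l \<Longrightarrow> j \<le> l \<Longrightarrow>
      sqi H (S i) {0} (vecs (mdim (S i))) (S j) {0} (vecs (mdim (S j))) \<Longrightarrow> i = j"
begin

text \<open>The top factor Z/Y of the chain falls into one of the two parts. If
  \<open>W \<subseteq> Y\<close>, it belongs to the upper one. Otherwise irreducibility gives
  \<open>ssum Y W = Z\<close>, so \<open>W \<inter> Y\<close> and \<open>W\<close> bound a factor
  isomorphic to Z/Y, which extends the lower part, while Z/W is isomorphic to the quotient of
  \<open>Y\<close> by \<open>W \<inter> Y\<close>.\<close>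

lemma filt_split:
  assumes "filt H l S M U Y x" "submodule_of H M W" "U \<subseteq> W" "W \<subseteq> Y"
  shows "\<exists>y z. filt H l S M U W y \<and> filt H l S M W Y z \<and> x = (\<lambda>i. y i + z i)"
  using assms
proof (induction arbitrary: W rule: filt.induct)
  case base
  then have "W = U" by blast
  then show ?case using filt.base[OF base.hyps] by (intro exI[of _ "\<lambda>_. 0"]) auto
next
  case (step Y x Z i)
  have Y: "submodule_of H M Y" "U \<subseteq> Y" using filt_submodule[OF step.hyps(1)] filt_subset[OF step.hyps(1)] by auto
  have WY: "submodule_of H M (W \<inter> Y)" using submodule_Int[OF step.prems(1) Y(1)] .
  obtain y z where yz: "filt H l S M U (W \<inter> Y) y" "filt H l S M (W \<inter> Y) Y z" "x = (\<lambda>i. y i + z i)"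
    using step.IH[OF WY] step.prems Y by blast
  show ?case
  proof (cases "W \<subseteq> Y")
    case True
    then have "W \<inter> Y = W" by blast
    then have "filt H l S M W Z (z(i := Suc (z i)))" "filt H l S M U W y"
      using yz step.hyps filt.step by metis+
    then show ?thesis unfolding yz(3) by - (rule exI[of _ y], rule exI[of _ "z(i := Suc (z i))"], intro conjI, assumption, assumption, simp add: fun_eq_iff)
  next
    case False
    have sum: "submodule_of H M (ssum Y W)" "Y \<subseteq> ssum Y W" "ssum Y W \<subseteq> Z"
      using submodule_ssum[OF Y(1) step.prems(1)] ssum_upper1[OF step.prems(1)]
        ssum_least[OF step.hyps(2,3) step.prems(3)] by auto
    have "ssum Y W \<noteq> Y" using False ssum_upper2[OF Y(1), of W] by blast
    then have YW: "ssum Y W = Z"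
      using sqi_irreducible_between[OF irreducible[OF step.hyps(4)] step.hyps(5) sum] by blast
    have WYs: "ssum W Y = Z" using YW ssum_commute by metis
    have e1: "ssum Y (W \<inter> Y) = Y"
      using ssum_upper1[OF WY, of Y] ssum_least[OF Y(1), of Y "W \<inter> Y"] by blast
    have e2: "ssum W (W \<inter> Y) = W"
      using ssum_upper1[OF WY, of W] ssum_least[OF step.prems(1), of W "W \<inter> Y"] by blast
    have "sqi H M Y Z M (W \<inter> Y) W"
      using sqi_diamond[OF Y(1) WY step.prems(1)] e1 YW by auto
    then have "sqi H M (W \<inter> Y) W (S i) {0} (vecs (mdim (S i)))"
      using step.hyps(5) sqi_sym sqi_trans by blast
    then have f1: "filt H l S M U W (y(i := Suc (y i)))"
      using filt.step[OF yz(1) step.prems(1) _ step.hyps(4)] by blast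
    have "sqi H M W Z M (W \<inter> Y) Y"
      using sqi_diamond[OF step.prems(1) WY Y(1)] e2 WYs by auto
    then have f2: "filt H l S M W Z z"
      using step.hyps(2) by (intro filt_transport[OF yz(2) _ step.prems(1,3)]) (auto simp: submodule_of_iff)
    show ?thesis unfolding yz(3) using f1 f2 by - (rule exI[of _ "y(i := Suc (y i))"], rule exI[of _ z], intro conjI, assumption, assumption, simp add: fun_eq_iff)
  qed
qed

lemma filt_refl_zero:
  assumes "filt H l S M U U x"
  shows "x = (\<lambda>_. 0)"
  using assms
proof (cases rule: filt.cases)
  case (step Y' y i)
  then have "Y' = U" using filt_subset by blast
  then show ?thesis using sqi_irreducible_neq[OF irreducible[OF step(5)] step(6)] by blast
qed

lemma filt_single:
  assumes f: "filt H l S M Y Z x" and ne: "Y \<noteq> Z"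
    and min: "\<And>X. submodule_of H M X \<Longrightarrow> Y \<subseteq> X \<Longrightarrow> X \<subseteq> Z \<Longrightarrow> X = Y \<or> X = Z"
  shows "\<exists>i\<le>l. sqi H M Y Z (S i) {0} (vecs (mdim (S i))) \<and> x = (\<lambda>_. 0)(i := 1)"
  using f
proof (cases rule: filt.cases)
  case (step X x' i)
  have "X = Y \<or> X = Z"
    using min[of X] filt_submodule[OF step(2)] filt_subset[OF step(2)] step(4) by blast
  moreover have "X \<noteq> Z" using sqi_irreducible_neq[OF irreducible[OF step(5)] step(6)] .
  ultimately have "X = Y" by blast
  then have "x' = (\<lambda>_. 0)" using filt_refl_zero step(2) by metis
  then show ?thesis using step \<open>X = Y\<close> by auto
qed (use ne in simp)

text \<open>Jordan-Hoelder: the second chain is split at the penultimate term of the first. Its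
  lower part is settled by induction; its upper part spans an irreducible factor and so is a single
  step of the same type.\<close>

theorem filt_unique: "filt H l S M U Y x \<Longrightarrow> filt H l S M U Y y \<Longrightarrow> x = y"
proof (induction arbitrary: y rule: filt.induct)
  case base
  then show ?case using filt_refl_zero by metis
next
  case (step Y x Z i)
  obtain a b where ab: "filt H l S M U Y a" "filt H l S M Y Z b" "y = (\<lambda>i. a i + b i)"
    using filt_split[OF step.prems _ _ step.hyps(3)] filt_submodule[OF step.hyps(1)] filt_subset[OF step.hyps(1)]
    by blast
  have "x = a" using step.IH ab(1) by blast
  obtain j where j: "j \<le> l" "sqi H M Y Z (S j) {0} (vecs (mdim (S j)))" "b = (\<lambda>_. 0)(j := 1)"
    using filt_single[OF ab(2) sqi_irreducible_neq[OF irreducible[OF step.hyps(4)] step.hyps(5)]]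
      sqi_irreducible_between[OF irreducible[OF step.hyps(4)] step.hyps(5)] by blast
  have "i = j" using distinct[OF step.hyps(4) j(1)] sqi_trans[OF sqi_sym[OF step.hyps(5)] j(2)] by blast
  then show ?case using ab(3) j(3) \<open>x = a\<close> by auto
qed

end


section \<open>Matrix isomorphisms and the count of factors\<close>

global_interpretation fvp: vector_space_pair "scl :: 'f::field \<Rightarrow> _" "scl :: 'f \<Rightarrow> _"
  by unfold_locales

definition uvec :: "nat \<Rightarrow> nat \<Rightarrow> 'f::field" where
  "uvec q = (\<lambda>p. if p = q then 1 else 0)"

lemma uvec_vecs: "q < n \<Longrightarrow> uvec q \<in> vecs n"
  by (simp add: uvec_def vecs_def)

lemma vecs_expand:
  assumes "v \<in> vecs n"
  shows "v = (\<Sum>q<n. scl (v q) (uvec q))"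
proof
  fix p
  have "(\<Sum>q<n. scl (v q) (uvec q)) p = (\<Sum>q<n. if p = q then v q else 0)"
    unfolding fun_sum_apply by (rule sum.cong) (simp_all add: uvec_def)
  then show "v p = (\<Sum>q<n. scl (v q) (uvec q)) p" using assms by (auto simp: vecs_def)
qed

lemma vecs_subset_span: "vecs n \<subseteq> fvs.span (uvec ` {..<n})"
proof
  fix v :: "nat \<Rightarrow> 'f::field" assume "v \<in> vecs n"
  then have "v = (\<Sum>q<n. scl (v q) (uvec q))" by (rule vecs_expand)
  also have "\<dots> \<in> fvs.span (uvec ` {..<n})"
    by (intro fvs.span_sum fvs.span_scale fvs.span_base imageI) simp
  finally show "v \<in> fvs.span (uvec ` {..<n})" .
qed

lemma independent_vecs_finite:
  fixes B :: "(nat \<Rightarrow> 'f::field) set"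
  assumes "fvs.independent B" "B \<subseteq> vecs n"
  shows "finite B \<and> card B \<le> n"
proof -
  let ?E = "uvec ` {..<n} :: (nat \<Rightarrow> 'f) set"
  have "B \<subseteq> fvs.span ?E" using assms(2) vecs_subset_span by (rule order_trans)
  then have "finite B \<and> card B \<le> card ?E" using fvs.independent_span_bound[OF _ assms(1), of ?E] by simp
  moreover have "card ?E \<le> n" using card_image_le[of "{..<n}" "uvec :: nat \<Rightarrow> nat \<Rightarrow> 'f"] by simp
  ultimately show ?thesis by linarith
qed

lemma vecs_eqI:
  assumes "v \<in> vecs n" "w \<in> vecs n" "\<And>p. p < n \<Longrightarrow> v p = w p"
  shows "v = w"
proof
  fix p show "v p = w p" using assms by (cases "p < n") (auto simp: vecs_def)
qed

text \<open>The map that \<open>subquot_iso\<close> spells out inside its body.\<close>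

definition matap :: "nat \<Rightarrow> nat \<Rightarrow> (nat \<Rightarrow> nat \<Rightarrow> 'f::field) \<Rightarrow> (nat \<Rightarrow> 'f) \<Rightarrow> nat \<Rightarrow> 'f" where
  "matap m n \<Phi> v = (\<lambda>p. if p < m then (\<Sum>q<n. \<Phi> p q * v q) else 0)"

lemma matap_add: "matap m n \<Phi> (v + w) = matap m n \<Phi> v + matap m n \<Phi> w"
  by (rule ext) (simp add: matap_def distrib_left sum.distrib)

lemma matap_scl: "matap m n \<Phi> (scl a v) = scl a (matap m n \<Phi> v)"
  by (rule ext) (simp add: matap_def sum_distrib_left mult_ac)

lemma matap_zero: "matap m n \<Phi> 0 = 0"
  by (rule ext) (simp add: matap_def)

lemma matap_vecs: "matap m n \<Phi> v \<in> vecs m"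
  by (simp add: matap_def vecs_def)

lemma subquot_iso_iff: "subquot_iso H M U Y N \<longleftrightarrow> (\<exists>\<Phi>.
    matap (mdim N) (mdim M) \<Phi> ` Y = vecs (mdim N) \<and> {v \<in> Y. matap (mdim N) (mdim M) \<Phi> v = 0} = U \<and>
    (\<forall>i<hdim H. \<forall>v\<in>Y. matap (mdim N) (mdim M) \<Phi> (actv M i v) = actv N i (matap (mdim N) (mdim M) \<Phi> v)))"
  unfolding subquot_iso_def matap_def Let_def zero_fun_def by simp

lemma subquot_iso_imp_sqi:
  assumes Y: "submodule_of H M Y" and "subquot_iso H M U Y N"
  shows "sqi H M U Y N {0} (vecs (mdim N))"
proof -
  obtain \<Phi> where \<Phi>: "matap (mdim N) (mdim M) \<Phi> ` Y = vecs (mdim N)"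
      "{v \<in> Y. matap (mdim N) (mdim M) \<Phi> v = 0} = U"
      "\<And>i v. i < hdim H \<Longrightarrow> v \<in> Y \<Longrightarrow>
        matap (mdim N) (mdim M) \<Phi> (actv M i v) = actv N i (matap (mdim N) (mdim M) \<Phi> v)"
    using assms(2) unfolding subquot_iso_iff by auto
  define f where "f = matap (mdim N) (mdim M) \<Phi>"
  have R_iff: "(v, w) \<in> {(v, f v) | v. v \<in> Y} \<longleftrightarrow> v \<in> Y \<and> w = f v" for v w by auto
  show ?thesis
  proof (rule sqiI[of _ _ _ "{(v, f v) | v. v \<in> Y}"])
    show "linrel H M N {(v, f v) | v. v \<in> Y}"
    proof (rule linrelI, goal_cases)
      case 1
      then show ?case unfolding R_iff using submodule_zero_mem[OF Y] by (simp add: f_def matap_zero)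
    next
      case (2 v w v' w')
      then show ?case unfolding R_iff using submodule_add[OF Y] by (simp add: f_def matap_add)
    next
      case (3 a v w)
      then show ?case unfolding R_iff using submodule_scl[OF Y] by (simp add: f_def matap_scl)
    next
      case (4 i v w)
      then show ?case unfolding R_iff using submodule_act[OF Y 4(1)] \<Phi>(3)[OF 4(1)] by (simp add: f_def)
    qed
    show "Domain {(v, f v) | v. v \<in> Y} = Y" by auto
    have "Range {(v, f v) | v. v \<in> Y} = f ` Y" by auto
    then show "Range {(v, f v) | v. v \<in> Y} = vecs (mdim N)" using \<Phi>(1) unfolding f_def by simp
    show "v \<in> U \<longleftrightarrow> w \<in> {0}" if "(v, w) \<in> {(v, f v) | v. v \<in> Y}" for v w
      using that \<Phi>(2) unfolding R_iff f_def by auto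
  qed
qed

lemma linear_on_vecs_matap:
  assumes "Vector_Spaces.linear scl scl g" and v: "v \<in> vecs n" and gv: "g v \<in> vecs m"
  shows "matap m n (\<lambda>p q. g (uvec q) p) v = g v"
proof (rule vecs_eqI[OF matap_vecs gv])
  fix p assume p: "p < m"
  interpret Vector_Spaces.linear scl scl g by (rule assms(1))
  have "g v = g (\<Sum>q<n. scl (v q) (uvec q))" using vecs_expand[OF v] by simp
  also have "\<dots> = (\<Sum>q<n. scl (v q) (g (uvec q)))" by (simp only: sum scale)
  finally have "g v p = (\<Sum>q<n. scl (v q) (g (uvec q)) p)" by (simp only: fun_sum_apply)
  then show "matap m n (\<lambda>p q. g (uvec q) p) v p = g v p" using p by (simp add: matap_def mult.commute)
qed

text \<open>Since the lower term on the right is \<open>{0}\<close>, the relation is the graph of a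
  map on \<open>Y\<close>. Its values on a basis of \<open>Y\<close> extend linearly to the whole
  space, and the images of the unit vectors give the matrix that \<open>subquot_iso\<close> asks
  for.\<close>

lemma sqi_imp_subquot_iso:
  fixes M :: "'f::field amod"
  assumes Y: "submodule_of H M Y" and UY: "U \<subseteq> Y" and s: "sqi H M U Y N {0} (vecs (mdim N))"
  shows "subquot_iso H M U Y N"
proof -
  obtain R where R: "linrel H M N R" "Domain R = Y" "Range R = vecs (mdim N)"
      "\<And>v w. (v, w) \<in> R \<Longrightarrow> v \<in> U \<longleftrightarrow> w \<in> {0}"
    using s unfolding sqi_def relates_subquot_def by auto
  have uniq: "w = w'" if "(v, w) \<in> R" "(v, w') \<in> R" for v w w'
  proof -
    have "(0, w - w') \<in> R" using linrel_diff[OF R(1) that] by simp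
    moreover have "0 \<in> U" using R(4)[OF linrel_zero[OF R(1)]] by simp
    ultimately have "w - w' = 0" using R(4) by blast
    then show ?thesis by simp
  qed
  have "\<forall>v\<in>Y. \<exists>w. (v, w) \<in> R" using R(2) by auto
  then obtain f where f: "\<And>v. v \<in> Y \<Longrightarrow> (v, f v) \<in> R" using bchoice[of Y "\<lambda>v w. (v, w) \<in> R"] by auto
  obtain B :: "(nat \<Rightarrow> 'f) set" where B: "B \<subseteq> Y" "fvs.independent B" "Y \<subseteq> fvs.span B"
    using fvs.maximal_independent_subset[of Y] by metis
  obtain g where g: "Vector_Spaces.linear scl scl g" "\<forall>x\<in>B. g x = f x"
    using fvp.linear_independent_extend[OF B(2), of f] by blast
  interpret g: Vector_Spaces.linear scl scl g by (rule g(1))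
  \<comment> \<open>The vectors that \<open>g\<close> maps to a partner under \<open>R\<close> form
    a subspace, so it suffices to check the basis.\<close>
  have "fvs.subspace {v. (v, g v) \<in> R}"
    unfolding fvs.subspace_def
    using linrel_zero[OF R(1)] linrel_add[OF R(1)] linrel_scl[OF R(1)] by (auto simp: g.add g.scale)
  moreover have "B \<subseteq> {v. (v, g v) \<in> R}" using g(2) f B(1) by auto
  ultimately have "fvs.span B \<subseteq> {v. (v, g v) \<in> R}" by (simp add: fvs.span_minimal)
  then have gR: "(v, g v) \<in> R" if "v \<in> Y" for v using B(3) that by auto
  have gvecs: "g v \<in> vecs (mdim N)" if "v \<in> Y" for v using gR[OF that] R(3) by auto
  define \<Phi> where "\<Phi> = (\<lambda>p q. g (uvec q) p)"
  have ap: "matap (mdim N) (mdim M) \<Phi> v = g v" if "v \<in> Y" for v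
    unfolding \<Phi>_def using submodule_vecs_subset[OF Y] that gvecs by (intro linear_on_vecs_matap[OF g(1)]) auto
  have "matap (mdim N) (mdim M) \<Phi> ` Y = g ` Y" using ap by (intro image_cong) auto
  also have "\<dots> = vecs (mdim N)"
  proof
    show "g ` Y \<subseteq> vecs (mdim N)" using gvecs by auto
    show "vecs (mdim N) \<subseteq> g ` Y"
    proof
      fix w :: "nat \<Rightarrow> 'f" assume "w \<in> vecs (mdim N)"
      then obtain v where v: "(v, w) \<in> R" using R(3) by auto
      then have "v \<in> Y" using R(2) by auto
      then show "w \<in> g ` Y" using uniq[OF v gR] by auto
    qed
  qed
  finally have 1: "matap (mdim N) (mdim M) \<Phi> ` Y = vecs (mdim N)" .
  have 2: "{v \<in> Y. matap (mdim N) (mdim M) \<Phi> v = 0} = U"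
    using R(4)[OF gR] UY by (auto simp: ap)
  have 3: "matap (mdim N) (mdim M) \<Phi> (actv M i v) = actv N i (matap (mdim N) (mdim M) \<Phi> v)"
    if "i < hdim H" "v \<in> Y" for i v
    using uniq[OF gR[OF submodule_act[OF Y that]] linrel_act[OF R(1) that(1) gR[OF that(2)]]]
      submodule_act[OF Y that] that(2) by (simp add: ap)
  show ?thesis unfolding subquot_iso_iff using 1 2 3 by (intro exI[of _ \<Phi>] conjI) auto
qed

lemma filt_imp_comp_series:
  assumes "filt H l S M U Y x" and irr: "\<And>i. i \<le> l \<Longrightarrow> irreducible_mod H (S i)"
  shows "\<exists>Us. Us \<noteq> [] \<and> hd Us = U \<and> last Us = Y \<and> (\<forall>j<length Us. submodule_of H M (Us ! j)) \<and>
     (\<forall>j. Suc j < length Us \<longrightarrow> Us ! j \<subset> Us ! Suc j \<and>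
        (\<forall>W. submodule_of H M W \<longrightarrow> Us ! j \<subseteq> W \<longrightarrow> W \<subseteq> Us ! Suc j \<longrightarrow> W = Us ! j \<or> W = Us ! Suc j))"
  using assms(1)
proof (induction rule: filt.induct)
  case base
  then show ?case by (intro exI[of _ "[U]"]) auto
next
  case (step Y x Z i)
  then obtain Us where Us: "Us \<noteq> []" "hd Us = U" "last Us = Y" "\<forall>j<length Us. submodule_of H M (Us ! j)"
     "\<forall>j. Suc j < length Us \<longrightarrow> Us ! j \<subset> Us ! Suc j \<and>
        (\<forall>W. submodule_of H M W \<longrightarrow> Us ! j \<subseteq> W \<longrightarrow> W \<subseteq> Us ! Suc j \<longrightarrow> W = Us ! j \<or> W = Us ! Suc j)"
    by blast
  have YZ: "Y \<subset> Z" using step.hyps(3) sqi_irreducible_neq[OF irr[OF step.hyps(4)] step.hyps(5)] by blast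
  have btw: "W = Y \<or> W = Z" if "submodule_of H M W" "Y \<subseteq> W" "W \<subseteq> Z" for W
    using sqi_irreducible_between[OF irr[OF step.hyps(4)] step.hyps(5) that] .
  have last: "Us ! (length Us - 1) = Y" using Us(1,3) by (simp add: last_conv_nth)
  let ?V = "Us @ [Z]"
  have "submodule_of H M (?V ! j)" if "j < length ?V" for j
    using that Us(4) step.hyps(2) by (cases "j < length Us") (auto simp: nth_append)
  moreover have "?V ! j \<subset> ?V ! Suc j \<and>
        (\<forall>W. submodule_of H M W \<longrightarrow> ?V ! j \<subseteq> W \<longrightarrow> W \<subseteq> ?V ! Suc j \<longrightarrow> W = ?V ! j \<or> W = ?V ! Suc j)"
    if j: "Suc j < length ?V" for j
  proof (cases "Suc j < length Us")
    case True
    then show ?thesis using Us(5) by (simp add: nth_append)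
  next
    case False
    then have "Suc j = length Us" using j by simp
    then have "j = length Us - 1" "j < length Us" "Suc j = length Us" by auto
    then have "?V ! j = Y" "?V ! Suc j = Z" using last by (simp_all add: nth_append)
    then show ?thesis using YZ btw by simp
  qed
  ultimately show ?case using Us(1,2) by (intro exI[of _ ?V]) simp
qed

context simples
begin

text \<open>The factors in \<open>comp_series\<close> are only known to be minimal. Cutting the
  chain of \<open>f\<close> at two neighbouring terms leaves a chain between them, which minimality
  forces to be one step, so the factor is isomorphic to exactly one \<open>S i\<close>.\<close>

lemma comp_series_counts:
  assumes f: "filt H l S M {0} (vecs (mdim M)) x" and cs: "comp_series H M Us" and "j < length Us"
  shows "filt H l S M (hd Us) (Us ! j) (\<lambda>i. if i \<le> l then card {k. k < j \<and> subquot_iso H M (Us ! k) (Us ! Suc k) (S i)} else 0)"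
proof -
  have hd: "hd Us = {0}" using cs unfolding comp_series_def zero_fun_def by auto
  show ?thesis using assms(3)
proof (induction j)
  case 0
  have "Us \<noteq> []" using cs unfolding comp_series_def by simp
  then have "Us ! 0 = hd Us" by (simp add: hd_conv_nth)
  then have "filt H l S M (hd Us) (Us ! 0) (\<lambda>_. 0)"
    using filt.base[OF submodule_0, of H l S M] hd by (simp only:)
  moreover have "(\<lambda>i. if i \<le> l then card {k. k < 0 \<and> subquot_iso H M (Us ! k) (Us ! Suc k) (S i)} else 0) = (\<lambda>_. 0)"
    by auto
  ultimately show ?case by (simp only:)
next
  case (Suc j)
  let ?c = "\<lambda>j i. if i \<le> l then card {k. k < j \<and> subquot_iso H M (Us ! k) (Us ! Suc k) (S i)} else 0"
  have IH: "filt H l S M (hd Us) (Us ! j) (?c j)" using Suc by simp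
  have sub: "submodule_of H M (Us ! j)" "submodule_of H M (Us ! Suc j)" "Us ! j \<subset> Us ! Suc j"
    and min: "\<And>W. submodule_of H M W \<Longrightarrow> Us ! j \<subseteq> W \<Longrightarrow> W \<subseteq> Us ! Suc j \<Longrightarrow> W = Us ! j \<or> W = Us ! Suc j"
    using cs Suc.prems unfolding comp_series_def by auto
  have z: "{0} \<subseteq> Us ! j" using submodule_zero_mem[OF sub(1)] by simp
  obtain y where y: "filt H l S M {0} (Us ! Suc j) y"
    using filt_split[OF f sub(2)] z sub(3) submodule_vecs_subset[OF sub(2)] by blast
  obtain w where w: "filt H l S M (Us ! j) (Us ! Suc j) w"
    using filt_split[OF y sub(1) z] sub(3) by blast
  obtain i0 where i0: "i0 \<le> l" "sqi H M (Us ! j) (Us ! Suc j) (S i0) {0} (vecs (mdim (S i0)))"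
    using filt_single[OF w _ min] sub(3) by blast
  have iff: "subquot_iso H M (Us ! j) (Us ! Suc j) (S i) \<longleftrightarrow> i = i0" if "i \<le> l" for i
  proof
    assume "subquot_iso H M (Us ! j) (Us ! Suc j) (S i)"
    then have "sqi H M (Us ! j) (Us ! Suc j) (S i) {0} (vecs (mdim (S i)))"
      by (rule subquot_iso_imp_sqi[OF sub(2)])
    then show "i = i0" using distinct[OF that i0(1)] sqi_trans[OF sqi_sym i0(2)] by simp
  next
    assume "i = i0"
    then show "subquot_iso H M (Us ! j) (Us ! Suc j) (S i)"
      using sqi_imp_subquot_iso[OF sub(2) _ i0(2)] sub(3) by auto
  qed
  have "?c (Suc j) = (?c j)(i0 := Suc (?c j i0))"
  proof
    fix i
    show "?c (Suc j) i = ((?c j)(i0 := Suc (?c j i0))) i"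
    proof (cases "i \<le> l")
      case True
      let ?P = "\<lambda>k. subquot_iso H M (Us ! k) (Us ! Suc k) (S i)"
      have "{k. k < Suc j \<and> ?P k} = (if i = i0 then insert j {k. k < j \<and> ?P k} else {k. k < j \<and> ?P k})"
        using iff[OF True] by (auto simp: less_Suc_eq)
      then show ?thesis using True by auto
    qed (use i0(1) in auto)
  qed
  moreover have "filt H l S M (hd Us) (Us ! Suc j) ((?c j)(i0 := Suc (?c j i0)))"
    using filt.step[OF IH sub(2) _ i0] sub(3) by blast
  ultimately show ?case by simp
qed
qed

text \<open>By \<open>filt_unique\<close> the series picked by \<open>SOME\<close> gives the same
  count as any chain, so from here on a multiplicity can be read off whichever chain is
  convenient.\<close>

lemma comp_mult_eq:
  assumes f: "filt H l S M {0} (vecs (mdim M)) x" and "i \<le> l"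
  shows "comp_mult H M (S i) = x i"
proof -
  define Us where "Us = (SOME Us. comp_series H M Us)"
  have "\<exists>Us. comp_series H M Us"
    using filt_imp_comp_series[OF f irreducible] unfolding comp_series_def zero_fun_def .
  then have cs: "comp_series H M Us" unfolding Us_def by (rule someI_ex)
  define c where "c = (\<lambda>i. if i \<le> l then card {k. k < length Us - 1 \<and> subquot_iso H M (Us ! k) (Us ! Suc k) (S i)} else 0)"
  have hd: "hd Us = {0}" using cs unfolding comp_series_def zero_fun_def by auto
  have ne: "Us \<noteq> []" "last Us = vecs (mdim M)" using cs by (auto simp: comp_series_def)
  then have "Us ! (length Us - 1) = vecs (mdim M)" by (simp add: last_conv_nth)
  then have "filt H l S M {0} (vecs (mdim M)) c"
    using comp_series_counts[OF f cs, of "length Us - 1"] ne(1) hd unfolding c_def by simp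
  then have "x = c" using filt_unique[OF f] by simp
  moreover have "comp_mult H M (S i) = c i"
    using assms(2) unfolding comp_mult_def Us_def[symmetric] Let_def c_def by (simp add: less_diff_conv)
  ultimately show ?thesis by simp
qed

end


section \<open>Subquotients as modules and existence of chains\<close>

lemma actv_uvec: "p < mdim M \<Longrightarrow> q < mdim M \<Longrightarrow> actv M i (uvec q) p = act M i p q"
  by (simp add: actv_def uvec_def if_distrib[of "\<lambda>t. _ * t"] cong: if_cong)

lemma actv_actv_apply:
  assumes "p < mdim M" "q < mdim M"
  shows "actv M i (actv M j (uvec q)) p = (\<Sum>t<mdim M. act M i p t * act M j t q)"
  using assms by (simp add: actv_def[of M i] actv_uvec)

text \<open>In this form the axioms speak of operators instead of matrix entries, so they pass
  through a relation to a quotient without a computation in coordinates.\<close>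

lemma is_module_iff:
  "is_module H M \<longleftrightarrow>
    (\<forall>i<hdim H. \<forall>j<hdim H. \<forall>v\<in>vecs (mdim M).
        actv M i (actv M j v) = (\<Sum>k<hdim H. scl (hmult H i j k) (actv M k v)))
    \<and> (\<forall>v\<in>vecs (mdim M). (\<Sum>k<hdim H. scl (hunit H k) (actv M k v)) = v)"
  (is "_ \<longleftrightarrow> ?assoc \<and> ?unit")
proof -
  let ?n = "mdim M"
  have sum_app: "(\<Sum>k<hdim H. scl (c k) (actv M k (uvec q))) p = (\<Sum>k<hdim H. c k * act M k p q)"
    if "p < ?n" "q < ?n" for c p q
    using that by (simp add: fun_sum_apply actv_uvec)
  have sum_vecs: "(\<Sum>k<hdim H. scl (c k) (actv M k v)) \<in> vecs ?n" for c v
    by (intro fvs.subspace_sum fvs.subspace_scale vecs_subspace) simp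
  show ?thesis
  proof
    assume m: "is_module H M"
    have e1: "actv M i (actv M j (uvec q)) = (\<Sum>k<hdim H. scl (hmult H i j k) (actv M k (uvec q)))"
      if "i < hdim H" "j < hdim H" "q < ?n" for i j q
      by (rule vecs_eqI[OF actv_vecs sum_vecs])
        (use m that in \<open>auto simp: is_module_def Let_def actv_actv_apply sum_app\<close>)
    have e2: "(\<Sum>k<hdim H. scl (hunit H k) (actv M k (uvec q))) = uvec q" if "q < ?n" for q
    proof (rule vecs_eqI[OF sum_vecs uvec_vecs[OF that]])
      fix p assume p: "p < ?n"
      have "(\<Sum>k<hdim H. hunit H k * act M k p q) = kd p q"
        using m p that by (simp add: is_module_def Let_def)
      then show "(\<Sum>k<hdim H. scl (hunit H k) (actv M k (uvec q))) p = uvec q p"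
        unfolding sum_app[OF p that] by (simp add: uvec_def kd_def)
    qed
    have exp: "actv M i v = (\<Sum>q<?n. scl (v q) (actv M i (uvec q)))" if "v \<in> vecs ?n" for i v
      by (subst vecs_expand[OF that]) (simp only: actv_sum actv_scl)
    have assoc: ?assoc
    proof (intro allI impI ballI)
      fix i j and v :: "nat \<Rightarrow> 'a" assume ij: "i < hdim H" "j < hdim H" and v: "v \<in> vecs ?n"
      have "actv M i (actv M j v) = (\<Sum>q<?n. scl (v q) (actv M i (actv M j (uvec q))))"
        by (simp only: exp[OF v, of j] actv_sum actv_scl)
      also have "\<dots> = (\<Sum>q<?n. scl (v q) (\<Sum>k<hdim H. scl (hmult H i j k) (actv M k (uvec q))))"
        by (rule sum.cong) (use e1[OF ij] in auto)
      also have "\<dots> = (\<Sum>k<hdim H. \<Sum>q<?n. scl (v q) (scl (hmult H i j k) (actv M k (uvec q))))"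
        by (subst sum.swap) (simp only: fvs.scale_sum_right)
      also have "\<dots> = (\<Sum>k<hdim H. scl (hmult H i j k) (actv M k v))"
        by (simp only: exp[OF v] fvs.scale_sum_right fvs.scale_left_commute)
      finally show "actv M i (actv M j v) = (\<Sum>k<hdim H. scl (hmult H i j k) (actv M k v))" .
    qed
    moreover have ?unit
    proof
      fix v :: "nat \<Rightarrow> 'a" assume v: "v \<in> vecs ?n"
      have "(\<Sum>k<hdim H. scl (hunit H k) (actv M k v))
          = (\<Sum>k<hdim H. \<Sum>q<?n. scl (v q) (scl (hunit H k) (actv M k (uvec q))))"
        by (simp only: exp[OF v] fvs.scale_sum_right fvs.scale_left_commute)
      also have "\<dots> = (\<Sum>q<?n. scl (v q) (\<Sum>k<hdim H. scl (hunit H k) (actv M k (uvec q))))"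
        by (subst sum.swap) (simp only: fvs.scale_sum_right)
      also have "\<dots> = (\<Sum>q<?n. scl (v q) (uvec q))" by (rule sum.cong) (use e2 in auto)
      finally show "(\<Sum>k<hdim H. scl (hunit H k) (actv M k v)) = v" using vecs_expand[OF v] by simp
    qed
    ultimately show "?assoc \<and> ?unit" by blast
  next
    assume au: "?assoc \<and> ?unit"
    have "(\<Sum>t<?n. act M i p t * act M j t q) = (\<Sum>k<hdim H. hmult H i j k * act M k p q)"
      if "i < hdim H" "j < hdim H" "p < ?n" "q < ?n" for i j p q
    proof -
      have "actv M i (actv M j (uvec q)) = (\<Sum>k<hdim H. scl (hmult H i j k) (actv M k (uvec q)))"
        using au uvec_vecs[OF that(4)] that(1,2) by blast
      then show ?thesis unfolding actv_actv_apply[OF that(3,4), symmetric] sum_app[OF that(3,4), symmetric]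
        by (rule fun_cong)
    qed
    moreover have "(\<Sum>k<hdim H. hunit H k * act M k p q) = kd p q" if "p < ?n" "q < ?n" for p q
    proof -
      have "(\<Sum>k<hdim H. scl (hunit H k) (actv M k (uvec q))) = uvec q" using au uvec_vecs[OF that(2)] by blast
      then show ?thesis unfolding sum_app[OF that, symmetric] by (simp add: uvec_def kd_def)
    qed
    ultimately show "is_module H M" unfolding is_module_def Let_def by blast
  qed
qed

lemma actv_expand:
  assumes "v \<in> vecs (mdim M)"
  shows "actv M i v = (\<Sum>q<mdim M. scl (v q) (actv M i (uvec q)))"
  by (subst vecs_expand[OF assms]) (simp only: actv_sum actv_scl)

text \<open>\<open>simple_classes\<close> speaks of modules given by matrices, so an abstract factor
  W/U has to receive coordinates: a basis of \<open>U\<close> is extended to one of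
  \<open>W\<close>, and the added vectors represent a basis of the quotient.\<close>

lemma realize_subquotient:
  fixes M :: "'f::field amod"
  assumes M: "is_module H M" and U: "submodule_of H M U" and W: "submodule_of H M W" and UW: "U \<subseteq> W"
  shows "\<exists>N. is_module H N \<and> sqi H M U W N {0} (vecs (mdim N))"
proof -
  have Us: "fvs.subspace U" and Ws: "fvs.subspace W" using U W by (auto simp: submodule_of_iff)
  obtain B :: "(nat \<Rightarrow> 'f) set" where B: "B \<subseteq> U" "fvs.independent B" "U \<subseteq> fvs.span B"
    using fvs.maximal_independent_subset[of U] by metis
  have BU: "fvs.span B \<subseteq> U" using B(1) Us by (rule fvs.span_minimal)
  obtain C :: "(nat \<Rightarrow> 'f) set" where C: "B \<subseteq> C" "C \<subseteq> W" "fvs.independent C" "W \<subseteq> fvs.span C"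
    using fvs.maximal_independent_subset_extend[OF _ B(2), of W] B(1) UW by (metis order_trans)
  have finC: "finite C"
    using independent_vecs_finite[OF C(3)] C(2) submodule_vecs_subset[OF W] by (meson order_trans)
  define m where "m = card (C - B)"
  obtain d where d: "bij_betw d {..<m} (C - B)"
    using ex_bij_betw_nat_finite[of "C - B"] finC unfolding m_def atLeast0LessThan by auto
  have dC: "d q \<in> C - B" if "q < m" for q using bij_betwE[OF d] that by simp
  have dW: "d q \<in> W" if "q < m" for q using dC[OF that] C(2) by auto
  \<comment> \<open>Lifts a coordinate vector of the quotient back to \<open>W\<close>.\<close>
  define tot where "tot = (\<lambda>y. \<Sum>p<m. scl (y p) (d p))"
  have tot_add: "tot (y + z) = tot y + tot z" for y z
    by (simp add: tot_def fvs.scale_left_distrib sum.distrib)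
  have tot_scl: "tot (scl a y) = scl a (tot y)" for a y
    by (simp only: tot_def fvs.scale_sum_right fvs.scale_scale scl_apply)
  have tot_W: "tot y \<in> W" for y
    unfolding tot_def by (intro fvs.subspace_sum[OF Ws] fvs.subspace_scale[OF Ws]) (use dW in auto)
  have tot_0: "tot 0 = 0" by (simp add: tot_def)
  have indep: "y = 0" if y: "y \<in> vecs m" "tot y \<in> U" for y
  proof (rule vecs_eqI[OF y(1)])
    show "0 \<in> vecs m" by (simp add: vecs_def)
    fix q assume q: "q < m"
    show "y q = 0 q"
    proof (rule ccontr)
      assume "y q \<noteq> 0 q"
      then have yq: "y q \<noteq> 0" by simp
      let ?T = "fvs.span (C - {d q})"
      have rest: "(\<Sum>p\<in>{..<m} - {q}. scl (y p) (d p)) \<in> ?T"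
      proof (intro fvs.span_sum fvs.span_scale fvs.span_base)
        fix p assume p: "p \<in> {..<m} - {q}"
        then have "d p \<noteq> d q" using d q by (auto simp: bij_betw_def inj_on_def)
        then show "d p \<in> C - {d q}" using dC[of p] p by simp
      qed
      have "B \<subseteq> C - {d q}" using C(1) dC[OF q] by auto
      then have "tot y \<in> ?T" using y(2) B(3) fvs.span_mono by blast
      then have "tot y - (\<Sum>p\<in>{..<m} - {q}. scl (y p) (d p)) \<in> ?T" using rest by (rule fvs.span_diff)
      moreover have "tot y = scl (y q) (d q) + (\<Sum>p\<in>{..<m} - {q}. scl (y p) (d p))"
        unfolding tot_def using q by (intro sum.remove) auto
      ultimately have "scl (y q) (d q) \<in> ?T" by simp
      then have "scl (inverse (y q)) (scl (y q) (d q)) \<in> ?T" by (rule fvs.span_scale)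
      then have "d q \<in> ?T" using yq by simp
      then show False using C(3) dC[OF q] unfolding fvs.dependent_def by blast
    qed
  qed
  have exist: "\<exists>y\<in>vecs m. v - tot y \<in> U" if v: "v \<in> W" for v
  proof -
    have "v \<in> fvs.span (B \<union> (C - B))" using v C(4) C(1) by (simp add: Un_absorb1 subset_iff)
    then obtain b t where bt: "v = b + t" "b \<in> fvs.span B" "t \<in> fvs.span (C - B)"
      unfolding fvs.span_Un by blast
    obtain u where u: "t = (\<Sum>a\<in>C - B. scl (u a) a)"
      using bt(3) finC unfolding fvs.span_finite[OF finite_Diff[OF finC]] by blast
    define y where "y = (\<lambda>p. if p < m then u (d p) else 0)"
    have "t = (\<Sum>p<m. scl (u (d p)) (d p))" unfolding u by (rule sum.reindex_bij_betw[OF d, symmetric])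
    also have "\<dots> = tot y" unfolding tot_def by (rule sum.cong) (auto simp: y_def)
    finally have "v - tot y = b" using bt(1) by simp
    moreover have "y \<in> vecs m" by (simp add: y_def vecs_def)
    ultimately show ?thesis using bt(2) BU by auto
  qed
  define R where "R = {(v, y). v \<in> W \<and> y \<in> vecs m \<and> v - tot y \<in> U}"
  have R_iff: "(v, y) \<in> R \<longleftrightarrow> v \<in> W \<and> y \<in> vecs m \<and> v - tot y \<in> U" for v y by (simp add: R_def)
  have R0: "(0, 0) \<in> R"
    unfolding R_iff using submodule_zero_mem[OF U] submodule_zero_mem[OF W] tot_0 by (simp add: vecs_def)
  have R_add: "(v + v', y + y') \<in> R" if r: "(v, y) \<in> R" "(v', y') \<in> R" for v y v' y'
  proof -
    have "(v + v') - tot (y + y') = (v - tot y) + (v' - tot y')" by (simp only: tot_add add_diff_add)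
    then show ?thesis using r submodule_add[OF U] submodule_add[OF W] fvs.subspace_add[OF vecs_subspace]
      unfolding R_iff by metis
  qed
  have R_scl: "(scl a v, scl a y) \<in> R" if r: "(v, y) \<in> R" for a v y
  proof -
    have "scl a v - tot (scl a y) = scl a (v - tot y)" by (simp only: tot_scl fvs.scale_right_diff_distrib)
    then show ?thesis using r submodule_scl[OF U] submodule_scl[OF W] fvs.subspace_scale[OF vecs_subspace]
      unfolding R_iff by metis
  qed
  have R_sum: "((\<Sum>k\<in>K. f k), (\<Sum>k\<in>K. g k)) \<in> R" if "\<And>k. k \<in> K \<Longrightarrow> (f k, g k) \<in> R" for K :: "nat set" and f g
  proof -
    \<comment> \<open>Setting \<open>hdim\<close> to 0 erases the action, so the general lemma on
      sums applies before the module \<open>N\<close> exists.\<close>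
    have "linrel (H\<lparr>hdim := 0\<rparr>) M M R" by (rule linrelI) (simp_all add: R0 R_add R_scl)
    then show ?thesis using that by (rule linrel_sum)
  qed
  have uniq: "y = y'" if r: "(v, y) \<in> R" "(v, y') \<in> R" for v y y'
  proof -
    have "(v + scl (-1) v, y + scl (-1) y') \<in> R" by (intro R_add R_scl r)
    then have h: "(0, y - y') \<in> R" by simp
    then have "0 - (0 - tot (y - y')) \<in> U" using submodule_diff[OF U submodule_zero_mem[OF U]] unfolding R_iff by blast
    then have "tot (y - y') \<in> U" by simp
    then have "y - y' = 0" using indep h unfolding R_iff by blast
    then show ?thesis by simp
  qed
  have "\<forall>i q. \<exists>y. i < hdim H \<longrightarrow> q < m \<longrightarrow> (actv M i (d q), y) \<in> R"
  proof (intro allI)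
    fix i q
    show "\<exists>y. i < hdim H \<longrightarrow> q < m \<longrightarrow> (actv M i (d q), y) \<in> R"
    proof (cases "i < hdim H \<and> q < m")
      case True
      then have "actv M i (d q) \<in> W" using submodule_act[OF W _ dW] by blast
      then show ?thesis using exist R_iff by blast
    qed auto
  qed
  \<comment> \<open>\<open>Y i q\<close> holds the coordinates of \<open>e_i\<close> applied to the
    q-th basis vector, that is, column \<open>q\<close> of the matrix of \<open>e_i\<close> on
    \<open>N\<close>.\<close>
  then obtain Y where Y: "\<And>i q. i < hdim H \<Longrightarrow> q < m \<Longrightarrow> (actv M i (d q), Y i q) \<in> R" by metis
  define N where "N = \<lparr>mdim = m, act = (\<lambda>i p q. Y i q p)\<rparr>"
  have mN: "mdim N = m" by (simp add: N_def)
  have Nu: "actv N i (uvec q) = Y i q" if iq: "i < hdim H" "q < m" for i q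
  proof (rule vecs_eqI)
    show "actv N i (uvec q) \<in> vecs m" using actv_vecs[of N] mN by simp
    show "Y i q \<in> vecs m" using Y[OF iq] R_iff by blast
    show "actv N i (uvec q) p = Y i q p" if "p < m" for p
      using actv_uvec[of p N q i] that iq mN by (simp add: N_def)
  qed
  have R_act: "(actv M i v, actv N i y) \<in> R" if i: "i < hdim H" and r: "(v, y) \<in> R" for i v y
  proof -
    have y: "y \<in> vecs m" and u: "v - tot y \<in> U" using r R_iff by auto
    \<comment> \<open>\<open>v\<close> splits into a part in \<open>U\<close>, which is mapped into
      \<open>U\<close> and so is related to 0, and a combination of basis vectors, which
      \<open>Y\<close> handles.\<close>
    have "actv M i (v - tot y) \<in> U" using submodule_act[OF U i u] .
    then have "(actv M i (v - tot y), 0) \<in> R" unfolding R_iff using UW tot_0 by (auto simp: vecs_def)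
    moreover have "((\<Sum>q<m. scl (y q) (actv M i (d q))), (\<Sum>q<m. scl (y q) (Y i q))) \<in> R"
      by (intro R_sum R_scl Y i) simp
    ultimately have "(actv M i (v - tot y) + (\<Sum>q<m. scl (y q) (actv M i (d q))), 0 + (\<Sum>q<m. scl (y q) (Y i q))) \<in> R"
      by (rule R_add)
    moreover have "actv M i (v - tot y) + (\<Sum>q<m. scl (y q) (actv M i (d q))) = actv M i v"
    proof -
      have "(\<Sum>q<m. scl (y q) (actv M i (d q))) = actv M i (tot y)" by (simp only: tot_def actv_sum actv_scl)
      then show ?thesis by (simp only: actv_add[symmetric] diff_add_cancel)
    qed
    moreover have "(\<Sum>q<m. scl (y q) (Y i q)) = actv N i y"
    proof -
      have "actv N i y = (\<Sum>q<m. scl (y q) (actv N i (uvec q)))" using actv_expand[of y N i] y mN by simp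
      also have "\<dots> = (\<Sum>q<m. scl (y q) (Y i q))" by (rule sum.cong) (use Nu[OF i] in auto)
      finally show ?thesis by simp
    qed
    ultimately show ?thesis by (simp only: add_0)
  qed
  have R_surj: "(tot y, y) \<in> R" if "y \<in> vecs m" for y
    unfolding R_iff using that tot_W submodule_zero_mem[OF U] by simp
  have Mact: "actv M i (actv M j v) = (\<Sum>k<hdim H. scl (hmult H i j k) (actv M k v))"
    if "i < hdim H" "j < hdim H" "v \<in> vecs (mdim M)" for i j v
    using M that unfolding is_module_iff by blast
  have Munit: "(\<Sum>k<hdim H. scl (hunit H k) (actv M k v)) = v" if "v \<in> vecs (mdim M)" for v
    using M that unfolding is_module_iff by blast
  \<comment> \<open>The two sides of a module law in \<open>M\<close> are related to the two sides
    in \<open>N\<close>, and \<open>uniq\<close> turns this into an equation.\<close>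
  have "is_module H N"
    unfolding is_module_iff
  proof (intro conjI allI impI ballI)
    fix i j and y :: "nat \<Rightarrow> 'f" assume ij: "i < hdim H" "j < hdim H" and "y \<in> vecs (mdim N)"
    then have r: "(tot y, y) \<in> R" using R_surj mN by simp
    have v: "tot y \<in> vecs (mdim M)" using tot_W submodule_vecs_subset[OF W] by blast
    have "(actv M i (actv M j (tot y)), actv N i (actv N j y)) \<in> R" by (intro R_act ij r)
    moreover have "((\<Sum>k<hdim H. scl (hmult H i j k) (actv M k (tot y))),
        (\<Sum>k<hdim H. scl (hmult H i j k) (actv N k y))) \<in> R"
      by (intro R_sum R_scl R_act r) simp
    ultimately show "actv N i (actv N j y) = (\<Sum>k<hdim H. scl (hmult H i j k) (actv N k y))"
      unfolding Mact[OF ij v] by (rule uniq)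
  next
    fix y :: "nat \<Rightarrow> 'f" assume "y \<in> vecs (mdim N)"
    then have r: "(tot y, y) \<in> R" using R_surj mN by simp
    have v: "tot y \<in> vecs (mdim M)" using tot_W submodule_vecs_subset[OF W] by blast
    have "((\<Sum>k<hdim H. scl (hunit H k) (actv M k (tot y))),
        (\<Sum>k<hdim H. scl (hunit H k) (actv N k y))) \<in> R"
      by (intro R_sum R_scl R_act r) simp
    then show "(\<Sum>k<hdim H. scl (hunit H k) (actv N k y)) = y"
      unfolding Munit[OF v] using r by (rule uniq)
  qed
  moreover have "sqi H M U W N {0} (vecs (mdim N))"
  proof (rule sqiI)
    show "linrel H M N R" by (rule linrelI) (simp_all add: R0 R_add R_scl R_act)
    show "Domain R = W"
    proof (intro equalityI subsetI)
      fix v assume "v \<in> W"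
      then obtain y where "(v, y) \<in> R" using exist R_iff by blast
      then show "v \<in> Domain R" by (rule DomainI)
    qed (use R_iff in auto)
    show "Range R = vecs (mdim N)"
    proof (intro equalityI subsetI)
      fix y :: "nat \<Rightarrow> 'f" assume "y \<in> vecs (mdim N)"
      then have "(tot y, y) \<in> R" using R_surj mN by simp
      then show "y \<in> Range R" by (rule RangeI)
    qed (use R_iff mN in auto)
    show "v \<in> U \<longleftrightarrow> y \<in> {0}" if r: "(v, y) \<in> R" for v y
    proof
      assume "v \<in> U"
      then have "(v, 0) \<in> R" unfolding R_iff using UW tot_0 by (auto simp: vecs_def)
      then show "y \<in> {0}" using uniq[OF r] by simp
    next
      assume "y \<in> {0}"
      then show "v \<in> U" using r tot_0 unfolding R_iff by simp
    qed
  qed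
  ultimately show ?thesis by blast
qed

lemma dim_strict_mono:
  fixes U W :: "(nat \<Rightarrow> 'f::field) set"
  assumes U: "fvs.subspace U" and UW: "U \<subset> W" and W: "W \<subseteq> vecs n"
  shows "fvs.dim U < fvs.dim W \<and> fvs.dim W \<le> n"
proof -
  obtain B :: "(nat \<Rightarrow> 'f) set" where B: "B \<subseteq> U" "fvs.independent B" "U \<subseteq> fvs.span B"
    using fvs.maximal_independent_subset[of U] by metis
  obtain C :: "(nat \<Rightarrow> 'f) set" where C: "B \<subseteq> C" "C \<subseteq> W" "fvs.independent C" "W \<subseteq> fvs.span C"
    using fvs.maximal_independent_subset_extend[OF _ B(2), of W] B(1) UW by (metis order_trans psubset_imp_subset)
  have fin: "finite C \<and> card C \<le> n" by (rule independent_vecs_finite[OF C(3) order_trans[OF C(2) W]])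
  have "fvs.span B \<subseteq> U" using B(1) U by (rule fvs.span_minimal)
  then have "B \<noteq> C" using UW C(4) by auto
  then have "card B < card C" using fin C(1) by (intro psubset_card_mono) auto
  then show ?thesis
    using fin fvs.basis_card_eq_dim[OF B(1,3,2)] fvs.basis_card_eq_dim[OF C(2,4,3)] by simp
qed

lemma simple_mod_iff: "simple_mod H N \<longleftrightarrow> is_module H N \<and> irreducible_mod H N"
  unfolding simple_mod_def irreducible_mod_def zero_fun_def by blast

lemma mod_iso_imp_sqi: "mod_iso H M N \<Longrightarrow> sqi H M {0} (vecs (mdim M)) N {0} (vecs (mdim N))"
  unfolding mod_iso_def zero_fun_def[symmetric] by (rule subquot_iso_imp_sqi[OF submodule_vecs])

lemma sqi_imp_mod_iso: "sqi H M {0} (vecs (mdim M)) N {0} (vecs (mdim N)) \<Longrightarrow> mod_iso H M N"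
  unfolding mod_iso_def zero_fun_def[symmetric]
  by (rule sqi_imp_subquot_iso[OF submodule_vecs]) (auto simp: vecs_def)

text \<open>Induction on the codimension of \<open>U\<close>: a submodule of least dimension
  strictly above \<open>U\<close> inside \<open>Y\<close> gives an irreducible factor, which
  \<open>realize_subquotient\<close> turns into a matrix module and which is therefore one of the
  \<open>S i\<close>.\<close>

lemma filt_exists:
  fixes M :: "'f::field amod"
  assumes complete: "\<And>N. simple_mod H N \<Longrightarrow> \<exists>i\<le>l. mod_iso H N (S i)"
    and M: "is_module H M"
    and "submodule_of H M U" "submodule_of H M Y" "U \<subseteq> Y"
  shows "\<exists>x. filt H l S M U Y x"
  using assms(3-5)
proof (induction "mdim M - fvs.dim U" arbitrary: U rule: less_induct)
  case less
  show ?case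
  proof (cases "U = Y")
    case True
    then show ?thesis using filt.base[OF less.prems(1)] by blast
  next
    case False
    define P where "P = (\<lambda>W. submodule_of H M W \<and> U \<subset> W \<and> W \<subseteq> Y)"
    have "P Y" using less.prems False by (auto simp: P_def)
    then obtain W where W: "P W" "\<And>X. P X \<Longrightarrow> fvs.dim W \<le> fvs.dim X"
      using exists_least_iff[of "\<lambda>k. \<exists>X. P X \<and> fvs.dim X = k"] by (metis not_le)
    have Wsub: "submodule_of H M W" "U \<subset> W" "W \<subseteq> Y" using W(1) by (auto simp: P_def)
    have between: "X = U \<or> X = W" if X: "submodule_of H M X" "U \<subseteq> X" "X \<subseteq> W" for X
    proof (rule ccontr)
      assume "\<not> (X = U \<or> X = W)"
      then have "P X" "X \<subset> W" using X Wsub(3) by (auto simp: P_def)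
      then show False
        using W(2) dim_strict_mono[of X W] X(1) Wsub(1) unfolding submodule_of_iff by fastforce
    qed
    obtain N where N: "is_module H N" "sqi H M U W N {0} (vecs (mdim N))"
      using realize_subquotient[OF M less.prems(1) Wsub(1)] Wsub(2) by blast
    obtain R where R: "linrel H M N R" "Domain R = W" "Range R = vecs (mdim N)"
        "\<And>v w. (v, w) \<in> R \<Longrightarrow> v \<in> U \<longleftrightarrow> w \<in> {0}"
      using N(2) unfolding sqi_def relates_subquot_def by auto
    \<comment> \<open>Submodules of \<open>N\<close> correspond to submodules from \<open>U\<close>
      to \<open>W\<close>, of which \<open>between\<close> leaves only the two extremes.\<close>
    have "X = {0} \<or> X = vecs (mdim N)" if X: "submodule_of H N X" for X
    proof -
      have pre: "submodule_of H M (R\<inverse> `` X)"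
        by (rule linrel_image[OF linrel_converse[OF R(1)] X]) (use R(2) submodule_vecs_subset[OF Wsub(1)] in simp)
      have XR: "X = R `` (R\<inverse> `` X)"
      proof
        show "X \<subseteq> R `` (R\<inverse> `` X)" using R(3) submodule_vecs_subset[OF X] by blast
        show "R `` (R\<inverse> `` X) \<subseteq> X"
        proof
          fix w assume "w \<in> R `` (R\<inverse> `` X)"
          then obtain v w' where h: "(v, w) \<in> R" "(v, w') \<in> R" "w' \<in> X" by blast
          have "(0, w - w') \<in> R" using linrel_diff[OF R(1) h(1,2)] by simp
          then have "w - w' = 0" using R(4) submodule_zero_mem[OF less.prems(1)] by blast
          then show "w \<in> X" using h(3) by simp
        qed
      qed
      have "U \<subseteq> R\<inverse> `` X"
      proof
        fix u assume u: "u \<in> U"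
        then obtain w where "(u, w) \<in> R" using R(2) Wsub(2) by blast
        moreover from this have "w \<in> X" using R(4) u submodule_zero_mem[OF X] by blast
        ultimately show "u \<in> R\<inverse> `` X" by blast
      qed
      moreover have "R\<inverse> `` X \<subseteq> W" using R(2) by blast
      ultimately consider "R\<inverse> `` X = U" | "R\<inverse> `` X = W" using between[OF pre] by blast
      then show ?thesis
      proof cases
        case 1
        then have "X = R `` U" using XR by simp
        then have "X \<subseteq> {0}" using R(4) by blast
        then show ?thesis using submodule_zero_mem[OF X] by blast
      next
        case 2
        then have "X = R `` W" using XR by simp
        then show ?thesis using R(2,3) by blast
      qed
    qed
    moreover have "mdim N > 0"
    proof (rule ccontr)
      assume "\<not> mdim N > 0"
      then have "vecs (mdim N) \<subseteq> {0 :: nat \<Rightarrow> 'f}" by (auto simp: vecs_def fun_eq_iff)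
      then have "W \<subseteq> U" using R(2,3,4) by blast
      then show False using Wsub(2) by blast
    qed
    ultimately have "simple_mod H N" using N(1) unfolding simple_mod_iff irreducible_mod_def by blast
    then obtain i where i: "i \<le> l" "mod_iso H N (S i)" using complete by blast
    have "sqi H M U W (S i) {0} (vecs (mdim (S i)))"
      using sqi_trans[OF N(2) mod_iso_imp_sqi[OF i(2)]] .
    then have "\<exists>y. filt H l S M U W y"
      using filt.step[OF filt.base[OF less.prems(1)] Wsub(1) _ i(1)] Wsub(2) by blast
    moreover have "mdim M - fvs.dim W < mdim M - fvs.dim U"
      using dim_strict_mono[OF _ Wsub(2) submodule_vecs_subset[OF Wsub(1)]] less.prems(1)
      unfolding submodule_of_iff by fastforce
    then have "\<exists>z. filt H l S M W Y z" using less.hyps Wsub less.prems(2) by blast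
    ultimately show ?thesis using filt_append by blast
  qed
qed

text \<open>The dimension is the length over the ground field: with \<open>hdim\<close> set to 0 every subspace
  is a submodule, and uniqueness of multiplicities is the invariance of dimension.\<close>

lemma vecs_zero: "vecs 0 = {0}"
  by (auto simp: vecs_def fun_eq_iff)

lemma ground_simples: "simples (H\<lparr>hdim := 0\<rparr>) 0 (\<lambda>_. triv_mod H)"
proof (unfold_locales, goal_cases)
  case (1 i)
  show "irreducible_mod (H\<lparr>hdim := 0\<rparr>) (triv_mod H)"
    unfolding irreducible_mod_def
  proof (intro conjI allI impI)
    show "mdim (triv_mod H) > 0" by (simp add: triv_mod_def)
    fix U assume U: "submodule_of (H\<lparr>hdim := 0\<rparr>) (triv_mod H) U"
    show "U = {0} \<or> U = vecs (mdim (triv_mod H))"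
    proof (cases "U \<subseteq> {0}")
      case True
      then show ?thesis using submodule_zero_mem[OF U] by auto
    next
      case False
      then obtain u where u: "u \<in> U" "u \<noteq> 0" by auto
      have uv: "u \<in> vecs 1" using u(1) submodule_vecs_subset[OF U] by (auto simp: triv_mod_def)
      have "0 \<in> vecs 1" by (simp add: vecs_def)
      then have u0: "u 0 \<noteq> 0" using vecs_eqI[OF uv, of 0] u(2) by auto
      have "v \<in> U" if v: "v \<in> vecs 1" for v
      proof -
        have "scl (v 0 / u 0) u \<in> vecs 1" using uv by (auto simp: vecs_def)
        then have "v = scl (v 0 / u 0) u" using u0 by (intro vecs_eqI[OF v]) auto
        then show ?thesis using submodule_scl[OF U u(1)] by metis
      qed
      then show ?thesis using submodule_vecs_subset[OF U] by (auto simp: triv_mod_def)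
    qed
  qed
qed simp

text \<open>Serves two purposes: with \<open>hdim\<close> 0 the hypothesis on the action is vacuous
  and the flag measures dimension; for \<open>trivials\<close> it shows that all factors are
  trivial.\<close>

lemma trivial_flag:
  fixes M :: "'f::field amod"
  assumes act: "\<And>i p q. i < hdim H \<Longrightarrow> p < mdim M \<Longrightarrow> q < mdim M \<Longrightarrow> act M i p q = hcounit H i * kd p q"
    and S: "S l = triv_mod H" and "k \<le> mdim M"
  shows "filt H l S M (vecs 0) (vecs k) (\<lambda>i. if i = l then k else 0)"
  using assms(3)
proof (induction k)
  case 0
  have "(\<lambda>i::nat. if i = l then 0 else 0 :: nat) = (\<lambda>_. 0)" by auto
  moreover have "submodule_of H M (vecs 0)" unfolding vecs_zero by (rule submodule_0)
  ultimately show ?case using filt.base by metis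
next
  case (Suc k)
  have av: "actv M i v = scl (hcounit H i) v" if "v \<in> vecs (Suc k)" "i < hdim H" for i v
  proof (rule vecs_eqI[OF actv_vecs])
    have v: "v \<in> vecs (mdim M)" using that(1) Suc.prems by (auto simp: vecs_def)
    then show "scl (hcounit H i) v \<in> vecs (mdim M)" by (auto simp: vecs_def)
    fix p assume p: "p < mdim M"
    then have "actv M i v p = (\<Sum>q<mdim M. (hcounit H i * kd p q) * v q)"
      unfolding actv_def using act[OF that(2) p] by simp
    also have "\<dots> = (\<Sum>q<mdim M. if p = q then hcounit H i * v q else 0)"
      by (rule sum.cong) (auto simp: kd_def)
    finally show "actv M i v p = scl (hcounit H i) v p" using p by simp
  qed
  \<comment> \<open>The step from \<open>vecs k\<close> to \<open>vecs (Suc k)\<close> is read off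
    by the last coordinate \<open>v k\<close>.\<close>
  let ?R = "{(v, w) | (v :: nat \<Rightarrow> 'f) (w :: nat \<Rightarrow> 'f). v \<in> vecs (Suc k) \<and> w \<in> vecs 1 \<and> w 0 = v k}"
  have R_iff: "(v, w) \<in> ?R \<longleftrightarrow> v \<in> vecs (Suc k) \<and> w \<in> vecs 1 \<and> w 0 = v k" for v w by simp
  have "sqi H M (vecs k) (vecs (Suc k)) (triv_mod H) {0} (vecs 1)"
  proof (rule sqiI[of _ _ _ ?R])
    show "linrel H M (triv_mod H) ?R"
    proof (rule linrelI, goal_cases)
      case (4 i v w)
      then have h: "v \<in> vecs (Suc k)" "w \<in> vecs 1" "w 0 = v k" unfolding R_iff by auto
      have "actv (triv_mod H) i w \<in> vecs 1" using actv_vecs[of "triv_mod H"] by (simp add: triv_mod_def)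
      moreover have "actv (triv_mod H) i w 0 = hcounit H i * v k" using h(3) by (simp add: actv_def triv_mod_def)
      moreover have "scl (hcounit H i) v \<in> vecs (Suc k)" using h(1) by (simp add: vecs_def)
      ultimately show ?case unfolding R_iff av[OF h(1) 4(1)] by simp
    qed (auto simp: vecs_def)
    show "Domain ?R = vecs (Suc k)"
    proof (intro equalityI subsetI)
      fix v :: "nat \<Rightarrow> 'f" assume "v \<in> vecs (Suc k)"
      then have "(v, \<lambda>p. if p = 0 then v k else 0) \<in> ?R" unfolding R_iff by (simp add: vecs_def)
      then show "v \<in> Domain ?R" by (rule DomainI)
    qed auto
    show "Range ?R = vecs 1"
    proof (intro equalityI subsetI)
      fix w :: "nat \<Rightarrow> 'f" assume "w \<in> vecs 1"
      then have "(\<lambda>p. if p = k then w 0 else 0, w) \<in> ?R" unfolding R_iff by (simp add: vecs_def)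
      then show "w \<in> Range ?R" by (rule RangeI)
    qed auto
    show "v \<in> vecs k \<longleftrightarrow> w \<in> {0}" if "(v, w) \<in> ?R" for v w
    proof -
      have h: "v \<in> vecs (Suc k)" "w \<in> vecs 1" "w 0 = v k" using that unfolding R_iff by auto
      have "w = 0 \<longleftrightarrow> w 0 = 0" using h(2) vecs_eqI[of w 1 0] by (auto simp: vecs_def)
      moreover have "v \<in> vecs k \<longleftrightarrow> v k = 0"
        using h(1) by (auto simp: vecs_def) (metis Suc_leI le_neq_implies_less)
      ultimately show ?thesis using h(3) by simp
    qed
  qed
  then have s: "sqi H M (vecs k) (vecs (Suc k)) (S l) {0} (vecs (mdim (S l)))"
    by (simp add: S triv_mod_def)
  have sub: "submodule_of H M (vecs (Suc k))"
  proof (rule submodule_ofI)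
    show "vecs (Suc k) \<subseteq> vecs (mdim M)" using Suc.prems by (auto simp: vecs_def)
  qed (auto simp: av vecs_def)
  have "vecs k \<subseteq> vecs (Suc k)" by (auto simp: vecs_def)
  moreover have "filt H l S M (vecs 0) (vecs k) (\<lambda>i. if i = l then k else 0)"
    using Suc by simp
  ultimately have "filt H l S M (vecs 0) (vecs (Suc k)) ((\<lambda>i. if i = l then k else 0)(l := Suc k))"
    using filt.step[where S = S and l = l and i = l and Y = "vecs k" and M = M, OF _ sub _ order_refl s] by fastforce
  moreover have "(\<lambda>i::nat. if i = l then k else 0)(l := Suc k) = (\<lambda>i. if i = l then Suc k else 0)" by auto
  ultimately show ?case by simp
qed

lemma ground_flag:
  assumes "k \<le> mdim M"
  shows "filt (H\<lparr>hdim := 0\<rparr>) 0 (\<lambda>_. triv_mod H) M (vecs 0) (vecs k) (\<lambda>i. if i = 0 then k else 0)"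
  by (rule trivial_flag[OF _ _ assms]) (simp_all add: triv_mod_def)

lemma submodule_ground: "submodule_of H M U \<Longrightarrow> submodule_of (H\<lparr>hdim := 0\<rparr>) M U"
  by (simp add: submodule_of_iff)

lemma sqi_ground: "sqi H M U Y N P Q \<Longrightarrow> sqi (H\<lparr>hdim := 0\<rparr>) M U Y N P Q"
  unfolding sqi_def relates_subquot_def linrel_def by auto

text \<open>Each factor \<open>S i\<close> is refined by a full flag of length
  \<open>mdim (S i)\<close>, so a chain of submodules becomes a chain of one-dimensional
  steps.\<close>

lemma filt_ground:
  assumes "filt H l S M U Y x"
  shows "filt (H\<lparr>hdim := 0\<rparr>) 0 (\<lambda>_. triv_mod H) M U Y (\<lambda>j. if j = 0 then \<Sum>i\<le>l. x i * mdim (S i) else 0)"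
  using assms
proof (induction rule: filt.induct)
  case base
  have "(\<lambda>j::nat. if j = 0 then \<Sum>i\<le>l. 0 * mdim (S i) else 0) = (\<lambda>_. 0)" by auto
  then show ?case using filt.base[OF submodule_ground[OF base]] by metis
next
  case (step Y x Z i)
  have "filt (H\<lparr>hdim := 0\<rparr>) 0 (\<lambda>_. triv_mod H) M Y Z (\<lambda>j. if j = 0 then mdim (S i) else 0)"
    using filt_transport[OF ground_flag[OF order_refl] sqi_ground[OF step.hyps(5)[folded vecs_zero]]]
      submodule_ground filt_submodule[OF step.hyps(1)] step.hyps(2,3) submodule_vecs_subset by blast
  from filt_append[OF this step.IH]
  have "filt (H\<lparr>hdim := 0\<rparr>) 0 (\<lambda>_. triv_mod H) M U Z
      (\<lambda>j. (if j = 0 then \<Sum>i\<le>l. x i * mdim (S i) else 0) + (if j = 0 then mdim (S i) else 0))" .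
  moreover have "(\<Sum>k\<le>l. (x(i := Suc (x i))) k * mdim (S k)) = (\<Sum>k\<le>l. x k * mdim (S k)) + mdim (S i)"
    using step.hyps(4) by (simp add: sum.remove[of "{..l}" i])
  then have "(\<lambda>j::nat. (if j = 0 then \<Sum>i\<le>l. x i * mdim (S i) else 0) + (if j = 0 then mdim (S i) else 0))
    = (\<lambda>j. if j = 0 then \<Sum>k\<le>l. (x(i := Suc (x i))) k * mdim (S k) else 0)" by auto
  ultimately show ?case by simp
qed

text \<open>The refined chain and the coordinate flag have the same length by uniqueness over the
  ground field.\<close>

lemma filt_dim:
  assumes "filt H l S M {0} (vecs (mdim M)) x"
  shows "mdim M = (\<Sum>i\<le>l. x i * mdim (S i))"
proof -
  interpret g: simples "H\<lparr>hdim := 0\<rparr>" 0 "\<lambda>_. triv_mod H" by (rule ground_simples)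
  have "(\<lambda>j. if j = 0 then \<Sum>i\<le>l. x i * mdim (S i) else 0) = (\<lambda>j::nat. if j = 0 then mdim M else 0)"
    using g.filt_unique[OF filt_ground[OF assms] ground_flag[OF order_refl, where M = M and H = H, unfolded vecs_zero]] .
  from fun_cong[OF this, of 0] show ?thesis by simp
qed

section \<open>Tensor products and the regular module\<close>

text \<open>A functor \<open>T\<close> such as \<open>M \<mapsto> M \<otimes> V\<close> or \<open>M \<mapsto> V \<otimes> M\<close>: a vector of \<open>T M\<close> is a family of
  \<open>n\<close> slices in \<open>M\<close>, and the action on slices has coefficients not depending on \<open>M\<close>.\<close>

locale slicing =
  fixes H :: "'f::field hopf_data" and n :: nat and K :: "nat \<Rightarrow> nat \<Rightarrow> nat \<Rightarrow> nat \<Rightarrow> 'f"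
    and T :: "'f amod \<Rightarrow> 'f amod" and slc :: "'f amod \<Rightarrow> nat \<Rightarrow> (nat \<Rightarrow> 'f) \<Rightarrow> (nat \<Rightarrow> 'f)"
  assumes slc_vecs: "\<And>M b x. slc M b x \<in> vecs (mdim M)"
    and slc_add: "\<And>M b x y. slc M b (x + y) = slc M b x + slc M b y"
    and slc_scl: "\<And>M b a x. slc M b (scl a x) = scl a (slc M b x)"
    and slc_inj: "\<And>M x. x \<in> vecs (mdim (T M)) \<Longrightarrow> (\<And>b. b < n \<Longrightarrow> slc M b x = 0) \<Longrightarrow> x = 0"
    and slc_surj: "\<And>M f. (\<And>b. b < n \<Longrightarrow> f b \<in> vecs (mdim M)) \<Longrightarrow>
        \<exists>x\<in>vecs (mdim (T M)). \<forall>b<n. slc M b x = f b"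
    and slc_act: "\<And>M i b x. i < hdim H \<Longrightarrow> b < n \<Longrightarrow> x \<in> vecs (mdim (T M)) \<Longrightarrow>
        slc M b (actv (T M) i x) = (\<Sum>j<hdim H. \<Sum>b'<n. scl (K i j b b') (actv M j (slc M b' x)))"
begin

lemma slc_zero: "slc M b 0 = 0"
  using slc_scl[of M b 0 0] by simp

text \<open>The submodule that the functor assigns to \<open>U\<close>, for instance U \<otimes> V
  inside M \<otimes> V.\<close>

definition lift :: "'f amod \<Rightarrow> (nat \<Rightarrow> 'f) set \<Rightarrow> (nat \<Rightarrow> 'f) set" where
  "lift M U = {x \<in> vecs (mdim (T M)). \<forall>b<n. slc M b x \<in> U}"

lemma lift_iff: "x \<in> lift M U \<longleftrightarrow> x \<in> vecs (mdim (T M)) \<and> (\<forall>b<n. slc M b x \<in> U)"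
  by (simp add: lift_def)

lemma lift_mono: "U \<subseteq> W \<Longrightarrow> lift M U \<subseteq> lift M W"
  unfolding lift_def by auto

lemma lift_0: "lift M {0} = {0}"
proof (intro equalityI subsetI)
  fix x assume "x \<in> lift M {0}"
  then show "x \<in> {0}" using slc_inj[of x M] unfolding lift_iff by simp
qed (auto simp: lift_iff slc_zero vecs_def)

lemma lift_vecs: "lift M (vecs (mdim M)) = vecs (mdim (T M))"
  by (auto simp: lift_def slc_vecs)

lemma lift_submodule:
  assumes U: "submodule_of H M U"
  shows "submodule_of H (T M) (lift M U)"
proof (rule submodule_ofI)
  show "lift M U \<subseteq> vecs (mdim (T M))" by (auto simp: lift_def)
  show "0 \<in> lift M U" using submodule_zero_mem[OF U] by (simp add: lift_iff slc_zero vecs_def)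
  show "x + y \<in> lift M U" if "x \<in> lift M U" "y \<in> lift M U" for x y
    using that unfolding lift_iff slc_add by (simp add: submodule_add[OF U] fvs.subspace_add[OF vecs_subspace])
  show "scl a x \<in> lift M U" if "x \<in> lift M U" for a x
    using that unfolding lift_iff slc_scl by (simp add: submodule_scl[OF U] fvs.subspace_scale[OF vecs_subspace])
  show "actv (T M) i x \<in> lift M U" if i: "i < hdim H" and x: "x \<in> lift M U" for i x
  proof -
    have Us: "fvs.subspace U" using U by (simp add: submodule_of_iff)
    have "slc M b (actv (T M) i x) \<in> U" if "b < n" for b
      using x i that submodule_act[OF U] unfolding lift_iff
      by (subst slc_act) (auto intro!: fvs.subspace_sum[OF Us] fvs.subspace_scale[OF Us])
    then show ?thesis unfolding lift_iff by simp
  qed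
qed

text \<open>Exactness of the functor: an isomorphism of subquotients is applied to every slice. By
  \<open>slc_surj\<close> the slices of a partner vector can be chosen independently.\<close>

lemma lift_sqi:
  assumes s: "sqi H M U Y N P Q" and Y: "Y \<subseteq> vecs (mdim M)" and Q: "Q \<subseteq> vecs (mdim N)"
  shows "sqi H (T M) (lift M U) (lift M Y) (T N) (lift N P) (lift N Q)"
proof -
  obtain R where R: "linrel H M N R" "Domain R = Y" "Range R = Q" "\<And>v w. (v, w) \<in> R \<Longrightarrow> v \<in> U \<longleftrightarrow> w \<in> P"
    using s unfolding sqi_def relates_subquot_def by auto
  define R' where "R' = {(x, y). x \<in> vecs (mdim (T M)) \<and> y \<in> vecs (mdim (T N)) \<and> (\<forall>b<n. (slc M b x, slc N b y) \<in> R)}"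
  have R'_iff: "(x, y) \<in> R' \<longleftrightarrow> x \<in> vecs (mdim (T M)) \<and> y \<in> vecs (mdim (T N)) \<and> (\<forall>b<n. (slc M b x, slc N b y) \<in> R)" for x y
    by (simp add: R'_def)
  show ?thesis
  proof (rule sqiI[of _ _ _ R'])
    show "linrel H (T M) (T N) R'"
    proof (rule linrelI)
      show "(0, 0) \<in> R'" unfolding R'_iff slc_zero using linrel_zero[OF R(1)] by (simp add: vecs_def)
      show "(v + v', w + w') \<in> R'" if "(v, w) \<in> R'" "(v', w') \<in> R'" for v w v' w'
        using that unfolding R'_iff slc_add by (simp add: linrel_add[OF R(1)] fvs.subspace_add[OF vecs_subspace])
      show "(scl a v, scl a w) \<in> R'" if "(v, w) \<in> R'" for a v w
        using that unfolding R'_iff slc_scl by (simp add: linrel_scl[OF R(1)] fvs.subspace_scale[OF vecs_subspace])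
      show "(actv (T M) i v, actv (T N) i w) \<in> R'" if i: "i < hdim H" and vw: "(v, w) \<in> R'" for i v w
      proof -
        have "(slc M b (actv (T M) i v), slc N b (actv (T N) i w)) \<in> R" if b: "b < n" for b
          using vw unfolding R'_iff
          by (auto simp: slc_act[OF i b] intro!: linrel_sum[OF R(1)] linrel_scl[OF R(1)] linrel_act[OF R(1)])
        then show ?thesis unfolding R'_iff by simp
      qed
    qed
    show "Domain R' = lift M Y"
    proof (intro equalityI subsetI)
      fix x assume "x \<in> Domain R'"
      then obtain y where "(x, y) \<in> R'" by (rule DomainE)
      then show "x \<in> lift M Y" unfolding R'_iff lift_iff R(2)[symmetric] by (auto intro: DomainI)
    next
      fix x assume x: "x \<in> lift M Y"
      then have "\<forall>b\<in>{..<n}. \<exists>w. (slc M b x, w) \<in> R" unfolding lift_iff R(2)[symmetric] by auto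
      then obtain f where f: "\<And>b. b < n \<Longrightarrow> (slc M b x, f b) \<in> R"
        using bchoice[of "{..<n}" "\<lambda>b w. (slc M b x, w) \<in> R"] by auto
      have "f b \<in> vecs (mdim N)" if "b < n" for b using f[OF that] R(3) Q by auto
      then obtain y where "y \<in> vecs (mdim (T N))" "\<forall>b<n. slc N b y = f b" using slc_surj[of f N] by auto
      then have "(x, y) \<in> R'" using f x unfolding R'_iff lift_iff by simp
      then show "x \<in> Domain R'" by (rule DomainI)
    qed
    show "Range R' = lift N Q"
    proof (intro equalityI subsetI)
      fix y assume "y \<in> Range R'"
      then obtain x where "(x, y) \<in> R'" by (rule RangeE)
      then show "y \<in> lift N Q" unfolding R'_iff lift_iff R(3)[symmetric] by (auto intro: RangeI)
    next
      fix y assume y: "y \<in> lift N Q"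
      then have "\<forall>b\<in>{..<n}. \<exists>v. (v, slc N b y) \<in> R" unfolding lift_iff R(3)[symmetric] by auto
      then obtain f where f: "\<And>b. b < n \<Longrightarrow> (f b, slc N b y) \<in> R"
        using bchoice[of "{..<n}" "\<lambda>b v. (v, slc N b y) \<in> R"] by auto
      have "f b \<in> vecs (mdim M)" if "b < n" for b using f[OF that] R(2) Y by auto
      then obtain x where "x \<in> vecs (mdim (T M))" "\<forall>b<n. slc M b x = f b" using slc_surj[of f M] by auto
      then have "(x, y) \<in> R'" using f y unfolding R'_iff lift_iff by simp
      then show "y \<in> Range R'" by (rule RangeI)
    qed
    show "v \<in> lift M U \<longleftrightarrow> w \<in> lift N P" if "(v, w) \<in> R'" for v w
      using that R(4) unfolding R'_iff lift_iff by blast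
  qed
qed

text \<open>The functor turns a chain of \<open>M\<close> into one with steps
  \<open>T (S i)\<close>, each of which is refined further by its own chain with counts
  \<open>t i\<close>.\<close>

lemma lift_filt:
  assumes "filt H l S M U Y x"
    and t: "\<And>i. i \<le> l \<Longrightarrow> filt H l S (T (S i)) {0} (vecs (mdim (T (S i)))) (t i)"
  shows "filt H l S (T M) (lift M U) (lift M Y) (\<lambda>k. \<Sum>i\<le>l. x i * t i k)"
  using assms(1)
proof (induction rule: filt.induct)
  case base
  then show ?case using filt.base[OF lift_submodule[OF base], of l S] by simp
next
  case (step Y x Z i)
  have Y: "submodule_of H M Y" using filt_submodule[OF step.hyps(1)] by simp
  have "sqi H (T M) (lift M Y) (lift M Z) (T (S i)) (lift (S i) {0}) (lift (S i) (vecs (mdim (S i))))"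
    using step.hyps(5) by (rule lift_sqi[OF _ submodule_vecs_subset[OF step.hyps(2)] order_refl])
  then have "sqi H (T M) (lift M Y) (lift M Z) (T (S i)) {0} (vecs (mdim (T (S i))))"
    by (simp only: lift_0 lift_vecs)
  then have "filt H l S (T M) (lift M Y) (lift M Z) (t i)"
    using filt_transport[OF t[OF step.hyps(4)]] lift_submodule[OF Y] lift_mono[OF step.hyps(3)]
      submodule_vecs_subset[OF lift_submodule[OF step.hyps(2)]] by blast
  from filt_append[OF this step.IH]
  have "filt H l S (T M) (lift M U) (lift M Z) (\<lambda>k. (\<Sum>i\<le>l. x i * t i k) + t i k)" .
  moreover have "(\<Sum>j\<le>l. (x(i := Suc (x i))) j * t j k) = (\<Sum>j\<le>l. x j * t j k) + t i k" for k
    using step.hyps(4) by (simp add: sum.remove[of "{..l}" i])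
  ultimately show ?case by simp
qed

lemma lift_filt_all:
  assumes "filt H l S M {0} (vecs (mdim M)) x"
    and "\<And>i. i \<le> l \<Longrightarrow> filt H l S (T (S i)) {0} (vecs (mdim (T (S i)))) (t i)"
  shows "filt H l S (T M) {0} (vecs (mdim (T M))) (\<lambda>k. \<Sum>i\<le>l. x i * t i k)"
  using lift_filt[OF assms] by (simp only: lift_0 lift_vecs)

end

lemma sum_div_mod:
  "(\<Sum>r<m*n. f r) = (\<Sum>q<m. \<Sum>b<n. f (q * n + b))" for f :: "nat \<Rightarrow> 'a::comm_monoid_add"
proof -
  have "(\<Sum>r<m*n. f r) = (\<Sum>q<m. sum f {q*n..<q*n+n})" by (rule sum.nat_group[symmetric])
  also have "\<dots> = (\<Sum>q<m. \<Sum>b<n. f (q * n + b))"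
  proof (rule sum.cong[OF refl])
    fix q
    show "sum f {q*n..<q*n+n} = (\<Sum>b<n. f (q * n + b))"
      by (rule sum.reindex_bij_witness[of _ "\<lambda>b. q * n + b" "\<lambda>r. r - q * n"]) auto
  qed
  finally show ?thesis .
qed

lemma pair_index_less: "p < m \<Longrightarrow> b < n \<Longrightarrow> p * n + b < m * n" for p b m n :: nat
proof -
  assume "p < m" "b < n"
  then have "p * n + b < (p + 1) * n" by simp
  also have "\<dots> \<le> m * n" using \<open>p < m\<close> by (intro mult_right_mono) auto
  finally show ?thesis .
qed

lemma actv_tensor:
  assumes "p < mdim M" "b < mdim V"
  shows "actv (tensor_mod H M V) i x (p * mdim V + b) =
    (\<Sum>q<mdim M. \<Sum>b'<mdim V. \<Sum>j<hdim H. \<Sum>k<hdim H. hcomult H i j k * act M j p q * act V k b b' * x (q * mdim V + b'))"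
proof -
  have "actv (tensor_mod H M V) i x (p * mdim V + b)
      = (\<Sum>r<mdim M * mdim V. act (tensor_mod H M V) i (p * mdim V + b) r * x r)"
    using pair_index_less[OF assms] by (simp add: actv_def tensor_mod_def)
  also have "\<dots> = (\<Sum>q<mdim M. \<Sum>b'<mdim V. act (tensor_mod H M V) i (p * mdim V + b) (q * mdim V + b') * x (q * mdim V + b'))"
    by (rule sum_div_mod)
  also have "\<dots> = (\<Sum>q<mdim M. \<Sum>b'<mdim V. \<Sum>j<hdim H. \<Sum>k<hdim H. hcomult H i j k * act M j p q * act V k b b' * x (q * mdim V + b'))"
    using assms by (intro sum.cong refl) (simp add: tensor_mod_def sum_distrib_right)
  finally show ?thesis .
qed

lemma vecs_pair_eq_0:
  assumes "x \<in> vecs (m * n)" "\<And>p b. p < m \<Longrightarrow> b < n \<Longrightarrow> x (p * n + b) = 0"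
  shows "x = (0 :: nat \<Rightarrow> 'f::field)"
proof (rule vecs_eqI[OF assms(1)])
  show "0 \<in> vecs (m * n)" by (simp add: vecs_def)
  fix r assume r: "r < m * n"
  then have "n > 0" by (cases n) auto
  then have "r div n < m" "r mod n < n" using r by (auto simp: less_mult_imp_div_less)
  then have "x (r div n * n + r mod n) = 0" by (rule assms(2))
  then show "x r = 0 r" by simp
qed

text \<open>Slice \<open>b\<close> of a vector of M \<otimes> V is its coefficient at the b-th basis
  vector of \<open>V\<close>; slices are mixed only through the action on \<open>V\<close>, whatever
  M is.\<close>

lemma slicing_tensor_left:
  "slicing H (mdim V) (\<lambda>i j b b'. \<Sum>k<hdim H. hcomult H i j k * act V k b b') (\<lambda>M. tensor_mod H M V)
     (\<lambda>M b x p. if p < mdim M \<and> b < mdim V then x (p * mdim V + b) else 0)"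
proof (unfold_locales, goal_cases)
  case (4 M x)
  show ?case
  proof (rule vecs_pair_eq_0)
    show "x \<in> vecs (mdim M * mdim V)" using 4(1) by (simp add: tensor_mod_def)
    fix p b assume "p < mdim M" "b < mdim V"
    then show "x (p * mdim V + b) = 0" using fun_cong[OF 4(2)[of b], of p] by simp
  qed
next
  case (5 M f)
  let ?n = "mdim V"
  let ?x = "\<lambda>r. if r < mdim M * ?n then f (r mod ?n) (r div ?n) else 0"
  have "(if p < mdim M \<and> b < ?n then ?x (p * ?n + b) else 0) = f b p" if b: "b < ?n" for b p
    using pair_index_less[of p "mdim M" b ?n] b 5[OF b] by (auto simp: vecs_def)
  moreover have "?x \<in> vecs (mdim (tensor_mod H M V))" by (simp add: vecs_def tensor_mod_def)
  ultimately show ?case by (intro bexI[of _ ?x]) auto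
next
  case (6 M i b x)
  let ?n = "mdim V"
  show ?case
  proof
    fix p
    show "(if p < mdim M \<and> b < ?n then actv (tensor_mod H M V) i x (p * ?n + b) else 0) =
      (\<Sum>j<hdim H. \<Sum>b'<?n. scl (\<Sum>k<hdim H. hcomult H i j k * act V k b b')
        (actv M j (\<lambda>p. if p < mdim M \<and> b' < ?n then x (p * ?n + b') else 0))) p"
    proof (cases "p < mdim M")
      case True
      have "(\<Sum>q<mdim M. \<Sum>b'<?n. \<Sum>j<hdim H. \<Sum>k<hdim H. hcomult H i j k * act M j p q * act V k b b' * x (q * ?n + b'))
        = (\<Sum>b'<?n. \<Sum>q<mdim M. \<Sum>j<hdim H. \<Sum>k<hdim H. hcomult H i j k * act M j p q * act V k b b' * x (q * ?n + b'))"
        by (rule sum.swap)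
      also have "\<dots> = (\<Sum>b'<?n. \<Sum>j<hdim H. \<Sum>q<mdim M. \<Sum>k<hdim H. hcomult H i j k * act M j p q * act V k b b' * x (q * ?n + b'))"
        by (rule sum.cong[OF refl], rule sum.swap)
      also have "\<dots> = (\<Sum>j<hdim H. \<Sum>b'<?n. \<Sum>q<mdim M. \<Sum>k<hdim H. hcomult H i j k * act M j p q * act V k b b' * x (q * ?n + b'))"
        by (rule sum.swap)
      also have "\<dots> = (\<Sum>j<hdim H. \<Sum>b'<?n. (\<Sum>q<mdim M. act M j p q * x (q * ?n + b')) *
          (\<Sum>k<hdim H. hcomult H i j k * act V k b b'))"
        unfolding sum_product by (intro sum.cong refl) (simp add: mult_ac)
      finally show ?thesis using True 6(2) by (simp add: actv_tensor fun_sum_apply actv_def[of M] mult.commute[of "sum _ {..<mdim M}"])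
    next
      case False
      then show ?thesis by (simp add: fun_sum_apply actv_def)
    qed
  qed
qed (auto simp: vecs_def)

text \<open>Here the varying module is the second factor, so slices are blocks of consecutive
  entries and the last two indices of \<open>hcomult\<close> change roles.\<close>

lemma slicing_tensor_right:
  "slicing H (mdim V) (\<lambda>i j b b'. \<Sum>k<hdim H. hcomult H i k j * act V k b b') (\<lambda>M. tensor_mod H V M)
     (\<lambda>M b x p. if p < mdim M \<and> b < mdim V then x (b * mdim M + p) else 0)"
proof (unfold_locales, goal_cases)
  case (4 M x)
  show ?case
  proof (rule vecs_pair_eq_0)
    show "x \<in> vecs (mdim V * mdim M)" using 4(1) by (simp add: tensor_mod_def)
    fix b p assume "b < mdim V" "p < mdim M"
    then show "x (b * mdim M + p) = 0" using fun_cong[OF 4(2)[of b], of p] by simp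
  qed
next
  case (5 M f)
  let ?n = "mdim V"
  let ?x = "\<lambda>r. if r < ?n * mdim M then f (r div mdim M) (r mod mdim M) else 0"
  have "(if p < mdim M \<and> b < ?n then ?x (b * mdim M + p) else 0) = f b p" if b: "b < ?n" for b p
    using pair_index_less[of b ?n p "mdim M"] b 5[OF b] by (auto simp: vecs_def)
  moreover have "?x \<in> vecs (mdim (tensor_mod H V M))" by (simp add: vecs_def tensor_mod_def)
  ultimately show ?case by (intro bexI[of _ ?x]) auto
next
  case (6 M i b x)
  let ?n = "mdim V"
  show ?case
  proof
    fix p
    show "(if p < mdim M \<and> b < ?n then actv (tensor_mod H V M) i x (b * mdim M + p) else 0) =
      (\<Sum>j<hdim H. \<Sum>b'<?n. scl (\<Sum>k<hdim H. hcomult H i k j * act V k b b')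
        (actv M j (\<lambda>p. if p < mdim M \<and> b' < ?n then x (b' * mdim M + p) else 0))) p"
    proof (cases "p < mdim M")
      case True
      have "(\<Sum>b'<?n. \<Sum>q<mdim M. \<Sum>k<hdim H. \<Sum>j<hdim H. hcomult H i k j * act V k b b' * act M j p q * x (b' * mdim M + q))
        = (\<Sum>b'<?n. \<Sum>j<hdim H. (\<Sum>q<mdim M. act M j p q * x (b' * mdim M + q)) *
          (\<Sum>k<hdim H. hcomult H i k j * act V k b b'))"
      proof (rule sum.cong[OF refl])
        fix b'
        have "(\<Sum>q<mdim M. \<Sum>k<hdim H. \<Sum>j<hdim H. hcomult H i k j * act V k b b' * act M j p q * x (b' * mdim M + q))
          = (\<Sum>q<mdim M. \<Sum>j<hdim H. \<Sum>k<hdim H. hcomult H i k j * act V k b b' * act M j p q * x (b' * mdim M + q))"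
          by (rule sum.cong[OF refl], rule sum.swap)
        also have "\<dots> = (\<Sum>j<hdim H. \<Sum>q<mdim M. \<Sum>k<hdim H. hcomult H i k j * act V k b b' * act M j p q * x (b' * mdim M + q))"
          by (rule sum.swap)
        also have "\<dots> = (\<Sum>j<hdim H. (\<Sum>q<mdim M. act M j p q * x (b' * mdim M + q)) *
          (\<Sum>k<hdim H. hcomult H i k j * act V k b b'))"
          unfolding sum_product
          by (intro sum.cong refl) (simp add: mult_ac)
        finally show "(\<Sum>q<mdim M. \<Sum>k<hdim H. \<Sum>j<hdim H. hcomult H i k j * act V k b b' * act M j p q * x (b' * mdim M + q))
          = (\<Sum>j<hdim H. (\<Sum>q<mdim M. act M j p q * x (b' * mdim M + q)) *
          (\<Sum>k<hdim H. hcomult H i k j * act V k b b'))" .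
      qed
      also have "\<dots> = (\<Sum>j<hdim H. \<Sum>b'<?n. (\<Sum>q<mdim M. act M j p q * x (b' * mdim M + q)) *
          (\<Sum>k<hdim H. hcomult H i k j * act V k b b'))"
        by (rule sum.swap)
      finally show ?thesis using True 6(2) by (simp add: actv_tensor fun_sum_apply actv_def[of M] mult.commute[of "sum _ {..<mdim M}"])
    next
      case False
      then show ?thesis by (simp add: fun_sum_apply actv_def)
    qed
  qed
qed (auto simp: vecs_def)

lemmas filt_tensor_left = slicing.lift_filt_all[OF slicing_tensor_left]
lemmas filt_tensor_right = slicing.lift_filt_all[OF slicing_tensor_right]


section \<open>The Hopf axioms in coordinates; tensor and regular modules\<close>

lemma sum_rotate3: "(\<Sum>a\<in>A. \<Sum>b\<in>B. \<Sum>c\<in>C. f a b c) = (\<Sum>b\<in>B. \<Sum>c\<in>C. \<Sum>a\<in>A. f a b c)"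
  for f :: "_ \<Rightarrow> _ \<Rightarrow> _ \<Rightarrow> 'a::comm_monoid_add"
  by (rule trans[OF sum.swap], rule sum.cong[OF refl], rule sum.swap)

lemma sum_rotate4: "(\<Sum>a\<in>A. \<Sum>b\<in>B. \<Sum>c\<in>C. \<Sum>d\<in>D. f a b c d) = (\<Sum>b\<in>B. \<Sum>c\<in>C. \<Sum>d\<in>D. \<Sum>a\<in>A. f a b c d)"
  for f :: "_ \<Rightarrow> _ \<Rightarrow> _ \<Rightarrow> _ \<Rightarrow> 'a::comm_monoid_add"
  by (rule trans[OF sum.swap], rule sum.cong[OF refl], rule sum_rotate3)

lemma sum_rotate5: "(\<Sum>a\<in>A. \<Sum>b\<in>B. \<Sum>c\<in>C. \<Sum>d\<in>D. \<Sum>e\<in>E. f a b c d e) = (\<Sum>b\<in>B. \<Sum>c\<in>C. \<Sum>d\<in>D. \<Sum>e\<in>E. \<Sum>a\<in>A. f a b c d e)"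
  for f :: "_ \<Rightarrow> _ \<Rightarrow> _ \<Rightarrow> _ \<Rightarrow> _ \<Rightarrow> 'a::comm_monoid_add"
  by (rule trans[OF sum.swap], rule sum.cong[OF refl], rule sum_rotate4)

lemma
  assumes H: "hopf H"
  shows hopf_assoc: "i < hdim H \<Longrightarrow> j < hdim H \<Longrightarrow> l < hdim H \<Longrightarrow> p < hdim H \<Longrightarrow>
        (\<Sum>k<hdim H. hmult H i j k * hmult H k l p) = (\<Sum>k<hdim H. hmult H j l k * hmult H i k p)"
    and hopf_unit_left: "j < hdim H \<Longrightarrow> p < hdim H \<Longrightarrow> (\<Sum>k<hdim H. hunit H k * hmult H k j p) = kd j p"
    and hopf_coassoc: "i < hdim H \<Longrightarrow> a < hdim H \<Longrightarrow> b < hdim H \<Longrightarrow> q < hdim H \<Longrightarrow>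
        (\<Sum>j<hdim H. hcomult H i j q * hcomult H j a b) = (\<Sum>k<hdim H. hcomult H i a k * hcomult H k b q)"
    and hopf_counit_right: "i < hdim H \<Longrightarrow> k < hdim H \<Longrightarrow> (\<Sum>j<hdim H. hcomult H i k j * hcounit H j) = kd i k"
    and hopf_comult_mult: "i < hdim H \<Longrightarrow> j < hdim H \<Longrightarrow> p < hdim H \<Longrightarrow> q < hdim H \<Longrightarrow>
        (\<Sum>k<hdim H. hmult H i j k * hcomult H k p q) =
        (\<Sum>a<hdim H. \<Sum>b<hdim H. \<Sum>a'<hdim H. \<Sum>b'<hdim H.
          hcomult H i a b * hcomult H j a' b' * hmult H a a' p * hmult H b b' q)"
    and hopf_comult_unit: "p < hdim H \<Longrightarrow> q < hdim H \<Longrightarrow>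
        (\<Sum>k<hdim H. hunit H k * hcomult H k p q) = hunit H p * hunit H q"
    and hopf_counit_mult: "i < hdim H \<Longrightarrow> j < hdim H \<Longrightarrow>
        (\<Sum>k<hdim H. hmult H i j k * hcounit H k) = hcounit H i * hcounit H j"
    and hopf_counit_unit: "(\<Sum>k<hdim H. hunit H k * hcounit H k) = 1"
    and hopf_antipode_right: "i < hdim H \<Longrightarrow> p < hdim H \<Longrightarrow>
        (\<Sum>j<hdim H. \<Sum>k<hdim H. \<Sum>a<hdim H. hcomult H i j k * hantipode H k a * hmult H j a p)
          = hcounit H i * hunit H p"
  using H unfolding hopf_def Let_def by (elim conjE, simp)+

lemma module_assoc:
  assumes "is_module H M" "i < hdim H" "j < hdim H" "p < mdim M" "q < mdim M"
  shows "(\<Sum>t<mdim M. act M i p t * act M j t q) = (\<Sum>k<hdim H. hmult H i j k * act M k p q)"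
  using conjunct1[OF assms(1)[unfolded is_module_def Let_def], rule_format, OF assms(2-5)] .

lemma module_unit:
  assumes "is_module H M" "p < mdim M" "q < mdim M"
  shows "(\<Sum>k<hdim H. hunit H k * act M k p q) = kd p q"
  using conjunct2[OF assms(1)[unfolded is_module_def Let_def], rule_format, OF assms(2,3)] .

lemma kd_div_mod: "kd p q = kd (p div n) (q div n) * kd (p mod n) (q mod n :: nat)"
proof -
  have "p = q \<longleftrightarrow> p div n = q div n \<and> p mod n = q mod n" by (metis div_mult_mod_eq)
  then show ?thesis by (auto simp: kd_def)
qed

lemma is_module_triv: "hopf H \<Longrightarrow> is_module H (triv_mod H)"
  by (simp add: is_module_def triv_mod_def hopf_counit_mult hopf_counit_unit kd_def)

text \<open>Column \<open>q\<close> of the matrix of \<open>e_i\<close> is the product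
  \<open>e_i e_q\<close>, hence the exchanged indices of \<open>hmult\<close>.\<close>

definition regular_mod :: "'f::field hopf_data \<Rightarrow> 'f amod" where
  "regular_mod H = \<lparr>mdim = hdim H, act = (\<lambda>i p q. hmult H i q p)\<rparr>"

lemma is_module_regular:
  assumes H: "hopf H"
  shows "is_module H (regular_mod H)"
proof -
  have "(\<Sum>t<hdim H. hmult H i t p * hmult H j q t) = (\<Sum>k<hdim H. hmult H i j k * hmult H k q p)"
    if "i < hdim H" "j < hdim H" "p < hdim H" "q < hdim H" for i j p q
    unfolding hopf_assoc[OF H that(1,2,4,3)] by (rule sum.cong[OF refl], rule mult.commute)
  moreover have "(\<Sum>k<hdim H. hunit H k * hmult H k q p) = kd p q" if "p < hdim H" "q < hdim H" for p q
    unfolding hopf_unit_left[OF H that(2,1)] by (simp add: kd_def)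
  ultimately show ?thesis unfolding is_module_def Let_def regular_mod_def by simp
qed

text \<open>Stands for V stripped of its action: tensoring the regular module with it gives A
  \<otimes> V with A acting on the first factor only.\<close>

definition trivials :: "'f::field hopf_data \<Rightarrow> nat \<Rightarrow> 'f amod" where
  "trivials H n = \<lparr>mdim = n, act = (\<lambda>i p q. hcounit H i * kd p q)\<rparr>"

text \<open>A product of two tensor actions contracts in each factor separately by the module law,
  and multiplicativity of the comultiplication reassembles the result.\<close>

lemma is_module_tensor:
  assumes H: "hopf H" and M: "is_module H M" and V: "is_module H V"
  shows "is_module H (tensor_mod H M V)"
proof -
  let ?d = "hdim H" and ?m = "mdim M" and ?n = "mdim V"
  let ?c = "hcomult H" and ?\<mu> = "hmult H"
  have rng: "p div ?n < ?m" "p mod ?n < ?n" if "p < ?m * ?n" for p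
    using that by (cases ?n, auto simp: less_mult_imp_div_less)+
  have ten: "act (tensor_mod H M V) i p q = (\<Sum>a<?d. \<Sum>b<?d. ?c i a b *
      act M a (p div ?n) (q div ?n) * act V b (p mod ?n) (q mod ?n))" for i p q
    by (simp add: tensor_mod_def)
  have "(\<Sum>t<?m*?n. act (tensor_mod H M V) i p t * act (tensor_mod H M V) j t q)
      = (\<Sum>k<?d. ?\<mu> i j k * act (tensor_mod H M V) k p q)"
    if i: "i < ?d" and j: "j < ?d" and p: "p < ?m*?n" and q: "q < ?m*?n" for i j p q
  proof -
    define p1 p2 q1 q2 where pq: "p1 = p div ?n" "p2 = p mod ?n" "q1 = q div ?n" "q2 = q mod ?n"
    have b: "p1 < ?m" "p2 < ?n" "q1 < ?m" "q2 < ?n" using rng p q pq by auto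
    have "(\<Sum>t<?m*?n. act (tensor_mod H M V) i p t * act (tensor_mod H M V) j t q)
      = (\<Sum>t1<?m. \<Sum>t2<?n. (\<Sum>a<?d. \<Sum>b<?d. ?c i a b * act M a p1 t1 * act V b p2 t2) *
          (\<Sum>a'<?d. \<Sum>b'<?d. ?c j a' b' * act M a' t1 q1 * act V b' t2 q2))"
      unfolding sum_div_mod by (intro sum.cong refl) (simp add: ten pq)
    also have "\<dots> = (\<Sum>t1<?m. \<Sum>t2<?n. \<Sum>a<?d. \<Sum>b<?d. \<Sum>a'<?d. \<Sum>b'<?d.
        (?c i a b * act M a p1 t1 * act V b p2 t2) * (?c j a' b' * act M a' t1 q1 * act V b' t2 q2))"
      unfolding sum_distrib_right unfolding sum_distrib_left by (rule refl)
    also have "\<dots> = (\<Sum>t1<?m. \<Sum>a<?d. \<Sum>b<?d. \<Sum>a'<?d. \<Sum>b'<?d. \<Sum>t2<?n.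
        (?c i a b * act M a p1 t1 * act V b p2 t2) * (?c j a' b' * act M a' t1 q1 * act V b' t2 q2))"
      by (rule sum.cong[OF refl], rule sum_rotate5)
    also have "\<dots> = (\<Sum>a<?d. \<Sum>b<?d. \<Sum>a'<?d. \<Sum>b'<?d. \<Sum>t1<?m. \<Sum>t2<?n.
        (?c i a b * act M a p1 t1 * act V b p2 t2) * (?c j a' b' * act M a' t1 q1 * act V b' t2 q2))"
      by (rule sum_rotate5)
    also have "\<dots> = (\<Sum>a<?d. \<Sum>b<?d. \<Sum>a'<?d. \<Sum>b'<?d. ?c i a b * ?c j a' b' *
        ((\<Sum>t1<?m. act M a p1 t1 * act M a' t1 q1) * (\<Sum>t2<?n. act V b p2 t2 * act V b' t2 q2)))"
      unfolding sum_product unfolding sum_distrib_left by (intro sum.cong refl) (simp add: mult_ac)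
    also have "\<dots> = (\<Sum>a<?d. \<Sum>b<?d. \<Sum>a'<?d. \<Sum>b'<?d. ?c i a b * ?c j a' b' *
        ((\<Sum>k<?d. ?\<mu> a a' k * act M k p1 q1) * (\<Sum>k'<?d. ?\<mu> b b' k' * act V k' p2 q2)))"
      by (intro sum.cong refl) (simp add: module_assoc[OF M] module_assoc[OF V] b)
    also have "\<dots> = (\<Sum>a<?d. \<Sum>b<?d. \<Sum>a'<?d. \<Sum>b'<?d. \<Sum>k<?d. \<Sum>k'<?d.
        ?c i a b * ?c j a' b' * ?\<mu> a a' k * ?\<mu> b b' k' * (act M k p1 q1 * act V k' p2 q2))"
      unfolding sum_product unfolding sum_distrib_left by (intro sum.cong refl) (simp add: mult_ac)
    also have "\<dots> = (\<Sum>k<?d. \<Sum>a<?d. \<Sum>b<?d. \<Sum>a'<?d. \<Sum>b'<?d. \<Sum>k'<?d.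
        ?c i a b * ?c j a' b' * ?\<mu> a a' k * ?\<mu> b b' k' * (act M k p1 q1 * act V k' p2 q2))"
      by (rule sum_rotate5[symmetric])
    also have "\<dots> = (\<Sum>k<?d. \<Sum>k'<?d. \<Sum>a<?d. \<Sum>b<?d. \<Sum>a'<?d. \<Sum>b'<?d.
        ?c i a b * ?c j a' b' * ?\<mu> a a' k * ?\<mu> b b' k' * (act M k p1 q1 * act V k' p2 q2))"
      by (rule sum.cong[OF refl], rule sum_rotate5[symmetric])
    also have "\<dots> = (\<Sum>k<?d. \<Sum>k'<?d. (\<Sum>a<?d. \<Sum>b<?d. \<Sum>a'<?d. \<Sum>b'<?d.
        ?c i a b * ?c j a' b' * ?\<mu> a a' k * ?\<mu> b b' k') * (act M k p1 q1 * act V k' p2 q2))"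
      unfolding sum_distrib_right by (rule refl)
    also have "\<dots> = (\<Sum>k<?d. \<Sum>k'<?d. (\<Sum>r<?d. ?\<mu> i j r * ?c r k k') * (act M k p1 q1 * act V k' p2 q2))"
      by (intro sum.cong refl) (simp add: hopf_comult_mult[OF H] i j)
    also have "\<dots> = (\<Sum>k<?d. \<Sum>k'<?d. \<Sum>r<?d. ?\<mu> i j r * (?c r k k' * act M k p1 q1 * act V k' p2 q2))"
      unfolding sum_distrib_right by (intro sum.cong refl) (simp add: mult_ac)
    also have "\<dots> = (\<Sum>r<?d. \<Sum>k<?d. \<Sum>k'<?d. ?\<mu> i j r * (?c r k k' * act M k p1 q1 * act V k' p2 q2))"
      by (rule sum_rotate3[symmetric])
    also have "\<dots> = (\<Sum>r<?d. ?\<mu> i j r * act (tensor_mod H M V) r p q)"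
      unfolding ten sum_distrib_left pq by (rule refl)
    finally show ?thesis .
  qed
  moreover have "(\<Sum>k<?d. hunit H k * act (tensor_mod H M V) k p q) = kd p q"
    if p: "p < ?m*?n" and q: "q < ?m*?n" for p q
  proof -
    define p1 p2 q1 q2 where pq: "p1 = p div ?n" "p2 = p mod ?n" "q1 = q div ?n" "q2 = q mod ?n"
    have b: "p1 < ?m" "p2 < ?n" "q1 < ?m" "q2 < ?n" using rng p q pq by auto
    have "(\<Sum>k<?d. hunit H k * act (tensor_mod H M V) k p q)
        = (\<Sum>k<?d. \<Sum>a<?d. \<Sum>b<?d. (hunit H k * ?c k a b) * (act M a p1 q1 * act V b p2 q2))"
      unfolding ten pq sum_distrib_left by (intro sum.cong refl) (simp add: mult_ac)
    also have "\<dots> = (\<Sum>a<?d. \<Sum>b<?d. \<Sum>k<?d. (hunit H k * ?c k a b) * (act M a p1 q1 * act V b p2 q2))"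
      by (rule sum_rotate3)
    also have "\<dots> = (\<Sum>a<?d. \<Sum>b<?d. (hunit H a * hunit H b) * (act M a p1 q1 * act V b p2 q2))"
      unfolding sum_distrib_right[symmetric] by (intro sum.cong refl) (simp add: hopf_comult_unit[OF H])
    also have "\<dots> = (\<Sum>a<?d. hunit H a * act M a p1 q1) * (\<Sum>b<?d. hunit H b * act V b p2 q2)"
      unfolding sum_product by (intro sum.cong refl) (simp add: mult_ac)
    also have "\<dots> = kd p q"
      unfolding kd_div_mod[of p q ?n] using module_unit[OF M b(1,3)] module_unit[OF V b(2,4)] by (simp add: pq)
    finally show ?thesis .
  qed
  moreover have "mdim (tensor_mod H M V) = ?m * ?n" by (simp add: tensor_mod_def)
  ultimately show ?thesis unfolding is_module_def Let_def by simp
qed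

section \<open>Counting factors along surjective homomorphisms\<close>

lemma matap_comp: "p < m \<Longrightarrow> matap m n F (matap n k G v) p = (\<Sum>q<k. (\<Sum>r<n. F p r * G r q) * v q)"
proof -
  assume "p < m"
  then have "matap m n F (matap n k G v) p = (\<Sum>r<n. \<Sum>q<k. F p r * G r q * v q)"
    by (simp add: matap_def sum_distrib_left mult.assoc)
  also have "\<dots> = (\<Sum>q<k. \<Sum>r<n. F p r * G r q * v q)" by (rule sum.swap)
  finally show ?thesis by (simp add: sum_distrib_right)
qed

lemma actv_matap: "actv M i v = matap (mdim M) (mdim M) (act M i) v"
  by (simp add: actv_def matap_def)

lemma surjective_hom_kernel:
  fixes F :: "nat \<Rightarrow> nat \<Rightarrow> 'f::field"
  assumes surj: "matap (mdim Y) (mdim X) F ` vecs (mdim X) = vecs (mdim Y)"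
    and hom: "\<And>i p q. i < hdim H \<Longrightarrow> p < mdim Y \<Longrightarrow> q < mdim X \<Longrightarrow>
      (\<Sum>r<mdim X. F p r * act X i r q) = (\<Sum>r<mdim Y. act Y i p r * F r q)"
  shows "\<exists>P. submodule_of H X P \<and> sqi H X P (vecs (mdim X)) Y {0} (vecs (mdim Y))"
proof -
  define f where "f = matap (mdim Y) (mdim X) F"
  have f_act: "f (actv X i v) = actv Y i (f v)" if "i < hdim H" for i v
  proof (rule vecs_eqI[of _ "mdim Y"])
    fix p assume "p < mdim Y"
    then show "f (actv X i v) p = actv Y i (f v) p"
      unfolding f_def actv_matap by (simp add: matap_comp hom[OF that])
  qed (simp_all add: f_def matap_vecs)
  define P where "P = {v \<in> vecs (mdim X). f v = 0}"
  have P: "submodule_of H X P"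
  proof (rule submodule_ofI)
    show "actv X i v \<in> P" if "i < hdim H" "v \<in> P" for i v using that f_act by (simp add: P_def)
  qed (auto simp: P_def f_def matap_zero matap_add matap_scl vecs_def)
  have "subquot_iso H X P (vecs (mdim X)) Y"
    unfolding subquot_iso_iff using surj f_act by (intro exI[of _ F]) (simp add: f_def P_def)
  then have "sqi H X P (vecs (mdim X)) Y {0} (vecs (mdim Y))" by (rule subquot_iso_imp_sqi[OF submodule_vecs])
  then show ?thesis using P by blast
qed

text \<open>The chain of \<open>Y\<close> transports to the part of \<open>X\<close> above the
  kernel, and the kernel contributes \<open>u\<close>.\<close>

lemma (in simples) surjective_hom_counts:
  assumes X: "filt H l S X {0} (vecs (mdim X)) x" and Y: "filt H l S Y {0} (vecs (mdim Y)) y"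
    and surj: "matap (mdim Y) (mdim X) F ` vecs (mdim X) = vecs (mdim Y)"
    and hom: "\<And>i p q. i < hdim H \<Longrightarrow> p < mdim Y \<Longrightarrow> q < mdim X \<Longrightarrow>
      (\<Sum>r<mdim X. F p r * act X i r q) = (\<Sum>r<mdim Y. act Y i p r * F r q)"
  shows "\<exists>u. x = (\<lambda>i. u i + y i)"
proof -
  obtain P where P: "submodule_of H X P" "sqi H X P (vecs (mdim X)) Y {0} (vecs (mdim Y))"
    using surjective_hom_kernel[OF surj hom] by blast
  have XP: "filt H l S X P (vecs (mdim X)) y"
    using filt_transport[OF Y P(2,1)] submodule_vecs_subset[OF P(1)] by blast
  obtain u z where uz: "filt H l S X {0} P u" "filt H l S X P (vecs (mdim X)) z" "x = (\<lambda>i. u i + z i)"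
    using filt_split[OF X P(1) _ submodule_vecs_subset[OF P(1)]] submodule_zero_mem[OF P(1)] by blast
  have "z = y" using filt_unique[OF uz(2) XP] .
  then show ?thesis using uz(3) by blast
qed

text \<open>The right inverse \<open>G\<close> makes \<open>F\<close> onto. Equal dimensions then
  leave no factor for the kernel, because every \<open>S i\<close> has positive dimension.\<close>

lemma (in simples) surjective_hom_counts_eq:
  assumes X: "filt H l S X {0} (vecs (mdim X)) x" and Y: "filt H l S Y {0} (vecs (mdim Y)) y"
    and dim: "mdim X = mdim Y"
    and inv: "\<And>p q. p < mdim Y \<Longrightarrow> q < mdim Y \<Longrightarrow> (\<Sum>r<mdim X. F p r * G r q) = kd p q"
    and hom: "\<And>i p q. i < hdim H \<Longrightarrow> p < mdim Y \<Longrightarrow> q < mdim X \<Longrightarrow>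
      (\<Sum>r<mdim X. F p r * act X i r q) = (\<Sum>r<mdim Y. act Y i p r * F r q)"
    and i: "i \<le> l"
  shows "x i = y i"
proof -
  define f where "f = matap (mdim Y) (mdim X) F"
  have f_surj: "f ` vecs (mdim X) = vecs (mdim Y)"
  proof (intro equalityI subsetI)
    fix w :: "nat \<Rightarrow> 'f" assume w: "w \<in> vecs (mdim Y)"
    have "f (matap (mdim X) (mdim Y) G w) = w"
    proof (rule vecs_eqI[OF _ w])
      fix p assume p: "p < mdim Y"
      have "f (matap (mdim X) (mdim Y) G w) p = (\<Sum>q<mdim Y. kd p q * w q)"
        unfolding f_def matap_comp[OF p] using inv[OF p] by simp
      then show "f (matap (mdim X) (mdim Y) G w) p = w p"
        using p by (simp add: kd_def if_distrib[of "\<lambda>t. t * _"] cong: if_cong)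
    qed (simp add: f_def matap_vecs)
    then show "w \<in> f ` vecs (mdim X)" using matap_vecs by (metis imageI)
  qed (auto simp: f_def matap_vecs)
  obtain u where u: "x = (\<lambda>i. u i + y i)"
    using surjective_hom_counts[OF X Y f_surj[unfolded f_def] hom] by blast
  then have "(\<Sum>i\<le>l. u i * mdim (S i)) = 0"
    using filt_dim[OF X] filt_dim[OF Y] dim by (simp add: distrib_right sum.distrib)
  then have "u i = 0" using i irreducible[OF i] by (auto simp: irreducible_mod_def)
  then show ?thesis using u by simp
qed

text \<open>The isomorphism \<open>a \<otimes> v \<mapsto> a\<^sub>1 \<otimes> a\<^sub>2 v\<close> from \<open>A \<otimes> V\<close> with trivial action on \<open>V\<close>
  to \<open>A \<otimes> V\<close>, with inverse \<open>a \<otimes> v \<mapsto> a\<^sub>1 \<otimes> S(a\<^sub>2) v\<close>.\<close>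

definition untwist :: "'f::field hopf_data \<Rightarrow> 'f amod \<Rightarrow> nat \<Rightarrow> nat \<Rightarrow> 'f" where
  "untwist H V P Q = (\<Sum>k<hdim H. hcomult H (Q div mdim V) (P div mdim V) k * act V k (P mod mdim V) (Q mod mdim V))"

definition twist :: "'f::field hopf_data \<Rightarrow> 'f amod \<Rightarrow> nat \<Rightarrow> nat \<Rightarrow> 'f" where
  "twist H V P Q = (\<Sum>k<hdim H. \<Sum>a<hdim H. hcomult H (Q div mdim V) (P div mdim V) k * hantipode H k a
      * act V a (P mod mdim V) (Q mod mdim V))"

text \<open>In Sweedler notation a \<otimes> v goes to a1 \<otimes> a2 S(a3) v, which is a1 eps(a2)
  \<otimes> v = a \<otimes> v. The computation uses the module law, coassociativity, the antipode,
  and finally counit and unit.\<close>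

lemma untwist_twist:
  assumes H: "hopf H" and V: "is_module H V" and P: "P < hdim H * mdim V" and Q: "Q < hdim H * mdim V"
  shows "(\<Sum>R<hdim H * mdim V. untwist H V P R * twist H V R Q) = kd P Q"
proof -
  let ?d = "hdim H" and ?n = "mdim V"
  let ?c = "hcomult H" and ?\<mu> = "hmult H" and ?s = "hantipode H"
  define r b2 q b where pq: "r = P div ?n" "b2 = P mod ?n" "q = Q div ?n" "b = Q mod ?n"
  have rng: "p div ?n < ?d" "p mod ?n < ?n" if "p < ?d * ?n" for p
    using that by (cases ?n, auto simp: less_mult_imp_div_less)+
  have bd: "r < ?d" "b2 < ?n" "q < ?d" "b < ?n" using rng P Q pq by auto
  define W where "W = (\<lambda>k a. \<Sum>t<?d. ?\<mu> k a t * act V t b2 b)"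
  have "(\<Sum>R<?d * ?n. untwist H V P R * twist H V R Q)
      = (\<Sum>p<?d. \<Sum>b'<?n. (\<Sum>k<?d. ?c p r k * act V k b2 b') * (\<Sum>k'<?d. \<Sum>a<?d. ?c q p k' * ?s k' a * act V a b' b))"
    unfolding sum_div_mod by (intro sum.cong refl) (simp add: untwist_def twist_def pq)
  also have "\<dots> = (\<Sum>p<?d. \<Sum>b'<?n. \<Sum>k<?d. \<Sum>k'<?d. \<Sum>a<?d. (?c p r k * act V k b2 b') * (?c q p k' * ?s k' a * act V a b' b))"
    unfolding sum_distrib_right unfolding sum_distrib_left by (rule refl)
  also have "\<dots> = (\<Sum>p<?d. \<Sum>k<?d. \<Sum>k'<?d. \<Sum>a<?d. \<Sum>b'<?n. (?c p r k * act V k b2 b') * (?c q p k' * ?s k' a * act V a b' b))"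
    by (rule sum.cong[OF refl], rule sum_rotate4)
  also have "\<dots> = (\<Sum>p<?d. \<Sum>k<?d. \<Sum>k'<?d. \<Sum>a<?d. (?c q p k' * ?c p r k) * (?s k' a * (\<Sum>b'<?n. act V k b2 b' * act V a b' b)))"
    unfolding sum_distrib_left by (intro sum.cong refl) (simp add: mult_ac)
  also have "\<dots> = (\<Sum>p<?d. \<Sum>k<?d. \<Sum>k'<?d. \<Sum>a<?d. (?c q p k' * ?c p r k) * (?s k' a * W k a))"
    unfolding W_def by (intro sum.cong refl) (simp add: module_assoc[OF V] bd)
  also have "\<dots> = (\<Sum>k<?d. \<Sum>k'<?d. \<Sum>a<?d. \<Sum>p<?d. (?c q p k' * ?c p r k) * (?s k' a * W k a))"
    by (rule sum_rotate4)
  \<comment> \<open>Coassociativity regroups (a1)1, (a1)2, a2 as a1, (a2)1, (a2)2, so that the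
    antipode meets its partner inside one comultiplication.\<close>
  also have "\<dots> = (\<Sum>k<?d. \<Sum>k'<?d. \<Sum>a<?d. (\<Sum>p<?d. ?c q r p * ?c p k k') * (?s k' a * W k a))"
    unfolding sum_distrib_right[symmetric] by (intro sum.cong refl) (simp add: hopf_coassoc[OF H] bd)
  also have "\<dots> = (\<Sum>k<?d. \<Sum>k'<?d. \<Sum>a<?d. \<Sum>p<?d. (?c q r p * ?c p k k') * (?s k' a * W k a))"
    unfolding sum_distrib_right by (rule refl)
  also have "\<dots> = (\<Sum>p<?d. \<Sum>k<?d. \<Sum>k'<?d. \<Sum>a<?d. (?c q r p * ?c p k k') * (?s k' a * W k a))"
    by (rule sum_rotate4[symmetric])
  also have "\<dots> = (\<Sum>p<?d. ?c q r p * (\<Sum>k<?d. \<Sum>k'<?d. \<Sum>a<?d. \<Sum>t<?d. ?c p k k' * ?s k' a * ?\<mu> k a t * act V t b2 b))"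
    unfolding W_def sum_distrib_left by (intro sum.cong refl) (simp add: mult_ac)
  also have "\<dots> = (\<Sum>p<?d. ?c q r p * (\<Sum>t<?d. \<Sum>k<?d. \<Sum>k'<?d. \<Sum>a<?d. ?c p k k' * ?s k' a * ?\<mu> k a t * act V t b2 b))"
    unfolding sum_rotate4[symmetric, where A = "{..<?d}" and B = "{..<?d}" and C = "{..<?d}" and D = "{..<?d}" and
        f = "\<lambda>t k k' a. ?c _ k k' * ?s k' a * ?\<mu> k a t * act V t b2 b"] by (rule refl)
  also have "\<dots> = (\<Sum>p<?d. ?c q r p * (\<Sum>t<?d. (hcounit H p * hunit H t) * act V t b2 b))"
    unfolding sum_distrib_right[symmetric] by (intro sum.cong refl arg_cong2[where f = "(*)"]) (simp add: hopf_antipode_right[OF H])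
  also have "\<dots> = (\<Sum>p<?d. ?c q r p * hcounit H p) * (\<Sum>t<?d. hunit H t * act V t b2 b)"
    unfolding sum_product unfolding sum_distrib_left by (intro sum.cong refl) (simp add: mult_ac)
  also have "\<dots> = kd q r * kd b2 b"
    using hopf_counit_right[OF H bd(3,1)] module_unit[OF V bd(2,4)] by simp
  also have "\<dots> = kd P Q" unfolding kd_div_mod[of P Q ?n] pq by (simp add: kd_def)
  finally show ?thesis .
qed

text \<open>An element b sends a \<otimes> v in the source to ba \<otimes> v, whose image is b1 a1
  \<otimes> b2 a2 v because the comultiplication is multiplicative; this is also b acting diagonally
  on a1 \<otimes> a2 v.\<close>

lemma untwist_hom:
  assumes H: "hopf H" and V: "is_module H V" and i: "i < hdim H"
    and P: "P < hdim H * mdim V" and Q: "Q < hdim H * mdim V"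
  shows "(\<Sum>R<hdim H * mdim V. untwist H V P R * act (tensor_mod H (regular_mod H) (trivials H (mdim V))) i R Q)
    = (\<Sum>R<hdim H * mdim V. act (tensor_mod H (regular_mod H) V) i P R * untwist H V R Q)"
proof -
  let ?d = "hdim H" and ?n = "mdim V"
  let ?c = "hcomult H" and ?\<mu> = "hmult H"
  define p b2 q b' where pq: "p = P div ?n" "b2 = P mod ?n" "q = Q div ?n" "b' = Q mod ?n"
  have rng: "p div ?n < ?d" "p mod ?n < ?n" if "p < ?d * ?n" for p
    using that by (cases ?n, auto simp: less_mult_imp_div_less)+
  have bd: "p < ?d" "b2 < ?n" "q < ?d" "b' < ?n" using rng P Q pq by auto
  \<comment> \<open>The counit removes the second component of the comultiplication, so the source
    carries left multiplication on A only.\<close>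
  have triv: "(\<Sum>j<?d. \<Sum>k<?d. ?c i j k * ?\<mu> j q r * (hcounit H k * kd b b')) = ?\<mu> i q r * kd b b'" for r b
  proof -
    have "(\<Sum>j<?d. \<Sum>k<?d. ?c i j k * ?\<mu> j q r * (hcounit H k * kd b b'))
        = (\<Sum>j<?d. (\<Sum>k<?d. ?c i j k * hcounit H k) * (?\<mu> j q r * kd b b'))"
      unfolding sum_distrib_right by (intro sum.cong refl) (simp add: mult_ac)
    also have "\<dots> = (\<Sum>j<?d. if i = j then ?\<mu> j q r * kd b b' else 0)"
      by (intro sum.cong refl) (simp add: hopf_counit_right[OF H i] kd_def)
    finally show ?thesis using i by simp
  qed
  have "(\<Sum>R<?d * ?n. untwist H V P R * act (tensor_mod H (regular_mod H) (trivials H ?n)) i R Q)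
      = (\<Sum>r<?d. \<Sum>b<?n. (\<Sum>k<?d. ?c r p k * act V k b2 b) * (?\<mu> i q r * kd b b'))"
    unfolding sum_div_mod
    by (intro sum.cong refl) (simp add: untwist_def tensor_mod_def regular_mod_def trivials_def pq[symmetric] triv)
  also have "\<dots> = (\<Sum>r<?d. \<Sum>b<?n. if b = b' then (\<Sum>k<?d. ?c r p k * act V k b2 b) * ?\<mu> i q r else 0)"
    by (intro sum.cong refl) (simp add: kd_def)
  also have "\<dots> = (\<Sum>r<?d. (\<Sum>k<?d. ?c r p k * act V k b2 b') * ?\<mu> i q r)"
    using bd(4) by simp
  finally have L: "(\<Sum>R<?d * ?n. untwist H V P R * act (tensor_mod H (regular_mod H) (trivials H ?n)) i R Q)
      = (\<Sum>r<?d. (\<Sum>k<?d. ?c r p k * act V k b2 b') * ?\<mu> i q r)" .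
  have "(\<Sum>R<?d * ?n. act (tensor_mod H (regular_mod H) V) i P R * untwist H V R Q)
      = (\<Sum>r<?d. \<Sum>b<?n. (\<Sum>j<?d. \<Sum>k<?d. ?c i j k * ?\<mu> j r p * act V k b2 b) * (\<Sum>k'<?d. ?c q r k' * act V k' b b'))"
    unfolding sum_div_mod
    by (intro sum.cong refl) (simp add: untwist_def tensor_mod_def regular_mod_def pq)
  also have "\<dots> = (\<Sum>r<?d. \<Sum>b<?n. \<Sum>j<?d. \<Sum>k<?d. \<Sum>k'<?d. (?c i j k * ?\<mu> j r p * act V k b2 b) * (?c q r k' * act V k' b b'))"
    unfolding sum_distrib_right unfolding sum_distrib_left by (rule refl)
  also have "\<dots> = (\<Sum>r<?d. \<Sum>j<?d. \<Sum>k<?d. \<Sum>k'<?d. \<Sum>b<?n. (?c i j k * ?\<mu> j r p * act V k b2 b) * (?c q r k' * act V k' b b'))"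
    by (rule sum.cong[OF refl], rule sum_rotate4)
  also have "\<dots> = (\<Sum>r<?d. \<Sum>j<?d. \<Sum>k<?d. \<Sum>k'<?d. ?c i j k * ?c q r k' * ?\<mu> j r p * (\<Sum>b<?n. act V k b2 b * act V k' b b'))"
    unfolding sum_distrib_left by (intro sum.cong refl) (simp add: mult_ac)
  also have "\<dots> = (\<Sum>r<?d. \<Sum>j<?d. \<Sum>k<?d. \<Sum>k'<?d. ?c i j k * ?c q r k' * ?\<mu> j r p * (\<Sum>t<?d. ?\<mu> k k' t * act V t b2 b'))"
    by (intro sum.cong refl) (simp add: module_assoc[OF V] bd)
  also have "\<dots> = (\<Sum>r<?d. \<Sum>j<?d. \<Sum>k<?d. \<Sum>k'<?d. \<Sum>t<?d. ?c i j k * ?c q r k' * ?\<mu> j r p * ?\<mu> k k' t * act V t b2 b')"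
    unfolding sum_distrib_left by (intro sum.cong refl) (simp add: mult_ac)
  also have "\<dots> = (\<Sum>j<?d. \<Sum>k<?d. \<Sum>r<?d. \<Sum>k'<?d. \<Sum>t<?d. ?c i j k * ?c q r k' * ?\<mu> j r p * ?\<mu> k k' t * act V t b2 b')"
    by (rule sum_rotate3)
  also have "\<dots> = (\<Sum>t<?d. \<Sum>j<?d. \<Sum>k<?d. \<Sum>r<?d. \<Sum>k'<?d. ?c i j k * ?c q r k' * ?\<mu> j r p * ?\<mu> k k' t * act V t b2 b')"
    by (rule sum_rotate5[symmetric])
  also have "\<dots> = (\<Sum>t<?d. (\<Sum>r<?d. ?\<mu> i q r * ?c r p t) * act V t b2 b')"
    unfolding sum_distrib_right[symmetric] by (intro sum.cong refl) (simp add: hopf_comult_mult[OF H] i bd)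
  also have "\<dots> = (\<Sum>t<?d. \<Sum>r<?d. ?c r p t * act V t b2 b' * ?\<mu> i q r)"
    unfolding sum_distrib_right by (intro sum.cong refl) (simp add: mult_ac)
  also have "\<dots> = (\<Sum>r<?d. \<Sum>t<?d. ?c r p t * act V t b2 b' * ?\<mu> i q r)" by (rule sum.swap)
  finally show ?thesis unfolding L sum_distrib_right by simp
qed

section \<open>The McKay matrix\<close>

text \<open>The ambient modules may differ as long as their actions agree on \<open>Y\<close>: this
  covers a summand inside a direct sum and a module whose action has merely been rewritten.\<close>

lemma sqi_identity:
  assumes Y: "submodule_of H M Y"
    and act: "\<And>i v. i < hdim H \<Longrightarrow> v \<in> Y \<Longrightarrow> actv N i v = actv M i v"
  shows "sqi H M U Y N U Y"
proof (rule sqiI[of _ _ _ "Id_on Y"])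
  show "linrel H M N (Id_on Y)"
    by (rule linrelI) (auto simp: Id_on_iff act submodule_zero_mem[OF Y] submodule_add[OF Y]
      submodule_scl[OF Y] submodule_act[OF Y])
qed auto

lemma sum_lessThan_add: "(\<Sum>q<a+b. f q) = (\<Sum>q<a. f q) + (\<Sum>q<b. f (a + q))"
  for f :: "nat \<Rightarrow> 'a::comm_monoid_add"
  by (induction b) (simp_all add: add.assoc)

text \<open>\<open>V\<close> is the submodule of vectors supported on the first coordinates, and
  dropping these identifies the quotient with \<open>W\<close>; the two chains are then
  concatenated.\<close>

lemma filt_dsum:
  fixes V W :: "'f::field amod"
  assumes V: "filt H l S V {0} (vecs (mdim V)) x" and W: "filt H l S W {0} (vecs (mdim W)) y"
  shows "filt H l S (dsum_mod V W) {0} (vecs (mdim (dsum_mod V W))) (\<lambda>i. x i + y i)"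
proof -
  let ?D = "dsum_mod V W" and ?a = "mdim V" and ?b = "mdim W"
  have mD: "mdim ?D = ?a + ?b" by (simp add: dsum_mod_def)
  have sub_ab: "vecs ?a \<subseteq> (vecs (?a + ?b) :: (nat \<Rightarrow> 'f) set)" by (auto simp: vecs_def)
  have act1: "actv ?D i v = actv V i v" if v: "v \<in> vecs ?a" for i v
  proof (rule vecs_eqI[of _ "?a + ?b"])
    show "actv ?D i v \<in> vecs (?a + ?b)" using actv_vecs[of ?D i v] mD by simp
    show "actv V i v \<in> vecs (?a + ?b)" using sub_ab actv_vecs by blast
    fix p assume "p < ?a + ?b"
    then show "actv ?D i v p = actv V i v p"
      using v by (auto simp: actv_def dsum_mod_def sum_lessThan_add vecs_def)
  qed
  have act2: "actv ?D i v (p + ?a) = actv W i (\<lambda>p. v (p + ?a)) p" for i v p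
    by (simp add: actv_def dsum_mod_def sum_lessThan_add add.commute)
  have sub: "submodule_of H ?D (vecs ?a)"
    by (rule submodule_ofI) (use sub_ab in \<open>auto simp: mD act1 fvs.subspace_add[OF vecs_subspace] fvs.subspace_scale[OF vecs_subspace] fvs.subspace_0[OF vecs_subspace]\<close>)
  have "sqi H ?D {0} (vecs ?a) V {0} (vecs ?a)"
    by (rule sqi_identity[OF sub]) (simp add: act1)
  then have f1: "filt H l S ?D {0} (vecs ?a) x"
    using submodule_zero_mem[OF sub] submodule_vecs_subset[OF sub]
    by (intro filt_transport[OF V _ submodule_0]) auto
  let ?g = "\<lambda>v :: nat \<Rightarrow> 'f. \<lambda>p. v (p + ?a)"
  let ?R = "{(v, w) | v w. v \<in> vecs (?a + ?b) \<and> w = ?g v}"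
  have R_iff: "(v, w) \<in> ?R \<longleftrightarrow> v \<in> vecs (?a + ?b) \<and> w = ?g v" for v w by auto
  have "sqi H ?D (vecs ?a) (vecs (?a + ?b)) W {0} (vecs ?b)"
  proof (rule sqiI[of _ _ _ ?R])
    show "linrel H ?D W ?R"
    proof (rule linrelI, goal_cases)
      case (4 i v w)
      then have "actv W i w = ?g (actv ?D i v)" unfolding R_iff by (auto simp: act2)
      then show ?case unfolding R_iff using actv_vecs[of ?D i v] mD by simp
    qed (auto simp: fun_eq_iff vecs_def)
    show "Domain ?R = vecs (?a + ?b)" by auto
    show "Range ?R = vecs ?b"
    proof (intro equalityI subsetI)
      fix w :: "nat \<Rightarrow> 'f" assume w: "w \<in> vecs ?b"
      have "(\<lambda>p. if p < ?a then 0 else w (p - ?a), w) \<in> ?R"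
        unfolding R_iff using w by (auto simp: vecs_def)
      then show "w \<in> Range ?R" by (rule RangeI)
    next
      fix w :: "nat \<Rightarrow> 'f" assume "w \<in> Range ?R"
      then obtain v where "(v, w) \<in> ?R" by (rule RangeE)
      then show "w \<in> vecs ?b" unfolding R_iff by (auto simp: vecs_def)
    qed
    show "v \<in> vecs ?a \<longleftrightarrow> w \<in> {0}" if "(v, w) \<in> ?R" for v w
    proof -
      have w: "w = ?g v" using that unfolding R_iff by blast
      have "v \<in> vecs ?a \<longleftrightarrow> (\<forall>p. ?g v p = 0)"
        unfolding vecs_def by (auto) (metis le_add_diff_inverse2)
      then show ?thesis unfolding w by (auto simp: fun_eq_iff)
    qed
  qed
  then have "filt H l S ?D (vecs ?a) (vecs (mdim ?D)) y"
    unfolding mD using sub_ab by (intro filt_transport[OF W _ sub]) (auto simp: mD)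
  from filt_append[OF this f1] show ?thesis .
qed

section \<open>Multiplicities over a Hopf algebra\<close>

locale hopf_simples =
  fixes H :: "'f::field hopf_data" and l :: nat and S :: "nat \<Rightarrow> 'f amod"
  assumes hopf: "hopf H" and classes: "simple_classes H l S"
begin

lemma simple_S: "i \<le> l \<Longrightarrow> simple_mod H (S i)"
  using classes by (simp add: simple_classes_def)

lemma module_S: "i \<le> l \<Longrightarrow> is_module H (S i)"
  using simple_S by (simp add: simple_mod_iff)

lemma S_l: "S l = triv_mod H"
  using classes by (simp add: simple_classes_def)

sublocale simples H l S
proof
  show "irreducible_mod H (S i)" if "i \<le> l" for i
    using simple_S[OF that] by (simp add: simple_mod_iff)
  show "i = j" if "i \<le> l" "j \<le> l" "sqi H (S i) {0} (vecs (mdim (S i))) (S j) {0} (vecs (mdim (S j)))" for i j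
    using classes that sqi_imp_mod_iso[OF that(3)] unfolding simple_classes_def by blast
qed

text \<open>Set to 0 beyond \<open>l\<close>, like the counts of a chain, so that
  \<open>mult_eqI\<close> can be an equation of functions.\<close>

definition mults :: "'f amod \<Rightarrow> nat \<Rightarrow> nat" where
  "mults M i = (if i \<le> l then comp_mult H M (S i) else 0)"

lemma mult_eqI:
  assumes "filt H l S M {0} (vecs (mdim M)) x"
  shows "mults M = x"
proof
  fix i show "mults M i = x i"
    using comp_mult_eq[OF assms, of i] filt_support[OF assms, of i] by (simp add: mults_def)
qed

lemma filt_mult:
  assumes "is_module H M"
  shows "filt H l S M {0} (vecs (mdim M)) (mults M)"
proof -
  have "{0} \<subseteq> vecs (mdim M)" by (simp add: vecs_def)
  moreover have "\<exists>i\<le>l. mod_iso H N (S i)" if "simple_mod H N" for N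
    using classes that by (simp add: simple_classes_def)
  ultimately obtain x where "filt H l S M {0} (vecs (mdim M)) x"
    using filt_exists[OF _ assms submodule_0 submodule_vecs] by blast
  then show ?thesis using mult_eqI by simp
qed

lemma mult_S:
  assumes "i \<le> l"
  shows "mults (S i) = (\<lambda>_. 0)(i := 1)"
proof (rule mult_eqI)
  have "sqi H (S i) {0} (vecs (mdim (S i))) (S i) {0} (vecs (mdim (S i)))"
    by (rule sqi_identity[OF submodule_vecs]) simp
  then show "filt H l S (S i) {0} (vecs (mdim (S i))) ((\<lambda>_. 0)(i := 1))"
    using filt.step[OF filt.base[OF submodule_0] submodule_vecs _ assms, where S = S]
    by (simp add: vecs_def)
qed

lemma mult_dim: "is_module H M \<Longrightarrow> mdim M = (\<Sum>i\<le>l. mults M i * mdim (S i))"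
  by (rule filt_dim[OF filt_mult])

lemma filt_tensor_S: "is_module H V \<Longrightarrow> i \<le> l \<Longrightarrow>
    filt H l S (tensor_mod H (S i) V) {0} (vecs (mdim (tensor_mod H (S i) V))) (mults (tensor_mod H (S i) V))"
  by (rule filt_mult[OF is_module_tensor[OF hopf module_S]])

lemma mult_tensor_left:
  assumes "is_module H M" "is_module H V"
  shows "mults (tensor_mod H M V) k = (\<Sum>i\<le>l. mults M i * mults (tensor_mod H (S i) V) k)"
  using mult_eqI[OF filt_tensor_left[OF filt_mult[OF assms(1)] filt_tensor_S[OF assms(2)]]] by simp

text \<open>The second factor enters through a chain instead of the module axioms, since the lemma
  is applied to \<open>trivials\<close>, for which \<open>trivial_flag\<close> supplies a
  chain.\<close>

lemma mult_tensor_right: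
  assumes "filt H l S V {0} (vecs (mdim V)) x" "is_module H M"
  shows "mults (tensor_mod H M V) k = (\<Sum>i\<le>l. x i * mults (tensor_mod H M (S i)) k)"
  using mult_eqI[OF filt_tensor_right[OF assms(1)
      filt_mult[OF is_module_tensor[OF hopf assms(2) module_S]]]] by simp

lemma mult_tensor_triv:
  assumes M: "is_module H M"
  shows "mults (tensor_mod H M (triv_mod H)) = mults M"
proof (rule mult_eqI)
  let ?T = "tensor_mod H M (triv_mod H)"
  have act: "act ?T i p q = act M i p q" if i: "i < hdim H" for i p q
  proof -
    have "act ?T i p q = (\<Sum>j<hdim H. (\<Sum>k<hdim H. hcomult H i j k * hcounit H k) * act M j p q)"
      by (simp add: tensor_mod_def triv_mod_def sum_distrib_left mult_ac)
    also have "\<dots> = (\<Sum>j<hdim H. if i = j then act M j p q else 0)"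
      by (intro sum.cong refl) (simp add: hopf_counit_right[OF hopf i] kd_def)
    finally show ?thesis using i by simp
  qed
  have mT: "mdim ?T = mdim M" by (simp add: tensor_mod_def triv_mod_def)
  have "actv M i v = actv ?T i v" if "i < hdim H" for i v
    unfolding actv_def mT by (simp add: act[OF that] cong: if_cong)
  then have "sqi H ?T {0} (vecs (mdim ?T)) M {0} (vecs (mdim ?T))"
    by (intro sqi_identity[OF submodule_vecs]) simp
  then have s: "sqi H ?T {0} (vecs (mdim ?T)) M {0} (vecs (mdim M))" by (simp only: mT)
  show "filt H l S ?T {0} (vecs (mdim ?T)) (mults M)"
    by (rule filt_transport[OF filt_mult[OF M] s submodule_0]) (auto simp: vecs_def)
qed

text \<open>\<open>F\<close> is the orbit map a \<mapsto> a u of the first basis vector u of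
  \<open>S i\<close>. It is a homomorphism and sends the unit of A to u, so irreducibility makes it
  onto, and \<open>S i\<close> occurs as a quotient of A.\<close>

lemma mult_regular_pos:
  assumes i: "i \<le> l"
  shows "0 < mults (regular_mod H) i"
proof -
  let ?A = "regular_mod H" and ?s = "mdim (S i)"
  have s0: "0 < ?s" using irreducible[OF i] by (simp add: irreducible_mod_def)
  have mA: "mdim ?A = hdim H" by (simp add: regular_mod_def)
  define F where "F = (\<lambda>p q. act (S i) q p 0)"
  have hom: "(\<Sum>r<mdim ?A. F p r * act ?A j r q) = (\<Sum>r<?s. act (S i) j p r * F r q)"
    if "j < hdim H" "p < ?s" "q < mdim ?A" for j p q
  proof -
    have "(\<Sum>r<?s. act (S i) j p r * F r q) = (\<Sum>k<hdim H. hmult H j q k * act (S i) k p 0)"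
      unfolding F_def using that by (intro module_assoc[OF module_S[OF i]]) (simp_all add: mA s0)
    then show ?thesis by (simp add: F_def regular_mod_def mult.commute)
  qed
  let ?f = "matap ?s (mdim ?A) F"
  have "submodule_of H (S i) (?f ` vecs (mdim ?A))"
  proof (rule submodule_ofI)
    show "?f ` vecs (mdim ?A) \<subseteq> vecs ?s" by (auto simp: matap_vecs)
    show "0 \<in> ?f ` vecs (mdim ?A)" by (rule image_eqI[of _ _ 0]) (simp_all add: matap_zero vecs_def)
    show "v + w \<in> ?f ` vecs (mdim ?A)" if "v \<in> ?f ` vecs (mdim ?A)" "w \<in> ?f ` vecs (mdim ?A)" for v w
    proof -
      obtain x y where xy: "v = ?f x" "x \<in> vecs (mdim ?A)" "w = ?f y" "y \<in> vecs (mdim ?A)" using \<open>v \<in> _\<close> \<open>w \<in> _\<close> by blast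
      show ?thesis by (rule image_eqI[of _ _ "x + y"])
        (use xy fvs.subspace_add[OF vecs_subspace] in \<open>auto simp: matap_add\<close>)
    qed
    show "scl a v \<in> ?f ` vecs (mdim ?A)" if v: "v \<in> ?f ` vecs (mdim ?A)" for a v
    proof -
      obtain x where x: "v = ?f x" "x \<in> vecs (mdim ?A)" using v by blast
      show ?thesis by (rule image_eqI[of _ _ "scl a x"])
        (use x fvs.subspace_scale[OF vecs_subspace] in \<open>auto simp: matap_scl\<close>)
    qed
    show "actv (S i) j v \<in> ?f ` vecs (mdim ?A)" if j: "j < hdim H" and v: "v \<in> ?f ` vecs (mdim ?A)" for j v
    proof -
      obtain x where x: "v = ?f x" using v by blast
      have eq: "?f (actv ?A j x) = actv (S i) j (?f x)"
      proof (rule vecs_eqI[OF matap_vecs actv_vecs])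
        fix p assume "p < ?s"
        then show "?f (actv ?A j x) p = actv (S i) j (?f x) p"
          unfolding actv_matap by (simp add: matap_comp hom[OF j])
      qed
      show ?thesis unfolding x by (rule rev_image_eqI[of "actv ?A j x"], rule actv_vecs, rule eq[symmetric])
    qed
  qed
  moreover have "?f ` vecs (mdim ?A) \<noteq> {0}"
  proof
    assume z: "?f ` vecs (mdim ?A) = {0}"
    \<comment> \<open>The coordinates of the unit of A; the image under the orbit map has first
      entry 1.\<close>
    define u where "u = (\<lambda>k. if k < hdim H then hunit H k else 0)"
    have "u \<in> vecs (mdim ?A)" by (simp add: u_def vecs_def mA)
    then have "?f u = 0" using z by blast
    moreover have "?f u 0 = (\<Sum>k<hdim H. hunit H k * act (S i) k 0 0)"
      using s0 by (simp add: matap_def mA F_def u_def mult.commute)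
    ultimately show False using module_unit[OF module_S[OF i] s0 s0] by (simp add: kd_def)
  qed
  ultimately have surj: "?f ` vecs (mdim ?A) = vecs ?s"
    using irreducible[OF i] unfolding irreducible_mod_def by blast
  obtain u where "mults ?A = (\<lambda>j. u j + mults (S i) j)"
    using surjective_hom_counts[OF filt_mult[OF is_module_regular[OF hopf]] filt_mult[OF module_S[OF i]] surj hom] by blast
  then show ?thesis by (simp add: mult_S[OF i])
qed

text \<open>Straightening replaces V by \<open>trivials\<close>, which has \<open>mdim V\<close>
  trivial factors; each contributes one copy of the regular module.\<close>

lemma mult_regular_tensor:
  assumes V: "is_module H V" and i: "i \<le> l"
  shows "mults (tensor_mod H (regular_mod H) V) i = mdim V * mults (regular_mod H) i"
proof -
  let ?A = "regular_mod H" and ?T = "trivials H (mdim V)"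
  have A: "is_module H ?A" by (rule is_module_regular[OF hopf])
  have "filt H l S ?T (vecs 0) (vecs (mdim V)) (\<lambda>j. if j = l then mdim V else 0)"
    by (rule trivial_flag) (simp_all add: trivials_def S_l)
  then have T: "filt H l S ?T {0} (vecs (mdim ?T)) (\<lambda>j. if j = l then mdim V else 0)"
    by (simp add: vecs_zero trivials_def)
  have "mults (tensor_mod H ?A ?T) i = (\<Sum>j\<le>l. (if j = l then mdim V else 0) * mults (tensor_mod H ?A (S j)) i)"
    by (rule mult_tensor_right[OF T A])
  also have "\<dots> = (\<Sum>j\<le>l. if j = l then mdim V * mults (tensor_mod H ?A (S j)) i else 0)"
    by (intro sum.cong refl) simp
  also have "\<dots> = mdim V * mults ?A i" by (simp add: S_l mult_tensor_triv[OF A])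
  finally have e: "mults (tensor_mod H ?A ?T) i = mdim V * mults ?A i" .
  have f: "filt H l S (tensor_mod H ?A ?T) {0} (vecs (mdim (tensor_mod H ?A ?T)))
      (\<lambda>k. \<Sum>i\<le>l. (if i = l then mdim V else 0) * mults (tensor_mod H ?A (S i)) k)"
    by (rule filt_tensor_right[OF T filt_mult[OF is_module_tensor[OF hopf A module_S]]])
  have fT: "filt H l S (tensor_mod H ?A ?T) {0} (vecs (mdim (tensor_mod H ?A ?T))) (mults (tensor_mod H ?A ?T))"
    using f unfolding mult_eqI[OF f] .
  have dims: "mdim (tensor_mod H ?A ?T) = hdim H * mdim V" "mdim (tensor_mod H ?A V) = hdim H * mdim V"
    by (simp_all add: tensor_mod_def regular_mod_def trivials_def)
  have "mults (tensor_mod H ?A ?T) i = mults (tensor_mod H ?A V) i"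
    by (rule surjective_hom_counts_eq[OF fT filt_mult[OF is_module_tensor[OF hopf A V]] _ _ _ i,
          where F = "untwist H V" and G = "twist H V"])
      (simp_all add: dims untwist_twist[OF hopf V] untwist_hom[OF hopf V])
  then show ?thesis using e by simp
qed

text \<open>\<open>s_M\<close> is multiplicativity of dimension, and \<open>M_c\<close> is
  \<open>mult_regular_tensor\<close> expanded along the factors of the regular module. The
  identities hold in \<open>nat\<close> and are cast to an arbitrary target, later
  \<open>int\<close> and \<open>real\<close>.\<close>

lemma positive_kernel_mckay:
  assumes V: "is_module H V"
  shows "positive_kernel l (of_nat (mdim V)) (\<lambda>i j. of_nat (mults (tensor_mod H (S j) V) i))
    (\<lambda>i. of_nat (mdim (S i))) (\<lambda>i. of_nat (mults (regular_mod H) i) :: 'b::linordered_idom)"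
proof (unfold_locales, goal_cases)
  case (2 i)
  then show ?case using irreducible[OF 2] by (simp add: irreducible_mod_def)
next
  case (3 i)
  then show ?case using mult_regular_pos by simp
next
  case (4 j)
  have "mdim (tensor_mod H (S j) V) = (\<Sum>i\<le>l. mults (tensor_mod H (S j) V) i * mdim (S i))"
    by (rule mult_dim[OF is_module_tensor[OF hopf module_S[OF 4] V]])
  moreover have "mdim (tensor_mod H (S j) V) = mdim (S j) * mdim V" by (simp add: tensor_mod_def)
  ultimately have "(\<Sum>i\<le>l. mdim (S i) * mults (tensor_mod H (S j) V) i) = mdim V * mdim (S j)"
    by (simp add: mult.commute)
  then have "(of_nat (\<Sum>i\<le>l. mdim (S i) * mults (tensor_mod H (S j) V) i) :: 'b) = of_nat (mdim V * mdim (S j))"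
    by simp
  then show ?case by simp
next
  case (5 i)
  have "(\<Sum>j\<le>l. mults (regular_mod H) j * mults (tensor_mod H (S j) V) i) = mdim V * mults (regular_mod H) i"
    using mult_tensor_left[OF is_module_regular[OF hopf] V] mult_regular_tensor[OF V 5] by simp
  then have "(of_nat (\<Sum>j\<le>l. mults (regular_mod H) j * mults (tensor_mod H (S j) V) i) :: 'b)
      = of_nat (mdim V * mults (regular_mod H) i)" by simp
  then show ?case by (simp add: mult.commute)
qed simp

lemma is_module_tensor_pow: "is_module H V \<Longrightarrow> is_module H (tensor_pow H V k)"
  by (induction k) (simp_all add: is_module_triv[OF hopf] is_module_tensor[OF hopf])

lemma mult_tensor_pow_sum:
  assumes V: "is_module H V"
  shows "mults (tensor_pow_sum H V t) i = (\<Sum>k\<le>t. mults (tensor_pow H V k) i)"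
proof -
  have "filt H l S (tensor_pow_sum H V t) (vecs 0) (vecs (mdim (tensor_pow_sum H V t)))
      (\<lambda>i. \<Sum>k\<le>t. mults (tensor_pow H V k) i)"
  proof (induction t)
    case 0
    then show ?case using filt_mult[OF is_module_tensor_pow[OF V], of 0] by (simp add: vecs_zero)
  next
    case (Suc t)
    show ?case
      using filt_dsum[OF Suc[unfolded vecs_zero] filt_mult[OF is_module_tensor_pow[OF V, of "Suc t"]]]
      unfolding vecs_zero tensor_pow_sum.simps sum.atMost_Suc .
  qed
  then show ?thesis using mult_eqI unfolding vecs_zero by metis
qed

lemma tensor_rich_iff_mult:
  assumes V: "is_module H V"
  shows "tensor_rich H l S V \<longleftrightarrow> (\<exists>t>0. \<forall>i\<le>l. \<exists>k\<le>t. 0 < mults (tensor_pow H V k) i)"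
proof -
  have "rich H l S (tensor_pow_sum H V t) \<longleftrightarrow> (\<forall>i\<le>l. \<exists>k\<le>t. 0 < mults (tensor_pow H V k) i)" for t
  proof -
    have "rich H l S (tensor_pow_sum H V t) \<longleftrightarrow> (\<forall>i\<le>l. mults (tensor_pow_sum H V t) i > 0)"
      by (simp add: rich_def mults_def)
    also have "\<dots> \<longleftrightarrow> (\<forall>i\<le>l. \<exists>k\<le>t. 0 < mults (tensor_pow H V k) i)"
      unfolding mult_tensor_pow_sum[OF V] by (auto simp: sum_nonneg_0 simp flip: neq0_conv)
    finally show ?thesis .
  qed
  then show ?thesis by (simp add: tensor_rich_def)
qed

text \<open>Summing \<open>[W : S k]\<close> times \<open>[S j \<otimes> S k : S i]\<close> over
  \<open>k\<close> gives \<open>[S j \<otimes> W : S i]\<close>, so multiplication by n - [V] in the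
  Grothendieck group is the Laplacian acting on coefficient vectors.\<close>

lemma gmul_crit:
  assumes V: "is_module H V"
  shows "gmul H l S x (\<lambda>i. int (mdim V) * gclass H l S (triv_mod H) i - gclass H l S V i)
    = (\<lambda>i. if i \<le> l then int (mdim V) * x i - (\<Sum>j\<le>l. int (mults (tensor_mod H (S j) V) i) * x j) else 0)"
proof
  fix i
  let ?n = "int (mdim V)"
  show "gmul H l S x (\<lambda>i. ?n * gclass H l S (triv_mod H) i - gclass H l S V i) i
    = (if i \<le> l then ?n * x i - (\<Sum>j\<le>l. int (mults (tensor_mod H (S j) V) i) * x j) else 0)"
  proof (cases "i \<le> l")
    case i: True
    have inner: "(\<Sum>k\<le>l. gclass H l S W k * int (mults (tensor_mod H (S j) (S k)) i)) = int (mults (tensor_mod H (S j) W) i)"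
      if "j \<le> l" "is_module H W" for j W
      using mult_tensor_right[OF filt_mult[OF that(2)] module_S[OF that(1)], of i]
      by (simp add: gclass_def mults_def)
    have triv: "int (mults (tensor_mod H (S j) (triv_mod H)) i) = (if i = j then 1 else 0)" if "j \<le> l" for j
      by (simp add: mult_tensor_triv[OF module_S[OF that]] mult_S[OF that])
    have "gmul H l S x (\<lambda>i. ?n * gclass H l S (triv_mod H) i - gclass H l S V i) i
      = (\<Sum>j\<le>l. x j * (?n * (\<Sum>k\<le>l. gclass H l S (triv_mod H) k * int (mults (tensor_mod H (S j) (S k)) i))
          - (\<Sum>k\<le>l. gclass H l S V k * int (mults (tensor_mod H (S j) (S k)) i))))"
      using i by (simp add: gmul_def mults_def sum_distrib_left sum_subtractf algebra_simps)
    also have "\<dots> = (\<Sum>j\<le>l. x j * (?n * (if i = j then 1 else 0) - int (mults (tensor_mod H (S j) V) i)))"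
      by (intro sum.cong refl) (simp add: inner[OF _ V] inner[OF _ is_module_triv[OF hopf]] triv)
    also have "\<dots> = (\<Sum>j\<le>l. if i = j then ?n * x j else 0) - (\<Sum>j\<le>l. int (mults (tensor_mod H (S j) V) i) * x j)"
      unfolding sum_subtractf[symmetric] by (intro sum.cong refl) (simp add: algebra_simps)
    finally show ?thesis using i by simp
  qed (simp add: gmul_def)
qed

end

section \<open>Equivalence of the five conditions\<close>

theorem theorem1p4:
  fixes H :: "'f::field hopf_data" and l :: nat and S :: "nat \<Rightarrow> 'f amod" and V :: "'f amod"
  assumes "alg_closed_field TYPE('f)"
    and "hopf H"
    and "simple_classes H l S"
    and "is_module H V"
  shows "(nonsingular_M_matrix (map_mat real_of_int (red_laplacian H l S V))
            \<longleftrightarrow> det (red_laplacian H l S V) \<noteq> 0)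
       \<and> (det (red_laplacian H l S V) \<noteq> 0
            \<longleftrightarrow> vec_space.rank (l+1) (map_mat real_of_int (laplacian H l S V)) = l)
       \<and> (vec_space.rank (l+1) (map_mat real_of_int (laplacian H l S V)) = l
            \<longleftrightarrow> finite (critical_group H l S V))
       \<and> (finite (critical_group H l S V) \<longleftrightarrow> tensor_rich H l S V)"
proof -
  interpret hopf_simples H l S using assms(2,3) by unfold_locales
  let ?M = "\<lambda>i j. mults (tensor_mod H (S j) V) i"
  let ?n = "mdim V"
  note V = assms(4)
  \<comment> \<open>Two instances of the same data: determinant, critical group and tensor powers
    are treated over the integers, rank and inverse over the reals.\<close>
  interpret Z: positive_kernel l "int ?n" "\<lambda>i j. int (?M i j)" "\<lambda>i. int (mdim (S i))" "\<lambda>i. int (mults (regular_mod H) i)"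
    using positive_kernel_mckay[OF V, where 'b = int] by simp
  interpret Q: positive_kernel l "real ?n" "\<lambda>i j. real (?M i j)" "\<lambda>i. real (mdim (S i))" "\<lambda>i. real (mults (regular_mod H) i)"
    using positive_kernel_mckay[OF V, where 'b = real] by simp
  have red: "red_laplacian H l S V = Z.red"
    unfolding Z.red_def by (rule eq_matI) (auto simp: red_laplacian_def laplacian_def mckay_def mults_def)
  have lap: "map_mat real_of_int (laplacian H l S V) = Q.lap"
    unfolding Q.lap_def by (rule eq_matI) (auto simp: laplacian_def mckay_def mults_def)
  have redQ: "map_mat real_of_int Z.red = Q.red"
    by (rule eq_matI) (auto simp: Z.red_def Q.red_def)
  have detQ: "det Q.red = real_of_int (det Z.red)"
    unfolding redQ[symmetric] by (rule of_int_hom.hom_det)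
  \<comment> \<open>From here each condition is compared with
    \<open>det Z.red \<noteq> 0\<close>.\<close>
  have i: "nonsingular_M_matrix Q.red \<longleftrightarrow> det Z.red \<noteq> 0"
  proof
    assume "nonsingular_M_matrix Q.red"
    then obtain B where B: "B \<in> carrier_mat l l" "Q.red * B = 1\<^sub>m l"
      unfolding nonsingular_M_matrix_def inverts_mat_def using Q.red_carrier by auto
    have "det Q.red * det B = 1" using det_mult[OF Q.red_carrier B(1)] B(2) by simp
    then show "det Z.red \<noteq> 0" using detQ by auto
  next
    assume d: "det Z.red \<noteq> 0"
    let ?d = "real_of_int (det Z.red)"
    have adj: "adj_mat Z.red \<in> carrier_mat l l" "Z.red * adj_mat Z.red = det Z.red \<cdot>\<^sub>m 1\<^sub>m l"
        "adj_mat Z.red * Z.red = det Z.red \<cdot>\<^sub>m 1\<^sub>m l"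
      using adj_mat[OF Z.red_carrier] by auto
    \<comment> \<open>The inverse is built from the integral adjugate, whose sign pattern
      \<open>signed_adj_nonneg\<close> provides.\<close>
    define A where "A = map_mat real_of_int (adj_mat Z.red)"
    have A: "A \<in> carrier_mat l l" using adj(1) by (simp add: A_def)
    have "Q.red * A = map_mat real_of_int (Z.red * adj_mat Z.red)"
      unfolding A_def redQ[symmetric] by (rule of_int_hom.mat_hom_mult[OF Z.red_carrier adj(1), symmetric])
    also have "\<dots> = ?d \<cdot>\<^sub>m 1\<^sub>m l" unfolding adj(2) by (rule eq_matI) auto
    finally have QA: "Q.red * A = ?d \<cdot>\<^sub>m 1\<^sub>m l" .
    have "A * Q.red = map_mat real_of_int (adj_mat Z.red * Z.red)"
      unfolding A_def redQ[symmetric] by (rule of_int_hom.mat_hom_mult[OF adj(1) Z.red_carrier, symmetric])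
    also have "\<dots> = ?d \<cdot>\<^sub>m 1\<^sub>m l" unfolding adj(3) by (rule eq_matI) auto
    finally have AQ: "A * Q.red = ?d \<cdot>\<^sub>m 1\<^sub>m l" .
    define B where "B = (1 / ?d) \<cdot>\<^sub>m A"
    have B: "B \<in> carrier_mat l l" using A by (simp add: B_def)
    have "Q.red * B = 1\<^sub>m l"
      unfolding B_def mult_smult_distrib[OF Q.red_carrier A] QA using d by (auto intro!: eq_matI)
    moreover have "B * Q.red = 1\<^sub>m l"
      unfolding B_def mult_smult_assoc_mat[OF A Q.red_carrier] AQ using d by (auto intro!: eq_matI)
    moreover have "0 \<le> B $$ (i, j)" if ij: "i < l" "j < l" for i j
    proof -
      \<comment> \<open>Multiplying by the sign of the determinant and dividing by the determinant
        produce the same sign.\<close>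
      have "0 \<le> real_of_int (sgn (det Z.red) * adj_mat Z.red $$ (i, j))"
        using Z.signed_adj_nonneg[OF d ij] by linarith
      then have "0 \<le> real_of_int (sgn (det Z.red)) * real_of_int (adj_mat Z.red $$ (i, j))" by simp
      moreover have "B $$ (i, j) = real_of_int (adj_mat Z.red $$ (i, j)) / ?d"
        using ij A adj(1) by (simp add: B_def A_def)
      ultimately show ?thesis using d by (auto simp: sgn_if zero_le_divide_iff split: if_splits)
    qed
    moreover have "Q.red $$ (i, j) \<le> 0" if "i < l" "j < l" "i \<noteq> j" for i j
      using that by (simp add: Q.red_def)
    moreover have "dim_row Q.red = l" "dim_col Q.red = l"
      by (rule carrier_matD[OF Q.red_carrier])+
    ultimately show "nonsingular_M_matrix Q.red"
      unfolding nonsingular_M_matrix_def inverts_mat_def using B by auto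
  qed
  have iii: "vec_space.rank (l+1) Q.lap = l \<longleftrightarrow> det Z.red \<noteq> 0"
    using rank_lap_iff[OF Q.positive_kernel_axioms] detQ by simp
  have "aug_ideal l S = augmentation_kernel l (\<lambda>i. int (mdim (S i)))"
    by (simp add: aug_ideal_def G0_def augmentation_kernel_def)
  moreover have "crit_rel H l S V = laplacian_image l (int ?n) (\<lambda>i j. int (?M i j))"
    unfolding crit_rel_def laplacian_image_def gmul_crit[OF V] G0_def by simp
  ultimately have "critical_group H l S V = (\<lambda>x. {(\<lambda>i. x i + y i) | y. y \<in> laplacian_image l (int ?n) (\<lambda>i j. int (?M i j))})
      ` augmentation_kernel l (\<lambda>i. int (mdim (S i)))"
    by (simp only: critical_group_def)
  moreover have "int (mdim (S l)) = 1" by (simp add: S_l triv_mod_def)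
  ultimately have iv: "finite (critical_group H l S V) \<longleftrightarrow> det Z.red \<noteq> 0"
    using finite_quotient_iff[OF Z.positive_kernel_axioms] by simp
  have "mults (tensor_pow H V 0) i = (if i = l then 1 else 0)" for i
    using mult_S[of l] by (simp add: S_l)
  moreover have "mults (tensor_pow H V (Suc k)) i = (\<Sum>j\<le>l. ?M i j * mults (tensor_pow H V k) j)" for k i
    using mult_tensor_left[OF is_module_tensor_pow[OF V] V] by (simp add: mult.commute)
  ultimately have v: "tensor_rich H l S V \<longleftrightarrow> det Z.red \<noteq> 0"
    using Z.tensor_rich_iff[of "\<lambda>k i. int (mults (tensor_pow H V k) i)"]
    unfolding tensor_rich_iff_mult[OF V] by simp
  show ?thesis unfolding red redQ lap i iii iv v by simp
qed

end
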